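(* Let $\mathcal C$ be a symmetric monoidal category satisfying the standing assumptions in the context, let $R=\mathrm{End}_{\mathcal C}(\mathbf 1)$ (a commutative ring), and let $(V,|0\rangle,T,Y)$ be a vertex algebra in $\mathcal C$. Then $\widetilde V:=\mathrm{Hom}_{\mathcal C}(\mathbf 1,V)$ has the structure of a vertex algebra over $R$, defined as follows: the vacuum vector is $|0\rangle\in\widetilde V$; the translation operator $\widetilde T$ sends $\alpha\in\widetilde V$ to $T\circ\alpha$; and $\widetilde Y(z):\widetilde V\otimes_R\widetilde V\to\widetilde V((z))$ is given by the products $\alpha\cdot_n\beta$ ($n\in\mathbb Z$), where for $\alpha,\beta\in\widetilde V$ the element $\alpha\cdot_n\beta$ is the composition $\mathbf 1\cong\mathbf 1\otimes\mathbf 1\xrightarrow{\alpha\otimes\beta}V\otimes V\xrightarrow{\cdot_n}V$.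
   Context: Standing assumptions on $\mathcal C$: $(\mathcal C,\otimes,\mathbf 1)$ is a symmetric monoidal category with unit isomorphisms $l_X:\mathbf 1\otimes X\to X$, $r_X:X\otimes\mathbf 1\to X$ and symmetric braiding $\sigma$ (associators are suppressed) such that (i) $\mathcal C\cong\mathrm{Ind}(\mathcal C_0)$ for a symmetric monoidal category $\mathcal C_0$, and $(\mathrm{colim}\,X_a)\otimes(\mathrm{colim}\,Y_b)=\mathrm{colim}(X_a\otimes Y_b)$; (ii) $\mathcal C_0$ is additive, Karoubian (every idempotent splits) and rigid symmetric monoidal; (iii) $\mathbb Q\subset\mathrm{End}_{\mathcal C}(\mathbf 1)$. An object $X$ is compact if $\mathrm{Hom}_{\mathcal C}(X,-)$ preserves filtered colimits. A vertex algebra in $\mathcal C$ is an object $V$ with morphisms $|0\rangle\in\mathrm{Hom}_{\mathcal C}(\mathbf 1,V)$, $T\in\mathrm{Hom}_{\mathcal C}(V,V)$, and $\cdot_n\in\mathrm{Hom}_{\mathcal C}(V\otimes V,V)$ for $n\in\mathbb Z$, with $Y(z)=\sum_n\cdot_n z^{-n-1}$, such that for all compact $X,X'$ and $\alpha:X\to V$, $\beta:X'\to V$ there is $K$ with $\cdot_n\circ(\alpha\otimes\beta)=0$ for all $n\ge K$, and satisfying: (Vacuum) $Y(z)\circ(|0\rangle\otimes\mathrm{id}_V)=l_V$; $Y(z)\circ(\mathrm{id}_V\otimes|0\rangle)\in\mathrm{Hom}_{\mathcal C}(V\otimes\mathbf 1,V)[[z]]$ with value $r_V$ at $z=0$. (Translation)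 $T\circ|0\rangle=0$ and $T\circ Y(z)-Y(z)\circ(\mathrm{id}_V\otimes T)=\partial_zY(z)$. (Locality) for all compact $X,X'$ and $\alpha:X\to V$, $\beta:X'\to V$ there is an integer $K$ with $(z-w)^K\big(Y(w)\circ(\mathrm{id}_V\otimes Y(z))\circ(\alpha\otimes\beta\otimes\mathrm{id}_V)-Y(z)\circ(\mathrm{id}_V\otimes Y(w))\circ(\sigma\otimes\mathrm{id}_V)\circ(\alpha\otimes\beta\otimes\mathrm{id}_V)\big)=0$. A vertex algebra over a commutative ring $R\supset\mathbb Q$ is an $R$-module $W$ with $|0\rangle\in W$, an $R$-linear $T:W\to W$, and $R$-bilinear products $\cdot_n$ ($n\in\mathbb Z$) with $u\cdot_nv=0$ for $n\gg0$ (depending on $u,v$); with $Y(u,z)v=\sum_n u\cdot_nv\,z^{-n-1}$ one requires $Y(|0\rangle,z)u=u$, $Y(u,z)|0\rangle\in u+zW[[z]]$, $T|0\rangle=0$, $[T,Y(u,z)]=\partial_zY(u,z)$, and for all $u,v$ some $K$ with $(z-w)^K[Y(u,z),Y(v,w)]=0$. *)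

theory Defs
  imports Complex_Main "HOL-Algebra.Module"
begin

unbundle cardinal_syntax

section \<open>Categories and functors\<close>

record ('o, 'a) cat =
  Obj :: "'o set"
  Arr :: "'a set"
  Src :: "'a \<Rightarrow> 'o"
  Tgt :: "'a \<Rightarrow> 'o"
  Idn :: "'o \<Rightarrow> 'a"
  Comp :: "'a \<Rightarrow> 'a \<Rightarrow> 'a" (infixl "\<bullet>\<index>" 70)

definition Hom :: "('o, 'a, 'm) cat_scheme \<Rightarrow> 'o \<Rightarrow> 'o \<Rightarrow> 'a set" where
  "Hom C X Y = {f \<in> Arr C. Src C f = X \<and> Tgt C f = Y}"

locale category =
  fixes C :: "('o, 'a, 'm) cat_scheme" (structure)
  assumes src_closed: "f \<in> Arr C \<Longrightarrow> Src C f \<in> Obj C"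
    and tgt_closed: "f \<in> Arr C \<Longrightarrow> Tgt C f \<in> Obj C"
    and idn_closed: "X \<in> Obj C \<Longrightarrow> Idn C X \<in> Hom C X X"
    and comp_closed: "\<lbrakk>f \<in> Hom C X Y; g \<in> Hom C Y Z\<rbrakk> \<Longrightarrow> g \<bullet> f \<in> Hom C X Z"
    and comp_assoc: "\<lbrakk>f \<in> Hom C W X; g \<in> Hom C X Y; h \<in> Hom C Y Z\<rbrakk>
        \<Longrightarrow> (h \<bullet> g) \<bullet> f = h \<bullet> (g \<bullet> f)"
    and idn_left: "f \<in> Hom C X Y \<Longrightarrow> Idn C Y \<bullet> f = f"
    and idn_right: "f \<in> Hom C X Y \<Longrightarrow> f \<bullet> Idn C X = f"

definition inverse_arrows :: "('o, 'a, 'm) cat_scheme \<Rightarrow> 'a \<Rightarrow> 'a \<Rightarrow> bool" where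
  "inverse_arrows C f g \<longleftrightarrow> f \<in> Arr C \<and> g \<in> Hom C (Tgt C f) (Src C f) \<and>
     g \<bullet>\<^bsub>C\<^esub> f = Idn C (Src C f) \<and> f \<bullet>\<^bsub>C\<^esub> g = Idn C (Tgt C f)"

definition iso_arrow :: "('o, 'a, 'm) cat_scheme \<Rightarrow> 'a \<Rightarrow> bool" where
  "iso_arrow C f \<longleftrightarrow> (\<exists>g. inverse_arrows C f g)"

definition inv_arrow :: "('o, 'a, 'm) cat_scheme \<Rightarrow> 'a \<Rightarrow> 'a" where
  "inv_arrow C f = (THE g. inverse_arrows C f g)"

record ('o, 'a, 'p, 'b) funct =
  fobj :: "'o \<Rightarrow> 'p"
  farr :: "'a \<Rightarrow> 'b"

locale cat_functor = D: category D + E: category E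
  for D :: "('o, 'a, 'm) cat_scheme" and E :: "('p, 'b, 'n) cat_scheme"
    and F :: "('o, 'a, 'p, 'b) funct" +
  assumes fobj_closed: "X \<in> Obj D \<Longrightarrow> fobj F X \<in> Obj E"
    and farr_closed: "f \<in> Hom D X Y \<Longrightarrow> farr F f \<in> Hom E (fobj F X) (fobj F Y)"
    and farr_idn: "X \<in> Obj D \<Longrightarrow> farr F (Idn D X) = Idn E (fobj F X)"
    and farr_comp: "\<lbrakk>f \<in> Hom D X Y; g \<in> Hom D Y Z\<rbrakk>
        \<Longrightarrow> farr F (g \<bullet>\<^bsub>D\<^esub> f) = farr F g \<bullet>\<^bsub>E\<^esub> farr F f"

locale equivalence_functor = cat_functor +
  assumes fully_faithful: "\<lbrakk>X \<in> Obj D; Y \<in> Obj D\<rbrakk>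
        \<Longrightarrow> bij_betw (farr F) (Hom D X Y) (Hom E (fobj F X) (fobj F Y))"
    and essentially_surjective: "Z \<in> Obj E
        \<Longrightarrow> \<exists>X\<in>Obj D. \<exists>f\<in>Hom E (fobj F X) Z. iso_arrow E f"

definition comp_funct ::
    "('p, 'b, 'q, 'c) funct \<Rightarrow> ('o, 'a, 'p, 'b) funct \<Rightarrow> ('o, 'a, 'q, 'c) funct" where
  "comp_funct G F = \<lparr>fobj = fobj G \<circ> fobj F, farr = farr G \<circ> farr F\<rparr>"

definition prod_cat :: "('i, 'j) cat \<Rightarrow> ('k, 'l) cat \<Rightarrow> ('i \<times> 'k, 'j \<times> 'l) cat" where
  "prod_cat I J = \<lparr>Obj = Obj I \<times> Obj J, Arr = Arr I \<times> Arr J,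
     Src = map_prod (Src I) (Src J), Tgt = map_prod (Tgt I) (Tgt J),
     Idn = map_prod (Idn I) (Idn J),
     Comp = (\<lambda>(u, v) (u', v'). (u \<bullet>\<^bsub>I\<^esub> u', v \<bullet>\<^bsub>J\<^esub> v'))\<rparr>"


section \<open>Filtered colimits and compact objects\<close>

text \<open>
  The type \<^typ>\<open>'i\<close> plays the role of the universe with respect to which index categories are
  small: a set is small if its cardinality is less than that of \<^typ>\<open>'i\<close>. All that is ever asked
  of \<^typ>\<open>'i\<close> is that its cardinality be infinite and regular; a Grothendieck universe is the
  special case in which it is strongly inaccessible. Every small category is isomorphic to one whose
  objects and arrows are elements of \<^typ>\<open>'i\<close>.
\<close>

definition universe :: "'i itself \<Rightarrow> bool" where
  "universe _ \<longleftrightarrow> infinite (UNIV :: 'i set) \<and> regularCard |UNIV :: 'i set|"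

definition small :: "'i itself \<Rightarrow> 'x set \<Rightarrow> bool" where
  "small _ A \<longleftrightarrow> |A| <o |UNIV :: 'i set|"

locale small_filtered = category J for J :: "('i, 'i) cat" (structure) +
  assumes small_obj: "small TYPE('i) (Obj J)"
    and small_arr: "small TYPE('i) (Arr J)"
    and nonempty: "Obj J \<noteq> {}"
    and upper_bound: "\<lbrakk>j \<in> Obj J; k \<in> Obj J\<rbrakk>
        \<Longrightarrow> \<exists>l\<in>Obj J. Hom J j l \<noteq> {} \<and> Hom J k l \<noteq> {}"
    and coequalized: "\<lbrakk>u \<in> Hom J j k; v \<in> Hom J j k\<rbrakk>
        \<Longrightarrow> \<exists>l\<in>Obj J. \<exists>w\<in>Hom J k l. w \<bullet> u = w \<bullet> v"

definition is_cocone :: "('i, 'j) cat \<Rightarrow> ('o, 'a, 'm) cat_scheme \<Rightarrow> ('i, 'j, 'o, 'a) funct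
    \<Rightarrow> 'o \<Rightarrow> ('i \<Rightarrow> 'a) \<Rightarrow> bool" where
  "is_cocone J C D L c \<longleftrightarrow> L \<in> Obj C \<and> (\<forall>j\<in>Obj J. c j \<in> Hom C (fobj D j) L) \<and>
     (\<forall>u\<in>Arr J. c (Tgt J u) \<bullet>\<^bsub>C\<^esub> farr D u = c (Src J u))"

definition is_colimit :: "('i, 'j) cat \<Rightarrow> ('o, 'a, 'm) cat_scheme \<Rightarrow> ('i, 'j, 'o, 'a) funct
    \<Rightarrow> 'o \<Rightarrow> ('i \<Rightarrow> 'a) \<Rightarrow> bool" where
  "is_colimit J C D L c \<longleftrightarrow> is_cocone J C D L c \<and>
     (\<forall>M d. is_cocone J C D M d \<longrightarrow> (\<exists>!h. h \<in> Hom C L M \<and> (\<forall>j\<in>Obj J. h \<bullet>\<^bsub>C\<^esub> c j = d j)))"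

text \<open>
  For \<^term>\<open>J\<close> filtered and \<^term>\<open>D\<close> a diagram of shape \<^term>\<open>J\<close> in \<^term>\<open>C\<close>, the set
  \<open>colim\<^sub>j Hom(X, D j)\<close>: pairs \<open>(j, f)\<close> with \<open>f : X \<rightarrow> D j\<close>, two of them being identified if they
  become equal at some later stage.
\<close>

definition hom_colim_rel :: "('o, 'a, 'm) cat_scheme \<Rightarrow> ('i, 'j) cat \<Rightarrow> ('i, 'j, 'o, 'a) funct
    \<Rightarrow> 'o \<Rightarrow> (('i \<times> 'a) \<times> ('i \<times> 'a)) set" where
  "hom_colim_rel C J D X = {((j, f), (k, g)). j \<in> Obj J \<and> f \<in> Hom C X (fobj D j) \<and>
     k \<in> Obj J \<and> g \<in> Hom C X (fobj D k) \<and>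
     (\<exists>l\<in>Obj J. \<exists>u\<in>Hom J j l. \<exists>v\<in>Hom J k l. farr D u \<bullet>\<^bsub>C\<^esub> f = farr D v \<bullet>\<^bsub>C\<^esub> g)}"

definition hom_colim :: "('o, 'a, 'm) cat_scheme \<Rightarrow> ('i, 'j) cat \<Rightarrow> ('i, 'j, 'o, 'a) funct
    \<Rightarrow> 'o \<Rightarrow> ('i \<times> 'a) set set" where
  "hom_colim C J D X = (SIGMA j:Obj J. Hom C X (fobj D j)) // hom_colim_rel C J D X"

text \<open>
  Compactness: for every colimit \<open>(L, c)\<close> of a small filtered diagram \<open>D\<close>, the canonical map
  \<open>colim\<^sub>j Hom(X, D j) \<rightarrow> Hom(X, L)\<close>, \<open>[(j, f)] \<mapsto> c\<^sub>j \<circ> f\<close>, is bijective.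
\<close>

definition compact_object :: "'i itself \<Rightarrow> ('o, 'a, 'm) cat_scheme \<Rightarrow> 'o \<Rightarrow> bool" where
  "compact_object _ C X \<longleftrightarrow> X \<in> Obj C \<and>
     (\<forall>(J :: ('i, 'i) cat) D L c.
        small_filtered J \<longrightarrow> cat_functor J C D \<longrightarrow> is_colimit J C D L c \<longrightarrow>
        bij_betw (\<lambda>\<xi>. the_elem ((\<lambda>(j, f). c j \<bullet>\<^bsub>C\<^esub> f) ` \<xi>)) (hom_colim C J D X) (Hom C X L))"


section \<open>The category of ind-objects\<close>

record ('i, 'o, 'a) ind_object =
  index :: "('i, 'i) cat"
  diagram :: "('i, 'i, 'o, 'a) funct"

type_synonym ('i, 'o, 'a) ind_arrow =
  "('i, 'o, 'a) ind_object \<times> ('i, 'o, 'a) ind_object \<times> ('i \<Rightarrow> ('i \<times> 'a) set)"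

abbreviation ind_at :: "('i, 'o, 'a) ind_object \<Rightarrow> 'i \<Rightarrow> 'o" where
  "ind_at X \<equiv> fobj (diagram X)"

abbreviation ind_colim_rel where
  "ind_colim_rel C Y \<equiv> hom_colim_rel C (index Y) (diagram Y)"

text \<open>\<open>Hom(X, Y) = lim\<^sub>a colim\<^sub>b Hom(X\<^sub>a, Y\<^sub>b)\<close>, the elements of the limit being the compatible
  families of elements of the colimits.\<close>

definition ind_hom :: "('o, 'a, 'm) cat_scheme
    \<Rightarrow> ('i, 'o, 'a) ind_object \<Rightarrow> ('i, 'o, 'a) ind_object \<Rightarrow> ('i \<Rightarrow> ('i \<times> 'a) set) set" where
  "ind_hom C X Y =
     {\<phi> \<in> \<Pi>\<^sub>E a\<in>Obj (index X). hom_colim C (index Y) (diagram Y) (ind_at X a).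
        \<forall>u\<in>Arr (index X).
          ind_colim_rel C Y (ind_at X (Src (index X) u)) ``
            ((\<lambda>(b, f). (b, f \<bullet>\<^bsub>C\<^esub> farr (diagram X) u)) ` \<phi> (Tgt (index X) u))
          = \<phi> (Src (index X) u)}"

definition ind_cat :: "('o, 'a, 'm) cat_scheme
    \<Rightarrow> (('i, 'o, 'a) ind_object, ('i, 'o, 'a) ind_arrow) cat" where
  "ind_cat C = \<lparr>
     Obj = {X. small_filtered (index X) \<and> cat_functor (index X) C (diagram X)},
     Arr = {(X, Y, \<phi>). small_filtered (index X) \<and> cat_functor (index X) C (diagram X) \<and>
                       small_filtered (index Y) \<and> cat_functor (index Y) C (diagram Y) \<and>
                       \<phi> \<in> ind_hom C X Y},
     Src = fst,
     Tgt = (\<lambda>(X, Y, \<phi>). Y),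
     Idn = (\<lambda>X. (X, X, \<lambda>a\<in>Obj (index X).
              ind_colim_rel C X (ind_at X a) `` {(a, Idn C (ind_at X a))})),
     Comp = (\<lambda>(Y, Z, \<psi>) (X, Y', \<phi>). (X, Z, \<lambda>a\<in>Obj (index X).
              ind_colim_rel C Z (ind_at X a) ``
                {(c, g \<bullet>\<^bsub>C\<^esub> f) | b c f g. (b, f) \<in> \<phi> a \<and> (c, g) \<in> \<psi> b}))\<rparr>"

text \<open>The embedding of a category into its ind-objects, as diagrams over a one-arrow category.\<close>

definition point_cat :: "('i, 'i) cat" where
  "point_cat = \<lparr>Obj = {undefined}, Arr = {undefined}, Src = (\<lambda>_. undefined),
     Tgt = (\<lambda>_. undefined), Idn = (\<lambda>_. undefined), Comp = (\<lambda>_ _. undefined)\<rparr>"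

definition const_ind :: "('o, 'a, 'm) cat_scheme \<Rightarrow> 'o \<Rightarrow> ('i, 'o, 'a) ind_object" where
  "const_ind C X = \<lparr>index = point_cat, diagram = \<lparr>fobj = (\<lambda>_. X), farr = (\<lambda>_. Idn C X)\<rparr>\<rparr>"

definition ind_embedding :: "('o, 'a, 'm) cat_scheme
    \<Rightarrow> ('o, 'a, ('i, 'o, 'a) ind_object, ('i, 'o, 'a) ind_arrow) funct" where
  "ind_embedding C = \<lparr>
     fobj = const_ind C,
     farr = (\<lambda>f. (const_ind C (Src C f), const_ind C (Tgt C f), \<lambda>a\<in>Obj point_cat.
               ind_colim_rel C (const_ind C (Tgt C f)) (Src C f) `` {(a, f)}))\<rparr>"


section \<open>Additive symmetric monoidal categories\<close>

record ('o, 'a) preadd_cat = "('o, 'a) cat" +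
  Zero :: "'o \<Rightarrow> 'o \<Rightarrow> 'a"
  Plus :: "'a \<Rightarrow> 'a \<Rightarrow> 'a"

text \<open>Only the additive part of the ring record is meaningful here.\<close>

definition hom_group :: "('o, 'a, 'm) preadd_cat_scheme \<Rightarrow> 'o \<Rightarrow> 'o \<Rightarrow> 'a ring" where
  "hom_group C X Y =
     \<lparr>carrier = Hom C X Y, mult = undefined, one = undefined, zero = Zero C X Y, add = Plus C\<rparr>"

locale preadditive_category = category C
  for C :: "('o, 'a, 'm) preadd_cat_scheme" (structure) +
  assumes abelian_group_hom: "\<lbrakk>X \<in> Obj C; Y \<in> Obj C\<rbrakk> \<Longrightarrow> abelian_group (hom_group C X Y)"
    and comp_plus_left: "\<lbrakk>f \<in> Hom C X Y; g \<in> Hom C Y Z; h \<in> Hom C Y Z\<rbrakk>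
        \<Longrightarrow> Plus C g h \<bullet> f = Plus C (g \<bullet> f) (h \<bullet> f)"
    and comp_plus_right: "\<lbrakk>f \<in> Hom C X Y; g \<in> Hom C X Y; h \<in> Hom C Y Z\<rbrakk>
        \<Longrightarrow> h \<bullet> Plus C f g = Plus C (h \<bullet> f) (h \<bullet> g)"

locale additive_category = preadditive_category +
  assumes zero_object: "\<exists>Z\<in>Obj C. Idn C Z = Zero C Z Z"
    and biproducts: "\<lbrakk>X \<in> Obj C; Y \<in> Obj C\<rbrakk> \<Longrightarrow>
        \<exists>B\<in>Obj C. \<exists>i1\<in>Hom C X B. \<exists>i2\<in>Hom C Y B. \<exists>p1\<in>Hom C B X. \<exists>p2\<in>Hom C B Y.
          p1 \<bullet> i1 = Idn C X \<and> p2 \<bullet> i2 = Idn C Y \<and> p1 \<bullet> i2 = Zero C Y X \<and> p2 \<bullet> i1 = Zero C X Y \<and>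
          Plus C (i1 \<bullet> p1) (i2 \<bullet> p2) = Idn C B"

definition karoubian :: "('o, 'a, 'm) cat_scheme \<Rightarrow> bool" where
  "karoubian C \<longleftrightarrow> (\<forall>X\<in>Obj C. \<forall>e\<in>Hom C X X. e \<bullet>\<^bsub>C\<^esub> e = e \<longrightarrow>
     (\<exists>Y\<in>Obj C. \<exists>r\<in>Hom C X Y. \<exists>s\<in>Hom C Y X. s \<bullet>\<^bsub>C\<^esub> r = e \<and> r \<bullet>\<^bsub>C\<^esub> s = Idn C Y))"

record ('o, 'a) sm_cat = "('o, 'a) preadd_cat" +
  Unit :: "'o" ("\<I>\<index>")
  Tobj :: "'o \<Rightarrow> 'o \<Rightarrow> 'o" (infixr "\<boxtimes>\<index>" 75)
  Tarr :: "'a \<Rightarrow> 'a \<Rightarrow> 'a" (infixr "\<star>\<index>" 75)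
  Assoc :: "'o \<Rightarrow> 'o \<Rightarrow> 'o \<Rightarrow> 'a"
  Lunit :: "'o \<Rightarrow> 'a"
  Runit :: "'o \<Rightarrow> 'a"
  Braid :: "'o \<Rightarrow> 'o \<Rightarrow> 'a"

locale symmetric_monoidal = category C
  for C :: "('o, 'a, 'm) sm_cat_scheme" (structure) +
  assumes unit_closed: "\<I> \<in> Obj C"
    and tobj_closed: "\<lbrakk>X \<in> Obj C; Y \<in> Obj C\<rbrakk> \<Longrightarrow> X \<boxtimes> Y \<in> Obj C"
    and tarr_closed: "\<lbrakk>f \<in> Hom C X X'; g \<in> Hom C Y Y'\<rbrakk> \<Longrightarrow> f \<star> g \<in> Hom C (X \<boxtimes> Y) (X' \<boxtimes> Y')"
    and tarr_idn: "\<lbrakk>X \<in> Obj C; Y \<in> Obj C\<rbrakk> \<Longrightarrow> Idn C X \<star> Idn C Y = Idn C (X \<boxtimes> Y)"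
    and tarr_comp: "\<lbrakk>f \<in> Hom C X X'; f' \<in> Hom C X' X''; g \<in> Hom C Y Y'; g' \<in> Hom C Y' Y''\<rbrakk>
        \<Longrightarrow> (f' \<bullet> f) \<star> (g' \<bullet> g) = (f' \<star> g') \<bullet> (f \<star> g)"
    and assoc_closed: "\<lbrakk>X \<in> Obj C; Y \<in> Obj C; Z \<in> Obj C\<rbrakk>
        \<Longrightarrow> Assoc C X Y Z \<in> Hom C ((X \<boxtimes> Y) \<boxtimes> Z) (X \<boxtimes> (Y \<boxtimes> Z))"
    and assoc_iso: "\<lbrakk>X \<in> Obj C; Y \<in> Obj C; Z \<in> Obj C\<rbrakk> \<Longrightarrow> iso_arrow C (Assoc C X Y Z)"
    and assoc_natural: "\<lbrakk>f \<in> Hom C X X'; g \<in> Hom C Y Y'; h \<in> Hom C Z Z'\<rbrakk>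
        \<Longrightarrow> Assoc C X' Y' Z' \<bullet> ((f \<star> g) \<star> h) = (f \<star> (g \<star> h)) \<bullet> Assoc C X Y Z"
    and lunit_closed: "X \<in> Obj C \<Longrightarrow> Lunit C X \<in> Hom C (\<I> \<boxtimes> X) X"
    and lunit_iso: "X \<in> Obj C \<Longrightarrow> iso_arrow C (Lunit C X)"
    and lunit_natural: "f \<in> Hom C X Y \<Longrightarrow> Lunit C Y \<bullet> (Idn C \<I> \<star> f) = f \<bullet> Lunit C X"
    and runit_closed: "X \<in> Obj C \<Longrightarrow> Runit C X \<in> Hom C (X \<boxtimes> \<I>) X"
    and runit_iso: "X \<in> Obj C \<Longrightarrow> iso_arrow C (Runit C X)"
    and runit_natural: "f \<in> Hom C X Y \<Longrightarrow> Runit C Y \<bullet> (f \<star> Idn C \<I>) = f \<bullet> Runit C X"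
    and braid_closed: "\<lbrakk>X \<in> Obj C; Y \<in> Obj C\<rbrakk> \<Longrightarrow> Braid C X Y \<in> Hom C (X \<boxtimes> Y) (Y \<boxtimes> X)"
    and braid_natural: "\<lbrakk>f \<in> Hom C X X'; g \<in> Hom C Y Y'\<rbrakk>
        \<Longrightarrow> Braid C X' Y' \<bullet> (f \<star> g) = (g \<star> f) \<bullet> Braid C X Y"
    and pentagon: "\<lbrakk>W \<in> Obj C; X \<in> Obj C; Y \<in> Obj C; Z \<in> Obj C\<rbrakk> \<Longrightarrow>
        Assoc C W X (Y \<boxtimes> Z) \<bullet> Assoc C (W \<boxtimes> X) Y Z =
        (Idn C W \<star> Assoc C X Y Z) \<bullet> Assoc C W (X \<boxtimes> Y) Z \<bullet> (Assoc C W X Y \<star> Idn C Z)"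
    and triangle: "\<lbrakk>X \<in> Obj C; Y \<in> Obj C\<rbrakk> \<Longrightarrow>
        (Idn C X \<star> Lunit C Y) \<bullet> Assoc C X \<I> Y = Runit C X \<star> Idn C Y"
    and hexagon: "\<lbrakk>X \<in> Obj C; Y \<in> Obj C; Z \<in> Obj C\<rbrakk> \<Longrightarrow>
        Assoc C Y Z X \<bullet> Braid C X (Y \<boxtimes> Z) \<bullet> Assoc C X Y Z =
        (Idn C Y \<star> Braid C X Z) \<bullet> Assoc C Y X Z \<bullet> (Braid C X Y \<star> Idn C Z)"
    and symmetry: "\<lbrakk>X \<in> Obj C; Y \<in> Obj C\<rbrakk> \<Longrightarrow> Braid C Y X \<bullet> Braid C X Y = Idn C (X \<boxtimes> Y)"

text \<open>Every object \<open>X\<close> has a dual \<open>X'\<close> with evaluation \<open>X' \<otimes> X \<rightarrow> \<one>\<close> and coevaluation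
  \<open>\<one> \<rightarrow> X \<otimes> X'\<close>.\<close>

definition rigid :: "('o, 'a, 'm) sm_cat_scheme \<Rightarrow> bool" where
  "rigid C \<longleftrightarrow> (\<forall>X\<in>Obj C. \<exists>X'\<in>Obj C.
     \<exists>ev\<in>Hom C (X' \<boxtimes>\<^bsub>C\<^esub> X) \<I>\<^bsub>C\<^esub>. \<exists>coev\<in>Hom C \<I>\<^bsub>C\<^esub> (X \<boxtimes>\<^bsub>C\<^esub> X').
       Runit C X \<bullet>\<^bsub>C\<^esub> (Idn C X \<star>\<^bsub>C\<^esub> ev) \<bullet>\<^bsub>C\<^esub> Assoc C X X' X \<bullet>\<^bsub>C\<^esub> (coev \<star>\<^bsub>C\<^esub> Idn C X)
         = Lunit C X \<and>
       Lunit C X' \<bullet>\<^bsub>C\<^esub> (ev \<star>\<^bsub>C\<^esub> Idn C X') \<bullet>\<^bsub>C\<^esub> inv_arrow C (Assoc C X' X X')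
           \<bullet>\<^bsub>C\<^esub> (Idn C X' \<star>\<^bsub>C\<^esub> coev)
         = Runit C X')"

locale strong_symmetric_monoidal_functor =
  cat_functor D E F + D: symmetric_monoidal D + E: symmetric_monoidal E
  for D :: "('o, 'a, 'm) sm_cat_scheme" and E :: "('p, 'b, 'n) sm_cat_scheme"
    and F :: "('o, 'a, 'p, 'b) funct" +
  fixes \<mu> :: "'o \<Rightarrow> 'o \<Rightarrow> 'b" and \<epsilon> :: "'b"
  assumes mu_closed: "\<lbrakk>X \<in> Obj D; Y \<in> Obj D\<rbrakk>
        \<Longrightarrow> \<mu> X Y \<in> Hom E (fobj F X \<boxtimes>\<^bsub>E\<^esub> fobj F Y) (fobj F (X \<boxtimes>\<^bsub>D\<^esub> Y))"
    and mu_iso: "\<lbrakk>X \<in> Obj D; Y \<in> Obj D\<rbrakk> \<Longrightarrow> iso_arrow E (\<mu> X Y)"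
    and mu_natural: "\<lbrakk>f \<in> Hom D X X'; g \<in> Hom D Y Y'\<rbrakk>
        \<Longrightarrow> \<mu> X' Y' \<bullet>\<^bsub>E\<^esub> (farr F f \<star>\<^bsub>E\<^esub> farr F g) = farr F (f \<star>\<^bsub>D\<^esub> g) \<bullet>\<^bsub>E\<^esub> \<mu> X Y"
    and epsilon_closed: "\<epsilon> \<in> Hom E \<I>\<^bsub>E\<^esub> (fobj F \<I>\<^bsub>D\<^esub>)"
    and epsilon_iso: "iso_arrow E \<epsilon>"
    and mu_assoc: "\<lbrakk>X \<in> Obj D; Y \<in> Obj D; Z \<in> Obj D\<rbrakk> \<Longrightarrow>
        farr F (Assoc D X Y Z) \<bullet>\<^bsub>E\<^esub> \<mu> (X \<boxtimes>\<^bsub>D\<^esub> Y) Z \<bullet>\<^bsub>E\<^esub> (\<mu> X Y \<star>\<^bsub>E\<^esub> Idn E (fobj F Z)) =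
        \<mu> X (Y \<boxtimes>\<^bsub>D\<^esub> Z) \<bullet>\<^bsub>E\<^esub> (Idn E (fobj F X) \<star>\<^bsub>E\<^esub> \<mu> Y Z)
          \<bullet>\<^bsub>E\<^esub> Assoc E (fobj F X) (fobj F Y) (fobj F Z)"
    and mu_lunit: "X \<in> Obj D \<Longrightarrow>
        farr F (Lunit D X) \<bullet>\<^bsub>E\<^esub> \<mu> \<I>\<^bsub>D\<^esub> X \<bullet>\<^bsub>E\<^esub> (\<epsilon> \<star>\<^bsub>E\<^esub> Idn E (fobj F X)) = Lunit E (fobj F X)"
    and mu_runit: "X \<in> Obj D \<Longrightarrow>
        farr F (Runit D X) \<bullet>\<^bsub>E\<^esub> \<mu> X \<I>\<^bsub>D\<^esub> \<bullet>\<^bsub>E\<^esub> (Idn E (fobj F X) \<star>\<^bsub>E\<^esub> \<epsilon>) = Runit E (fobj F X)"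
    and mu_braid: "\<lbrakk>X \<in> Obj D; Y \<in> Obj D\<rbrakk> \<Longrightarrow>
        farr F (Braid D X Y) \<bullet>\<^bsub>E\<^esub> \<mu> X Y = \<mu> Y X \<bullet>\<^bsub>E\<^esub> Braid E (fobj F X) (fobj F Y)"

definition tensor_diagram :: "('o, 'a, 'm) sm_cat_scheme \<Rightarrow> ('i, 'j, 'o, 'a) funct
    \<Rightarrow> ('k, 'l, 'o, 'a) funct \<Rightarrow> ('i \<times> 'k, 'j \<times> 'l, 'o, 'a) funct" where
  "tensor_diagram C D E =
     \<lparr>fobj = (\<lambda>(i, k). fobj D i \<boxtimes>\<^bsub>C\<^esub> fobj E k), farr = (\<lambda>(u, v). farr D u \<star>\<^bsub>C\<^esub> farr E v)\<rparr>"

definition end_ring :: "('o, 'a, 'm) sm_cat_scheme \<Rightarrow> 'a ring" where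
  "end_ring C = \<lparr>carrier = Hom C \<I>\<^bsub>C\<^esub> \<I>\<^bsub>C\<^esub>, mult = Comp C, one = Idn C \<I>\<^bsub>C\<^esub>,
     zero = Zero C \<I>\<^bsub>C\<^esub> \<I>\<^bsub>C\<^esub>, add = Plus C\<rparr>"

definition rat_ring :: "rat ring" where
  "rat_ring = \<lparr>carrier = UNIV, mult = (*), one = 1, zero = 0, add = (+)\<rparr>"

definition contains_rationals :: "('r, 'm) ring_scheme \<Rightarrow> bool" where
  "contains_rationals R \<longleftrightarrow> (\<exists>h\<in>ring_hom rat_ring R. inj h)"

text \<open>
  The symmetric monoidal category \<^term>\<open>C\<close> is identified with \<open>Ind(C\<^sub>0)\<close> by an equivalence
  \<^term>\<open>\<Phi>\<close> whose restriction to \<open>C\<^sub>0\<close> is symmetric monoidal (with structure isomorphisms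
  \<^term>\<open>\<mu>\<close> and \<^term>\<open>\<epsilon>\<close>), and the tensor product of \<^term>\<open>C\<close> is determined by that of
  \<open>C\<^sub>0\<close> through its compatibility with filtered colimits. A category equivalent to \<open>Ind(C\<^sub>0)\<close> is
  additive and its \<open>Hom\<close>-groups are determined by the underlying category, so that recording them
  in \<^term>\<open>C\<close> is no restriction.
\<close>

locale ind_monoidal_category =
  symmetric_monoidal C + preadditive_category C +
  C0: symmetric_monoidal C0 + C0: additive_category C0
  for C :: "('o, 'a, 'm) sm_cat_scheme" (structure)
    and C0 :: "('p, 'b, 'n) sm_cat_scheme"
    and \<Phi> :: "(('i, 'p, 'b) ind_object, ('i, 'p, 'b) ind_arrow, 'o, 'a) funct"
    and \<mu> :: "'p \<Rightarrow> 'p \<Rightarrow> 'a" and \<epsilon> :: "'a" +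
  assumes universe: "universe TYPE('i)"
    and locally_small: "\<lbrakk>X \<in> Obj C0; Y \<in> Obj C0\<rbrakk> \<Longrightarrow> small TYPE('i) (Hom C0 X Y)"
    and karoubian: "karoubian C0"
    and rigid: "rigid C0"
    and equivalence: "equivalence_functor (ind_cat C0) C \<Phi>"
    and monoidal: "strong_symmetric_monoidal_functor C0 C (comp_funct \<Phi> (ind_embedding C0)) \<mu> \<epsilon>"
    and tensor_colimit: "\<And>(I :: ('i, 'i) cat) (J :: ('i, 'i) cat) D E L M c d.
        \<lbrakk>small_filtered I; small_filtered J; cat_functor I C D; cat_functor J C E;
         is_colimit I C D L c; is_colimit J C E M d\<rbrakk>
        \<Longrightarrow> is_colimit (prod_cat I J) C (tensor_diagram C D E) (L \<boxtimes> M) (\<lambda>(i, j). c i \<star> d j)"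
    and rationals: "contains_rationals (end_ring C)"


section \<open>Formal distributions\<close>

text \<open>
  A formal distribution in \<open>z\<close> with coefficients in an abelian group is the function sending
  \<open>p\<close> to the coefficient of \<open>z\<^sup>p\<close>; in two variables, \<open>F p q\<close> is the coefficient of \<open>z\<^sup>p w\<^sup>q\<close>.
\<close>

definition field_of :: "(int \<Rightarrow> 'a) \<Rightarrow> int \<Rightarrow> 'a" where
  "field_of Y p = Y (- p - 1)"

definition fd_deriv :: "('a, 'm) ring_scheme \<Rightarrow> (int \<Rightarrow> 'a) \<Rightarrow> int \<Rightarrow> 'a" where
  "fd_deriv G A p = [(p + 1)] \<cdot>\<^bsub>G\<^esub> A (p + 1)"

definition times_z_minus_w :: "('a, 'm) ring_scheme \<Rightarrow> (int \<Rightarrow> int \<Rightarrow> 'a) \<Rightarrow> int \<Rightarrow> int \<Rightarrow> 'a" where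
  "times_z_minus_w G F p q = F (p - 1) q \<ominus>\<^bsub>G\<^esub> F p (q - 1)"


section \<open>Vertex algebras\<close>

text \<open>
  Vertex algebras in \<^term>\<open>C\<close>; \<^term>\<open>prd n\<close> is the \<open>n\<close>-th product, and the type \<^typ>\<open>'i\<close>
  enters through the notion of compact object. The associator, usually suppressed, makes the two
  composites in the locality axiom start at \<open>(X \<otimes> X') \<otimes> V\<close>.
\<close>

locale vertex_algebra_in =
  symmetric_monoidal C + preadditive_category C
  for universe_type :: "'i itself" and C :: "('o, 'a, 'm) sm_cat_scheme" (structure) +
  fixes V :: "'o" and vac :: "'a" and T :: "'a" and prd :: "int \<Rightarrow> 'a"
  assumes V_closed: "V \<in> Obj C"
    and vac_closed: "vac \<in> Hom C \<I> V"
    and T_closed: "T \<in> Hom C V V"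
    and prd_closed: "prd n \<in> Hom C (V \<boxtimes> V) V"
    and truncation:
      "\<lbrakk>compact_object TYPE('i) C X; compact_object TYPE('i) C X'; \<alpha> \<in> Hom C X V; \<beta> \<in> Hom C X' V\<rbrakk>
       \<Longrightarrow> \<exists>K. \<forall>n\<ge>K. prd n \<bullet> (\<alpha> \<star> \<beta>) = Zero C (X \<boxtimes> X') V"
    and vacuum_left:
      "field_of prd p \<bullet> (vac \<star> Idn C V) = (if p = 0 then Lunit C V else Zero C (\<I> \<boxtimes> V) V)"
    and vacuum_right_regular:
      "p < 0 \<Longrightarrow> field_of prd p \<bullet> (Idn C V \<star> vac) = Zero C (V \<boxtimes> \<I>) V"
    and vacuum_right_value: "field_of prd 0 \<bullet> (Idn C V \<star> vac) = Runit C V"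
    and T_vac: "T \<bullet> vac = Zero C \<I> V"
    and translation:
      "T \<bullet> field_of prd p \<ominus>\<^bsub>hom_group C (V \<boxtimes> V) V\<^esub> field_of prd p \<bullet> (Idn C V \<star> T)
       = fd_deriv (hom_group C (V \<boxtimes> V) V) (field_of prd) p"
    and locality:
      "\<lbrakk>compact_object TYPE('i) C X; compact_object TYPE('i) C X'; \<alpha> \<in> Hom C X V; \<beta> \<in> Hom C X' V\<rbrakk>
       \<Longrightarrow> \<exists>K. (times_z_minus_w (hom_group C ((X \<boxtimes> X') \<boxtimes> V) V) ^^ K)
          (\<lambda>p q.
             field_of prd q \<bullet> (Idn C V \<star> field_of prd p) \<bullet> Assoc C V V V
               \<bullet> ((\<alpha> \<star> \<beta>) \<star> Idn C V)
             \<ominus>\<^bsub>hom_group C ((X \<boxtimes> X') \<boxtimes> V) V\<^esub>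
             field_of prd p \<bullet> (Idn C V \<star> field_of prd q) \<bullet> Assoc C V V V
               \<bullet> (Braid C V V \<star> Idn C V) \<bullet> ((\<alpha> \<star> \<beta>) \<star> Idn C V))
          = (\<lambda>p q. Zero C ((X \<boxtimes> X') \<boxtimes> V) V)"

locale vertex_algebra_over = module R W
  for R :: "('r, 'm) ring_scheme" (structure) and W :: "('r, 'v, 'n) module_scheme" (structure) +
  fixes vac :: "'v" and T :: "'v \<Rightarrow> 'v" and prd :: "int \<Rightarrow> 'v \<Rightarrow> 'v \<Rightarrow> 'v"
  assumes rationals: "contains_rationals R"
    and vac_closed: "vac \<in> carrier W"
    and T_closed: "u \<in> carrier W \<Longrightarrow> T u \<in> carrier W"
    and T_add: "\<lbrakk>u \<in> carrier W; v \<in> carrier W\<rbrakk> \<Longrightarrow> T (u \<oplus>\<^bsub>W\<^esub> v) = T u \<oplus>\<^bsub>W\<^esub> T v"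
    and T_smult: "\<lbrakk>a \<in> carrier R; u \<in> carrier W\<rbrakk> \<Longrightarrow> T (a \<odot>\<^bsub>W\<^esub> u) = a \<odot>\<^bsub>W\<^esub> T u"
    and prd_closed: "\<lbrakk>u \<in> carrier W; v \<in> carrier W\<rbrakk> \<Longrightarrow> prd n u v \<in> carrier W"
    and prd_add_left: "\<lbrakk>u \<in> carrier W; u' \<in> carrier W; v \<in> carrier W\<rbrakk>
        \<Longrightarrow> prd n (u \<oplus>\<^bsub>W\<^esub> u') v = prd n u v \<oplus>\<^bsub>W\<^esub> prd n u' v"
    and prd_add_right: "\<lbrakk>u \<in> carrier W; v \<in> carrier W; v' \<in> carrier W\<rbrakk>
        \<Longrightarrow> prd n u (v \<oplus>\<^bsub>W\<^esub> v') = prd n u v \<oplus>\<^bsub>W\<^esub> prd n u v'"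
    and prd_smult_left: "\<lbrakk>a \<in> carrier R; u \<in> carrier W; v \<in> carrier W\<rbrakk>
        \<Longrightarrow> prd n (a \<odot>\<^bsub>W\<^esub> u) v = a \<odot>\<^bsub>W\<^esub> prd n u v"
    and prd_smult_right: "\<lbrakk>a \<in> carrier R; u \<in> carrier W; v \<in> carrier W\<rbrakk>
        \<Longrightarrow> prd n u (a \<odot>\<^bsub>W\<^esub> v) = a \<odot>\<^bsub>W\<^esub> prd n u v"
    and truncation: "\<lbrakk>u \<in> carrier W; v \<in> carrier W\<rbrakk> \<Longrightarrow> \<exists>K. \<forall>n\<ge>K. prd n u v = \<zero>\<^bsub>W\<^esub>"
    and vacuum_left: "u \<in> carrier W \<Longrightarrow> field_of prd p vac u = (if p = 0 then u else \<zero>\<^bsub>W\<^esub>)"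
    and vacuum_right_regular: "\<lbrakk>u \<in> carrier W; p < 0\<rbrakk> \<Longrightarrow> field_of prd p u vac = \<zero>\<^bsub>W\<^esub>"
    and vacuum_right_value: "u \<in> carrier W \<Longrightarrow> field_of prd 0 u vac = u"
    and T_vac: "T vac = \<zero>\<^bsub>W\<^esub>"
    and translation: "\<lbrakk>u \<in> carrier W; v \<in> carrier W\<rbrakk>
        \<Longrightarrow> T (field_of prd p u v) \<ominus>\<^bsub>W\<^esub> field_of prd p u (T v)
            = fd_deriv W (\<lambda>r. field_of prd r u v) p"
    and locality: "\<lbrakk>u \<in> carrier W; v \<in> carrier W\<rbrakk>
        \<Longrightarrow> \<exists>K. \<forall>x\<in>carrier W. (times_z_minus_w W ^^ K)
              (\<lambda>p q. field_of prd p u (field_of prd q v x) \<ominus>\<^bsub>W\<^esub> field_of prd q v (field_of prd p u x))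
            = (\<lambda>p q. \<zero>\<^bsub>W\<^esub>)"

text \<open>\<open>Hom(\<one>, V)\<close> as a module over \<open>End(\<one>)\<close>, acting by precomposition; the multiplicative
  fields inherited from the ring record carry no meaning.\<close>

definition hom_module :: "('o, 'a, 'm) sm_cat_scheme \<Rightarrow> 'o \<Rightarrow> ('a, 'a) module" where
  "hom_module C V = \<lparr>carrier = Hom C \<I>\<^bsub>C\<^esub> V, mult = undefined, one = undefined,
     zero = Zero C \<I>\<^bsub>C\<^esub> V, add = Plus C, smult = (\<lambda>r \<alpha>. \<alpha> \<bullet>\<^bsub>C\<^esub> r)\<rparr>"

definition hom_product :: "('o, 'a, 'm) sm_cat_scheme \<Rightarrow> (int \<Rightarrow> 'a) \<Rightarrow> int \<Rightarrow> 'a \<Rightarrow> 'a \<Rightarrow> 'a" where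
  "hom_product C prd n \<alpha> \<beta> = prd n \<bullet>\<^bsub>C\<^esub> (\<alpha> \<star>\<^bsub>C\<^esub> \<beta>) \<bullet>\<^bsub>C\<^esub> inv_arrow C (Lunit C \<I>\<^bsub>C\<^esub>)"

end

theory Submission
  imports Defs
begin

text \<open>
  For points \<open>\<alpha> : \<one> \<rightarrow> V\<close> and \<open>\<beta> : \<one> \<rightarrow> V\<close> the composite
  \<open>(\<alpha> \<otimes> \<beta>) \<circ> l\<^sup>-\<^sup>1\<close> equals both \<open>(\<alpha> \<otimes> id) \<circ> l\<^sup>-\<^sup>1 \<circ> \<beta>\<close> and
  \<open>(id \<otimes> \<beta>) \<circ> r\<^sup>-\<^sup>1 \<circ> \<alpha>\<close>, by naturality and \<open>l\<^bsub>\<one>\<^esub> = r\<^bsub>\<one>\<^esub>\<close>. Hence the products on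
  \<open>Hom(\<one>, V)\<close> are bilinear because composition is, and each axiom of a vertex algebra over
  \<open>End(\<one>)\<close> is the axiom in \<open>C\<close> precomposed with a suitable arrow out of \<open>\<one>\<close>.

  Truncation and locality are only available on compact objects, so \<open>\<one>\<close> has to be compact.
  It is isomorphic to the image of the unit of \<open>C\<^sub>0\<close>, and objects of \<open>C\<^sub>0\<close> are compact in
  \<open>Ind(C\<^sub>0)\<close>: for a small filtered diagram \<open>D\<close>, the index categories of presentations of the
  \<open>D j\<close> by objects of \<open>C\<^sub>0\<close> glue to a small filtered category, which defines an ind-object
  \<open>P\<close> representing \<open>colim\<^sub>j Hom(-, D j)\<close> on \<open>C\<^sub>0\<close>. A colimit of \<open>D\<close> is a retract of \<open>P\<close>
  compatibly with the cocones, so arrows from objects of \<open>C\<^sub>0\<close> into it factor through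
  some \<open>D j\<close>, essentially uniquely.
\<close>

text \<open>Colimits in \<open>C\<close> are known only through their universal property, and the
  presentations of the objects \<open>D j\<close> are chosen one at a time. An arrow of
  \<open>J\<close> therefore induces no map between the chosen diagrams; it lifts only stage by
  stage, to arrows of \<open>C0\<close> into some stage of the target. The glued category is built
  for this: its objects are pairs \<open>(j, k)\<close>, its arrows are arrows of \<open>C0\<close>
  subject to an equation in the colimit of hom sets. Arrows of \<open>J\<close> then lift, and
  filteredness is obtained first in \<open>J\<close> and then inside a single presentation. With
  \<open>e \<circ> h = id\<close> exhibiting the colimit \<open>L\<close> as a retract of
  \<open>P\<close>, an arrow into \<open>L\<close> is carried by \<open>h\<close> to
  \<open>P\<close>, factored there, and brought back by \<open>e\<close>; injectivity follows by
  carrying an equation along \<open>h\<close>. For the products, the coherence that matters is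
  \<open>l = r\<close> and \<open>\<sigma> = id\<close> at the unit object. The former is derived
  from pentagon and triangle, the latter from hexagon and symmetry.\<close>

context category
begin

lemma HomD:
  assumes "f \<in> Hom C X Y"
  shows "f \<in> Arr C" "Src C f = X" "Tgt C f = Y" "X \<in> Obj C" "Y \<in> Obj C"
  using assms src_closed tgt_closed by (auto simp: Hom_def)

lemma HomI: "\<lbrakk>f \<in> Arr C; Src C f = X; Tgt C f = Y\<rbrakk> \<Longrightarrow> f \<in> Hom C X Y"
  by (simp add: Hom_def)

lemma arr_iff_Hom: "f \<in> Arr C \<longleftrightarrow> f \<in> Hom C (Src C f) (Tgt C f)"
  by (simp add: Hom_def)

lemma idn_simps [simp]:
  assumes "X \<in> Obj C"
  shows "Idn C X \<in> Arr C" "Src C (Idn C X) = X" "Tgt C (Idn C X) = X"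
  using HomD[OF idn_closed[OF assms]] by auto

lemma comp_simps [simp]:
  assumes "f \<in> Arr C" "g \<in> Arr C" "Src C g = Tgt C f"
  shows "g \<bullet> f \<in> Arr C" "Src C (g \<bullet> f) = Src C f" "Tgt C (g \<bullet> f) = Tgt C g"
  using comp_closed[of f "Src C f" "Tgt C f" g "Tgt C g"] assms by (auto simp: Hom_def)

lemma comp_assoc_arr:
  assumes "f \<in> Arr C" "g \<in> Arr C" "h \<in> Arr C" "Src C g = Tgt C f" "Src C h = Tgt C g"
  shows "(h \<bullet> g) \<bullet> f = h \<bullet> (g \<bullet> f)"
  using comp_assoc[of f "Src C f" "Tgt C f" g "Tgt C g" h "Tgt C h"] assms by (auto simp: Hom_def)

lemma comp_idn [simp]:
  assumes "f \<in> Arr C"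
  shows "Tgt C f = Y \<Longrightarrow> Idn C Y \<bullet> f = f" "Src C f = X \<Longrightarrow> f \<bullet> Idn C X = f"
  using idn_left[of f "Src C f" "Tgt C f"] idn_right[of f "Src C f" "Tgt C f"] assms
  by (auto simp: Hom_def)

lemma inverse_arrows_unique:
  assumes "inverse_arrows C f g" "inverse_arrows C f h"
  shows "g = h"
proof -
  have t: "f \<in> Hom C (Src C f) (Tgt C f)" "g \<in> Hom C (Tgt C f) (Src C f)"
    "h \<in> Hom C (Tgt C f) (Src C f)"
    using assms by (auto simp: inverse_arrows_def Hom_def)
  have "g = g \<bullet> (f \<bullet> h)"
    using assms(2) idn_right[OF t(2)] by (simp add: inverse_arrows_def)
  also have "\<dots> = h"
    using assms(1) comp_assoc[OF t(3,1,2), symmetric] idn_left[OF t(3)]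
    by (simp add: inverse_arrows_def)
  finally show ?thesis .
qed

lemma inv_arrow:
  assumes "iso_arrow C f" "f \<in> Hom C X Y"
  shows "inv_arrow C f \<in> Hom C Y X" "inv_arrow C f \<bullet> f = Idn C X" "f \<bullet> inv_arrow C f = Idn C Y"
proof -
  obtain g where g: "inverse_arrows C f g"
    using assms by (auto simp: iso_arrow_def)
  then have "inv_arrow C f = g"
    unfolding inv_arrow_def using inverse_arrows_unique by blast
  then show "inv_arrow C f \<in> Hom C Y X" "inv_arrow C f \<bullet> f = Idn C X" "f \<bullet> inv_arrow C f = Idn C Y"
    using g HomD(2,3)[OF assms(2)] by (simp_all add: inverse_arrows_def)
qed

lemma iso_epi:
  assumes "iso_arrow C e" "e \<in> Hom C X Y" "f \<in> Hom C Y Z" "g \<in> Hom C Y Z" "f \<bullet> e = g \<bullet> e"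
  shows "f = g"
  using comp_assoc[OF inv_arrow(1)[OF assms(1,2)] assms(2,3)] assms(5) inv_arrow(3)[OF assms(1,2)]
    comp_assoc[OF inv_arrow(1)[OF assms(1,2)] assms(2,4)] idn_right[OF assms(3)] idn_right[OF assms(4)]
  by simp

lemma iso_mono:
  assumes "iso_arrow C e" "e \<in> Hom C X Y" "f \<in> Hom C Z X" "g \<in> Hom C Z X" "e \<bullet> f = e \<bullet> g"
  shows "f = g"
  using comp_assoc[OF assms(3,2) inv_arrow(1)[OF assms(1,2)]] assms(5) inv_arrow(2)[OF assms(1,2)]
    comp_assoc[OF assms(4,2) inv_arrow(1)[OF assms(1,2)]] idn_left[OF assms(3)] idn_left[OF assms(4)]
  by simp

end

section \<open>Coherence for the unit object\<close>

context symmetric_monoidal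
begin

lemma unit_obj [simp]: "\<I> \<in> Obj C"
  and tensor_obj [simp]: "X \<in> Obj C \<Longrightarrow> Y \<in> Obj C \<Longrightarrow> X \<boxtimes> Y \<in> Obj C"
  by (fact unit_closed, fact tobj_closed)

lemma tensor_simps [simp]:
  assumes "f \<in> Arr C" "g \<in> Arr C"
  shows "f \<star> g \<in> Arr C" "Src C (f \<star> g) = Src C f \<boxtimes> Src C g" "Tgt C (f \<star> g) = Tgt C f \<boxtimes> Tgt C g"
  using tarr_closed[of f "Src C f" "Tgt C f" g "Src C g" "Tgt C g"] assms by (auto simp: Hom_def)

lemma structure_simps [simp]:
  assumes "X \<in> Obj C"
  shows "Lunit C X \<in> Arr C" "Src C (Lunit C X) = \<I> \<boxtimes> X" "Tgt C (Lunit C X) = X"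
    and "Runit C X \<in> Arr C" "Src C (Runit C X) = X \<boxtimes> \<I>" "Tgt C (Runit C X) = X"
    and "Y \<in> Obj C \<Longrightarrow> Braid C X Y \<in> Arr C"
    and "Y \<in> Obj C \<Longrightarrow> Src C (Braid C X Y) = X \<boxtimes> Y"
    and "Y \<in> Obj C \<Longrightarrow> Tgt C (Braid C X Y) = Y \<boxtimes> X"
    and "Y \<in> Obj C \<Longrightarrow> Z \<in> Obj C \<Longrightarrow> Assoc C X Y Z \<in> Arr C"
    and "Y \<in> Obj C \<Longrightarrow> Z \<in> Obj C \<Longrightarrow> Src C (Assoc C X Y Z) = (X \<boxtimes> Y) \<boxtimes> Z"
    and "Y \<in> Obj C \<Longrightarrow> Z \<in> Obj C \<Longrightarrow> Tgt C (Assoc C X Y Z) = X \<boxtimes> (Y \<boxtimes> Z)"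
  using lunit_closed[OF assms] runit_closed[OF assms] braid_closed[OF assms] assoc_closed[OF assms]
  by (auto simp: Hom_def)

lemma interchange:
  assumes "f \<in> Arr C" "f' \<in> Arr C" "g \<in> Arr C" "g' \<in> Arr C" "Src C f' = Tgt C f" "Src C g' = Tgt C g"
  shows "(f' \<star> g') \<bullet> (f \<star> g) = (f' \<bullet> f) \<star> (g' \<bullet> g)"
  using tarr_comp[of f "Src C f" "Tgt C f" f' "Tgt C f'" g "Src C g" "Tgt C g" g' "Tgt C g'"] assms
  by (auto simp: Hom_def)

lemma whisker_left:
  assumes "X \<in> Obj C" "f \<in> Arr C" "g \<in> Arr C" "Src C g = Tgt C f"
  shows "(Idn C X \<star> g) \<bullet> (Idn C X \<star> f) = Idn C X \<star> (g \<bullet> f)"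
  using assms by (simp add: interchange)

lemma whisker_right:
  assumes "X \<in> Obj C" "f \<in> Arr C" "g \<in> Arr C" "Src C g = Tgt C f"
  shows "(g \<star> Idn C X) \<bullet> (f \<star> Idn C X) = (g \<bullet> f) \<star> Idn C X"
  using assms by (simp add: interchange)

lemma iso_arrow_tensor:
  assumes "iso_arrow C f" "iso_arrow C g"
  shows "iso_arrow C (f \<star> g)"
proof -
  obtain f' g' where "inverse_arrows C f f'" "inverse_arrows C g g'"
    using assms by (auto simp: iso_arrow_def)
  then have "inverse_arrows C (f \<star> g) (f' \<star> g')"
    unfolding inverse_arrows_def
    by (auto simp: Hom_def interchange src_closed tgt_closed tarr_idn)
  then show ?thesis
    by (auto simp: iso_arrow_def)
qed

lemma iso_arrow_idn: "X \<in> Obj C \<Longrightarrow> iso_arrow C (Idn C X)"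
  unfolding iso_arrow_def inverse_arrows_def by (intro exI[of _ "Idn C X"]) (auto simp: Hom_def)

text \<open>Through the natural isomorphism \<open>l\<close>, tensoring with the unit object is
  isomorphic to the identity functor, hence faithful. Coherence equations can be checked after
  tensoring with \<open>\<I>\<close>, where pentagon and triangle apply.\<close>

lemma unit_tensor_cancel:
  assumes "f \<in> Hom C X Y" "g \<in> Hom C X Y" "Idn C \<I> \<star> f = Idn C \<I> \<star> g"
  shows "f = g"
proof -
  note X = HomD(4)[OF assms(1)]
  have "f \<bullet> Lunit C X = g \<bullet> Lunit C X"
    using lunit_natural assms by metis
  then show ?thesis
    using iso_epi[OF lunit_iso lunit_closed] X assms by blast
qed

lemma tensor_unit_cancel:
  assumes "f \<in> Hom C X Y" "g \<in> Hom C X Y" "f \<star> Idn C \<I> = g \<star> Idn C \<I>"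
  shows "f = g"
proof -
  note X = HomD(4)[OF assms(1)]
  have "f \<bullet> Runit C X = g \<bullet> Runit C X"
    using runit_natural assms by metis
  then show ?thesis
    using iso_epi[OF runit_iso runit_closed] X assms by blast
qed

text \<open>Kelly's derivation: tensored with \<open>\<I>\<close> and preceded by the isomorphisms
  \<open>?a\<close> and \<open>?b\<close>, both sides become the same arrow \<open>?d\<close>. One
  side uses the pentagon for \<open>\<I>\<close>, \<open>\<I>\<close>, \<open>X\<close>,
  \<open>Y\<close>, a triangle and naturality of the associator; the other uses naturality and a
  triangle.\<close>

lemma lunit_tensor:
  assumes X [simp]: "X \<in> Obj C" and Y [simp]: "Y \<in> Obj C"
  shows "Lunit C (X \<boxtimes> Y) \<bullet> Assoc C \<I> X Y = Lunit C X \<star> Idn C Y"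
proof (rule unit_tensor_cancel)
  let ?k = "Lunit C (X \<boxtimes> Y) \<bullet> Assoc C \<I> X Y" and ?m = "Lunit C X \<star> Idn C Y"
  let ?a = "Assoc C \<I> (\<I> \<boxtimes> X) Y" and ?b = "Assoc C \<I> \<I> X \<star> Idn C Y"
  let ?d = "Assoc C \<I> X Y \<bullet> ((Runit C \<I> \<star> Idn C X) \<star> Idn C Y)"
  have "(Idn C \<I> \<star> ?k) \<bullet> (?a \<bullet> ?b)
      = (Idn C \<I> \<star> Lunit C (X \<boxtimes> Y)) \<bullet> ((Idn C \<I> \<star> Assoc C \<I> X Y) \<bullet> ?a \<bullet> ?b)"
    by (simp add: whisker_left[symmetric] comp_assoc_arr)
  also have "\<dots> = (Idn C \<I> \<star> Lunit C (X \<boxtimes> Y)) \<bullet> (Assoc C \<I> \<I> (X \<boxtimes> Y) \<bullet> Assoc C (\<I> \<boxtimes> \<I>) X Y)"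
    by (simp add: pentagon)
  also have "\<dots> = ((Idn C \<I> \<star> Lunit C (X \<boxtimes> Y)) \<bullet> Assoc C \<I> \<I> (X \<boxtimes> Y)) \<bullet> Assoc C (\<I> \<boxtimes> \<I>) X Y"
    by (simp add: comp_assoc_arr)
  also have "\<dots> = (Runit C \<I> \<star> (Idn C X \<star> Idn C Y)) \<bullet> Assoc C (\<I> \<boxtimes> \<I>) X Y"
    by (simp add: triangle tarr_idn)
  also have "\<dots> = ?d"
    by (rule assoc_natural[symmetric]) (auto simp: Hom_def)
  finally have 1: "(Idn C \<I> \<star> ?k) \<bullet> (?a \<bullet> ?b) = ?d" .
  have "(Idn C \<I> \<star> ?m) \<bullet> (?a \<bullet> ?b) = ((Idn C \<I> \<star> ?m) \<bullet> ?a) \<bullet> ?b"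
    by (simp add: comp_assoc_arr)
  also have "\<dots> = (Assoc C \<I> X Y \<bullet> ((Idn C \<I> \<star> Lunit C X) \<star> Idn C Y)) \<bullet> ?b"
    by (subst assoc_natural[symmetric]) (auto simp: Hom_def)
  also have "\<dots> = Assoc C \<I> X Y \<bullet> (((Idn C \<I> \<star> Lunit C X) \<bullet> Assoc C \<I> \<I> X) \<star> Idn C Y)"
    by (simp add: comp_assoc_arr interchange)
  also have "\<dots> = ?d"
    by (simp add: triangle)
  finally have 2: "((Idn C \<I> \<star> ?k) \<bullet> ?a) \<bullet> ?b = ((Idn C \<I> \<star> ?m) \<bullet> ?a) \<bullet> ?b"
    using 1 by (simp add: comp_assoc_arr)
  have "(Idn C \<I> \<star> ?k) \<bullet> ?a = (Idn C \<I> \<star> ?m) \<bullet> ?a"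
    by (rule iso_epi[OF _ _ _ _ 2]) (auto simp: Hom_def iso_arrow_tensor iso_arrow_idn assoc_iso)
  then show "Idn C \<I> \<star> ?k = Idn C \<I> \<star> ?m"
    by (rule iso_epi[rotated 4]) (auto simp: Hom_def assoc_iso)
qed (auto simp: Hom_def)

text \<open>Naturality of the left unit isomorphism at the arrow \<open>Lunit C X\<close> itself,
  followed by cancelling \<open>Lunit C X\<close>.\<close>

lemma lunit_unit_tensor:
  assumes [simp]: "X \<in> Obj C"
  shows "Lunit C (\<I> \<boxtimes> X) = Idn C \<I> \<star> Lunit C X"
proof -
  have "Lunit C X \<bullet> (Idn C \<I> \<star> Lunit C X) = Lunit C X \<bullet> Lunit C (\<I> \<boxtimes> X)"
    by (rule lunit_natural) (auto simp: Hom_def)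
  then show ?thesis
    by - (rule iso_mono[OF lunit_iso[OF assms] lunit_closed[OF assms]], auto simp: Hom_def)
qed

text \<open>Tensored with \<open>\<I>\<close> on the right, both arrows equal
  \<open>Idn C \<I> \<star> Lunit C \<I>\<close> after the associator: one by the triangle, the
  other by the two preceding lemmas.\<close>

lemma lunit_unit_eq_runit_unit: "Lunit C \<I> = Runit C \<I>"
proof (rule tensor_unit_cancel)
  show "Lunit C \<I> \<star> Idn C \<I> = Runit C \<I> \<star> Idn C \<I>"
    using lunit_tensor[of \<I> \<I>] lunit_unit_tensor[of \<I>] triangle[of \<I> \<I>] by simp
qed (auto simp: Hom_def)

text \<open>Since \<open>l = r\<close> at the unit, tensoring \<open>s\<close> with the identity on
  either side gives the conjugate of \<open>s\<close> by the same isomorphism.\<close>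

lemma endo_tensor_unit:
  assumes "s \<in> Hom C \<I> \<I>"
  shows "Lunit C \<I> \<bullet> (Idn C \<I> \<star> s) = s \<bullet> Lunit C \<I>" "Lunit C \<I> \<bullet> (s \<star> Idn C \<I>) = s \<bullet> Lunit C \<I>"
    "s \<star> Idn C \<I> = Idn C \<I> \<star> s"
proof -
  show *: "Lunit C \<I> \<bullet> (Idn C \<I> \<star> s) = s \<bullet> Lunit C \<I>" "Lunit C \<I> \<bullet> (s \<star> Idn C \<I>) = s \<bullet> Lunit C \<I>"
    using lunit_natural[OF assms] runit_natural[OF assms] by (auto simp: lunit_unit_eq_runit_unit)
  show "s \<star> Idn C \<I> = Idn C \<I> \<star> s"
    using * HomD[OF assms] by - (rule iso_mono[OF lunit_iso[OF unit_obj] lunit_closed[OF unit_obj]], auto simp: Hom_def)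
qed

text \<open>An Eckmann-Hilton argument: \<open>s\<close> may be moved to the other tensor factor,
  where it slides past \<open>t\<close> by interchange.\<close>

lemma endo_unit_comm:
  assumes "s \<in> Hom C \<I> \<I>" "t \<in> Hom C \<I> \<I>"
  shows "s \<bullet> t = t \<bullet> s"
proof (rule unit_tensor_cancel)
  note [simp] = HomD[OF assms(1)] HomD[OF assms(2)]
  have "Idn C \<I> \<star> (s \<bullet> t) = (s \<star> Idn C \<I>) \<bullet> (Idn C \<I> \<star> t)"
    using endo_tensor_unit(3)[OF assms(1)] by (simp add: interchange)
  also have "\<dots> = (Idn C \<I> \<star> t) \<bullet> (s \<star> Idn C \<I>)"
    by (simp add: interchange)
  also have "\<dots> = Idn C \<I> \<star> (t \<bullet> s)"
    using endo_tensor_unit(3)[OF assms(1)] by (simp add: interchange)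
  finally show "Idn C \<I> \<star> (s \<bullet> t) = Idn C \<I> \<star> (t \<bullet> s)" .
qed (use HomD[OF assms(1)] HomD[OF assms(2)] in \<open>auto simp: Hom_def\<close>)

text \<open>Conjugating by \<open>l\<close> turns \<open>\<sigma>\<close> into an endomorphism
  \<open>s\<close> of the unit, so \<open>\<sigma>\<close> is \<open>s\<close> tensored with the
  identity. In the hexagon for three units, followed by
  \<open>Idn C \<I> \<star> Lunit C \<I>\<close>, one side reduces to a single
  \<open>\<sigma>\<close> by naturality of the braiding, while the other contains
  \<open>\<sigma>\<close> twice and loses it by symmetry.\<close>

lemma braid_unit_unit: "Braid C \<I> \<I> = Idn C (\<I> \<boxtimes> \<I>)"
proof -
  let ?\<sigma> = "Braid C \<I> \<I>" and ?l = "Lunit C \<I>" and ?i = "Idn C \<I>" and ?a = "Assoc C \<I> \<I> \<I>"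
  let ?li = "inv_arrow C ?l"
  have li: "?li \<in> Hom C \<I> (\<I> \<boxtimes> \<I>)" "?li \<bullet> ?l = Idn C (\<I> \<boxtimes> \<I>)" "?l \<bullet> ?li = ?i"
    using inv_arrow[OF lunit_iso lunit_closed] by auto
  note [simp] = HomD[OF li(1)]
  define s where "s = ?l \<bullet> ?\<sigma> \<bullet> ?li"
  have s: "s \<in> Hom C \<I> \<I>"
    unfolding s_def by (auto simp: Hom_def)
  note [simp] = HomD[OF s]
  have ls: "s \<bullet> ?l = ?l \<bullet> ?\<sigma>"
    unfolding s_def using li by (simp add: comp_assoc_arr)
  have \<sigma>: "?\<sigma> = ?i \<star> s"
    using endo_tensor_unit(1)[OF s] ls
    by - (rule iso_mono[OF lunit_iso[OF unit_obj] lunit_closed[OF unit_obj]], auto simp: Hom_def)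
  have tri: "(?i \<star> ?l) \<bullet> ?a = ?l \<star> ?i"
    using triangle[of \<I> \<I>] by (simp add: lunit_unit_eq_runit_unit)
  have "(?i \<star> ?l) \<bullet> (?a \<bullet> Braid C \<I> (\<I> \<boxtimes> \<I>) \<bullet> ?a) = ((?i \<star> ?l) \<bullet> ?a) \<bullet> Braid C \<I> (\<I> \<boxtimes> \<I>) \<bullet> ?a"
    by (simp add: comp_assoc_arr)
  also have "\<dots> = ((?l \<star> ?i) \<bullet> Braid C \<I> (\<I> \<boxtimes> \<I>)) \<bullet> ?a"
    by (simp add: tri)
  also have "\<dots> = (?\<sigma> \<bullet> (?i \<star> ?l)) \<bullet> ?a"
    by (subst braid_natural) (auto simp: Hom_def)
  also have "\<dots> = ?\<sigma> \<bullet> (?l \<star> ?i)"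
    by (simp add: comp_assoc_arr tri)
  finally have 1: "(?i \<star> ?l) \<bullet> (?a \<bullet> Braid C \<I> (\<I> \<boxtimes> \<I>) \<bullet> ?a) = ?\<sigma> \<bullet> (?l \<star> ?i)" .
  have "(?i \<star> ?l) \<bullet> ((?i \<star> ?\<sigma>) \<bullet> ?a \<bullet> (?\<sigma> \<star> ?i)) = (?i \<star> (?l \<bullet> ?\<sigma>)) \<bullet> (?a \<bullet> (?\<sigma> \<star> ?i))"
    by (simp add: whisker_left[symmetric] comp_assoc_arr)
  also have "\<dots> = (?i \<star> s) \<bullet> ((?i \<star> ?l) \<bullet> ?a) \<bullet> (?\<sigma> \<star> ?i)"
    by (simp add: ls[symmetric] whisker_left[symmetric] comp_assoc_arr)
  also have "\<dots> = (?i \<star> s) \<bullet> ((?l \<bullet> ?\<sigma>) \<star> ?i)"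
    by (simp add: tri whisker_right comp_assoc_arr)
  also have "\<dots> = ?\<sigma> \<bullet> (?\<sigma> \<bullet> (?l \<star> ?i))"
    by (simp add: ls[symmetric] whisker_right[symmetric] endo_tensor_unit(3)[OF s] \<sigma>[symmetric])
  also have "\<dots> = ?l \<star> ?i"
    using symmetry[of \<I> \<I>] by (simp flip: comp_assoc_arr)
  finally have "?\<sigma> \<bullet> (?l \<star> ?i) = Idn C (\<I> \<boxtimes> \<I>) \<bullet> (?l \<star> ?i)"
    using 1 hexagon[of \<I> \<I> \<I>] by simp
  then show ?thesis
    by (rule iso_epi[rotated 4]) (auto simp: Hom_def iso_arrow_tensor iso_arrow_idn lunit_iso)
qed

end

section \<open>Tensor products of arrows out of the unit object\<close>

context symmetric_monoidal
begin

lemma inv_unit_simps [simp]: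
  assumes "X \<in> Obj C"
  shows "inv_arrow C (Lunit C X) \<in> Arr C" "Src C (inv_arrow C (Lunit C X)) = X"
    "Tgt C (inv_arrow C (Lunit C X)) = \<I> \<boxtimes> X"
    "Lunit C X \<bullet> inv_arrow C (Lunit C X) = Idn C X" "inv_arrow C (Lunit C X) \<bullet> Lunit C X = Idn C (\<I> \<boxtimes> X)"
    and "inv_arrow C (Runit C X) \<in> Arr C" "Src C (inv_arrow C (Runit C X)) = X"
    "Tgt C (inv_arrow C (Runit C X)) = X \<boxtimes> \<I>"
    "Runit C X \<bullet> inv_arrow C (Runit C X) = Idn C X" "inv_arrow C (Runit C X) \<bullet> Runit C X = Idn C (X \<boxtimes> \<I>)"
  using inv_arrow[OF lunit_iso lunit_closed, OF assms assms]
    inv_arrow[OF runit_iso runit_closed, OF assms assms] by (auto simp: Hom_def)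

lemma inv_lunit_natural:
  assumes f: "f \<in> Hom C X Y"
  shows "(Idn C \<I> \<star> f) \<bullet> inv_arrow C (Lunit C X) = inv_arrow C (Lunit C Y) \<bullet> f"
proof -
  note [simp] = HomD[OF f]
  have "Lunit C Y \<bullet> ((Idn C \<I> \<star> f) \<bullet> inv_arrow C (Lunit C X))
      = (Lunit C Y \<bullet> (Idn C \<I> \<star> f)) \<bullet> inv_arrow C (Lunit C X)"
    by (simp add: comp_assoc_arr)
  also have "\<dots> = (Lunit C Y \<bullet> inv_arrow C (Lunit C Y)) \<bullet> f"
    by (simp add: lunit_natural[OF f] comp_assoc_arr)
  also have "\<dots> = Lunit C Y \<bullet> (inv_arrow C (Lunit C Y) \<bullet> f)"
    by (rule comp_assoc_arr) auto
  finally show ?thesis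
    by - (rule iso_mono[OF lunit_iso lunit_closed], auto simp: Hom_def)
qed

lemma inv_runit_natural:
  assumes f: "f \<in> Hom C X Y"
  shows "(f \<star> Idn C \<I>) \<bullet> inv_arrow C (Runit C X) = inv_arrow C (Runit C Y) \<bullet> f"
proof -
  note [simp] = HomD[OF f]
  have "Runit C Y \<bullet> ((f \<star> Idn C \<I>) \<bullet> inv_arrow C (Runit C X))
      = (Runit C Y \<bullet> (f \<star> Idn C \<I>)) \<bullet> inv_arrow C (Runit C X)"
    by (simp add: comp_assoc_arr)
  also have "\<dots> = (Runit C Y \<bullet> inv_arrow C (Runit C Y)) \<bullet> f"
    by (simp add: runit_natural[OF f] comp_assoc_arr)
  also have "\<dots> = Runit C Y \<bullet> (inv_arrow C (Runit C Y) \<bullet> f)"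
    by (rule comp_assoc_arr) auto
  finally show ?thesis
    by - (rule iso_mono[OF runit_iso runit_closed], auto simp: Hom_def)
qed

lemma points_tensor_right:
  assumes u: "u \<in> Hom C \<I> X" and v: "v \<in> Hom C \<I> Y"
  shows "(u \<star> v) \<bullet> inv_arrow C (Lunit C \<I>) = ((u \<star> Idn C Y) \<bullet> inv_arrow C (Lunit C Y)) \<bullet> v"
proof -
  note [simp] = HomD[OF u] HomD[OF v]
  have "u \<star> v = (u \<star> Idn C Y) \<bullet> (Idn C \<I> \<star> v)"
    by (simp add: interchange)
  then show ?thesis
    by (simp add: comp_assoc_arr inv_lunit_natural[OF v])
qed

lemma points_tensor_left:
  assumes u: "u \<in> Hom C \<I> X" and v: "v \<in> Hom C \<I> Y"
  shows "(u \<star> v) \<bullet> inv_arrow C (Lunit C \<I>) = ((Idn C X \<star> v) \<bullet> inv_arrow C (Runit C X)) \<bullet> u"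
proof -
  note [simp] = HomD[OF u] HomD[OF v]
  have "u \<star> v = (Idn C X \<star> v) \<bullet> (u \<star> Idn C \<I>)"
    by (simp add: interchange)
  then show ?thesis
    by (simp add: comp_assoc_arr inv_runit_natural[OF u] lunit_unit_eq_runit_unit)
qed

text \<open>The triangle at the unit object with both unit isomorphisms inverted;
  \<open>l = r\<close> makes them the same arrow.\<close>

lemma assoc_inv_lunit:
  "Assoc C \<I> \<I> \<I> \<bullet> (inv_arrow C (Lunit C \<I>) \<star> Idn C \<I>) = Idn C \<I> \<star> inv_arrow C (Lunit C \<I>)"
proof -
  let ?i = "Idn C \<I>" and ?l = "Lunit C \<I>" and ?li = "inv_arrow C (Lunit C \<I>)"
  have "(?i \<star> ?l) \<bullet> (Assoc C \<I> \<I> \<I> \<bullet> (?li \<star> ?i)) = ((?i \<star> ?l) \<bullet> Assoc C \<I> \<I> \<I>) \<bullet> (?li \<star> ?i)"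
    by (simp add: comp_assoc_arr)
  also have "\<dots> = (?i \<star> ?l) \<bullet> (?i \<star> ?li)"
    using triangle[of \<I> \<I>] by (simp add: lunit_unit_eq_runit_unit interchange)
  finally show ?thesis
    by - (rule iso_mono[OF iso_arrow_tensor[OF iso_arrow_idn[OF unit_obj] lunit_iso[OF unit_obj]]],
        auto simp: Hom_def)
qed

text \<open>Here the associator is absorbed: a triple of points bracketed to the left becomes a
  point paired with a pair of points, which is the shape of an iterated product.\<close>

lemma points_tensor_nested:
  assumes u: "u \<in> Hom C \<I> X" and v: "v \<in> Hom C \<I> Y" and x: "x \<in> Hom C \<I> Z"
  shows "Assoc C X Y Z \<bullet> (((u \<star> v) \<star> x) \<bullet> (inv_arrow C (Lunit C \<I>) \<star> Idn C \<I>))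
    = u \<star> ((v \<star> x) \<bullet> inv_arrow C (Lunit C \<I>))"
proof -
  note [simp] = HomD[OF u] HomD[OF v] HomD[OF x]
  let ?li = "inv_arrow C (Lunit C \<I>)"
  have "Assoc C X Y Z \<bullet> (((u \<star> v) \<star> x) \<bullet> (?li \<star> Idn C \<I>))
      = (Assoc C X Y Z \<bullet> ((u \<star> v) \<star> x)) \<bullet> (?li \<star> Idn C \<I>)"
    by (simp add: comp_assoc_arr)
  also have "\<dots> = (u \<star> (v \<star> x)) \<bullet> (Assoc C \<I> \<I> \<I> \<bullet> (?li \<star> Idn C \<I>))"
    by (simp add: assoc_natural[OF u v x] comp_assoc_arr)
  also have "\<dots> = u \<star> ((v \<star> x) \<bullet> ?li)"
    by (simp add: assoc_inv_lunit interchange)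
  finally show ?thesis .
qed

end

section \<open>Precomposition as a homomorphism of hom groups\<close>

lemma hom_group_simps [simp]:
  "carrier (hom_group C X Y) = Hom C X Y" "add (hom_group C X Y) = Plus C"
  "zero (hom_group C X Y) = Zero C X Y"
  by (auto simp: hom_group_def)

context preadditive_category
begin

text \<open>The axioms state additivity of composition only. Packaged as a \<open>group_hom\<close>,
  precomposition also respects zero, negatives and the integer multiples occurring in
  \<open>fd_deriv\<close>.\<close>

lemma precomp_group_hom:
  assumes f: "f \<in> Hom C X Y" and Z: "Z \<in> Obj C"
  shows "group_hom (add_monoid (hom_group C Y Z)) (add_monoid (hom_group C X Z)) (\<lambda>g. g \<bullet> f)"
proof (intro group_hom.intro group_hom_axioms.intro)
  show "group (add_monoid (hom_group C Y Z))" "group (add_monoid (hom_group C X Z))"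
    using abelian_group_hom abelian_group.a_group HomD[OF f] Z by blast+
  show "(\<lambda>g. g \<bullet> f) \<in> hom (add_monoid (hom_group C Y Z)) (add_monoid (hom_group C X Z))"
    using comp_closed[OF f] comp_plus_left[OF f] by (auto simp: hom_def)
qed

lemma comp_zero_left:
  assumes "f \<in> Hom C X Y" "Z \<in> Obj C"
  shows "Zero C Y Z \<bullet> f = Zero C X Z"
  using group_hom.hom_one[OF precomp_group_hom[OF assms]] by simp

lemma comp_minus_left:
  assumes f: "f \<in> Hom C X Y" and g: "g \<in> Hom C Y Z" and h: "h \<in> Hom C Y Z"
  shows "(g \<ominus>\<^bsub>hom_group C Y Z\<^esub> h) \<bullet> f = g \<bullet> f \<ominus>\<^bsub>hom_group C X Z\<^esub> h \<bullet> f"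
proof -
  interpret YZ: abelian_group "hom_group C Y Z"
    using abelian_group_hom HomD[OF g] by blast
  have "\<ominus>\<^bsub>hom_group C Y Z\<^esub> h \<in> Hom C Y Z"
    using YZ.a_inv_closed h by simp
  moreover have "(\<ominus>\<^bsub>hom_group C Y Z\<^esub> h) \<bullet> f = \<ominus>\<^bsub>hom_group C X Z\<^esub> (h \<bullet> f)"
    using group_hom.hom_inv[OF precomp_group_hom[OF f HomD(5)[OF g]], of h] h by (simp add: a_inv_def)
  ultimately show ?thesis
    using comp_plus_left[OF f g] by (simp add: a_minus_def)
qed

lemma comp_int_pow_left:
  assumes f: "f \<in> Hom C X Y" and g: "g \<in> Hom C Y Z"
  shows "([(n::int)] \<cdot>\<^bsub>hom_group C Y Z\<^esub> g) \<bullet> f = [n] \<cdot>\<^bsub>hom_group C X Z\<^esub> (g \<bullet> f)"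
  using group_hom.hom_int_pow[OF precomp_group_hom[OF f HomD(5)[OF g]], of g n] g
  by (simp add: add_pow_def)

end

text \<open>Multiplication by \<open>z - w\<close> consists of index shifts and differences, so a
  map compatible with differences commutes with it. As \<open>h\<close> is controlled on the carrier
  only, the induction also carries the fact that all coefficients stay in the carrier.\<close>

lemma times_z_minus_w_pow_map:
  assumes G: "abelian_group G" and F: "\<And>p q. F p q \<in> carrier G"
    and h: "\<And>x y. x \<in> carrier G \<Longrightarrow> y \<in> carrier G \<Longrightarrow> h (x \<ominus>\<^bsub>G\<^esub> y) = h x \<ominus>\<^bsub>H\<^esub> h y"
  shows "(times_z_minus_w H ^^ K) (\<lambda>p q. h (F p q)) = (\<lambda>p q. h ((times_z_minus_w G ^^ K) F p q))"
proof -
  have "(\<forall>p q. (times_z_minus_w G ^^ K) F p q \<in> carrier G) \<and> ?thesis"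
  proof (induction K)
    case 0
    show ?case using F by simp
  next
    case (Suc K)
    then show ?case
      using h abelian_group.minus_closed[OF G] by (auto simp: times_z_minus_w_def fun_eq_iff)
  qed
  then show ?thesis ..
qed

section \<open>The vertex algebra of points\<close>

text \<open>\<open>hom_group\<close>, \<open>hom_module\<close> and \<open>end_ring\<close> have the
  same kind of additive part but are different records; this moves the group structure from the
  first to the other two.\<close>

lemma abelian_group_cong:
  assumes G: "abelian_group G" and eq: "carrier H = carrier G" "add H = add G" "zero H = zero G"
  shows "abelian_group H"
proof -
  interpret G: abelian_group G by (fact G)
  show ?thesis
  proof (rule abelian_groupI)
    show "\<exists>y\<in>carrier H. y \<oplus>\<^bsub>H\<^esub> x = \<zero>\<^bsub>H\<^esub>" if "x \<in> carrier H" for x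
      using that G.l_neg[of x] G.a_inv_closed[of x] unfolding eq by blast
  qed (auto simp: eq G.a_ac)
qed

lemma hom_module_simps [simp]:
  "carrier (hom_module C X) = Hom C \<I>\<^bsub>C\<^esub> X" "add (hom_module C X) = Plus C"
  "zero (hom_module C X) = Zero C \<I>\<^bsub>C\<^esub> X" "smult (hom_module C X) r f = f \<bullet>\<^bsub>C\<^esub> r"
  by (auto simp: hom_module_def)

lemma hom_module_inv:
  "m_inv (add_monoid (hom_module C X)) = m_inv (add_monoid (hom_group C \<I>\<^bsub>C\<^esub> X))"
  by (simp add: fun_eq_iff m_inv_def)

lemma hom_module_minus: "a_minus (hom_module C X) = a_minus (hom_group C \<I>\<^bsub>C\<^esub> X)"
  unfolding fun_eq_iff a_minus_def a_inv_def hom_module_inv by simp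

lemma hom_module_int_pow:
  "[(n::int)] \<cdot>\<^bsub>hom_module C X\<^esub> f = [n] \<cdot>\<^bsub>hom_group C \<I>\<^bsub>C\<^esub> X\<^esub> f"
  unfolding add_pow_def int_pow_def nat_pow_def hom_module_inv by simp

section \<open>Endomorphisms of the unit as a commutative ring, and points as a module over
  it\<close>

lemma end_ring_simps [simp]:
  "carrier (end_ring C) = Hom C \<I>\<^bsub>C\<^esub> \<I>\<^bsub>C\<^esub>" "mult (end_ring C) = Comp C" "one (end_ring C) = Idn C \<I>\<^bsub>C\<^esub>"
  "zero (end_ring C) = Zero C \<I>\<^bsub>C\<^esub> \<I>\<^bsub>C\<^esub>" "add (end_ring C) = Plus C"
  by (auto simp: end_ring_def)

locale preadditive_symmetric_monoidal = symmetric_monoidal C + preadditive_category C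
  for C :: "('o, 'a, 'm) sm_cat_scheme" (structure)
begin

lemma end_ring_cring: "cring (end_ring C)"
proof (rule cringI)
  interpret G: abelian_group "hom_group C \<I> \<I>"
    by (rule abelian_group_hom) auto
  show "abelian_group (end_ring C)"
    by (rule abelian_group_cong[OF G.abelian_group_axioms]) auto
  show "Group.comm_monoid (end_ring C)"
    by (rule comm_monoidI)
      (auto intro: comp_closed comp_assoc idn_left endo_unit_comm idn_closed)
qed (auto intro: comp_plus_left)

lemma hom_module_module:
  assumes "X \<in> Obj C"
  shows "module (end_ring C) (hom_module C X)"
proof (rule moduleI)
  interpret G: abelian_group "hom_group C \<I> X"
    using assms by (intro abelian_group_hom) auto
  show "abelian_group (hom_module C X)"
    by (rule abelian_group_cong[OF G.abelian_group_axioms]) auto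
  \<comment> \<open>Precomposition is a right action; it is also a left one because endomorphisms of
    the unit commute.\<close>
  show "a \<otimes>\<^bsub>end_ring C\<^esub> b \<odot>\<^bsub>hom_module C X\<^esub> f = a \<odot>\<^bsub>hom_module C X\<^esub> (b \<odot>\<^bsub>hom_module C X\<^esub> f)"
    if "a \<in> carrier (end_ring C)" "b \<in> carrier (end_ring C)" "f \<in> carrier (hom_module C X)" for a b f
    using that comp_assoc[of a \<I> \<I> b \<I> f X] by (simp add: endo_unit_comm[of a b])
qed (auto intro: end_ring_cring comp_closed comp_plus_left comp_plus_right idn_right)

end

context vertex_algebra_in
begin

sublocale preadditive_symmetric_monoidal ..

lemma prd_simps [simp]:
  "prd n \<in> Arr C" "Src C (prd n) = V \<boxtimes> V" "Tgt C (prd n) = V"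
  "vac \<in> Arr C" "Src C vac = \<I>" "Tgt C vac = V"
  "T \<in> Arr C" "Src C T = V" "Tgt C T = V" "V \<in> Obj C"
  using HomD[OF prd_closed[of n]] HomD[OF vac_closed] HomD[OF T_closed] V_closed by auto

lemma field_of_simps [simp]:
  "field_of prd p \<in> Arr C" "Src C (field_of prd p) = V \<boxtimes> V" "Tgt C (field_of prd p) = V"
  by (auto simp: field_of_def)

lemma field_of_hom_product:
  "field_of (hom_product C prd) p u v = field_of prd p \<bullet> ((u \<star> v) \<bullet> inv_arrow C (Lunit C \<I>))"
  if "u \<in> Hom C \<I> V" "v \<in> Hom C \<I> V"
  using HomD[OF that(1)] HomD[OF that(2)] by (simp add: field_of_def hom_product_def comp_assoc_arr)

lemma hom_product_right:
  assumes u: "u \<in> Hom C \<I> V" and v: "v \<in> Hom C \<I> V"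
  shows "hom_product C prd n u v
    = (prd n \<bullet> ((u \<star> Idn C V) \<bullet> inv_arrow C (Lunit C V))) \<bullet> v"
  using points_tensor_right[OF u v] HomD[OF u] HomD[OF v]
  by (simp add: hom_product_def comp_assoc_arr)

lemma hom_product_left:
  assumes u: "u \<in> Hom C \<I> V" and v: "v \<in> Hom C \<I> V"
  shows "hom_product C prd n u v
    = (prd n \<bullet> ((Idn C V \<star> v) \<bullet> inv_arrow C (Runit C V))) \<bullet> u"
  using points_tensor_left[OF u v] HomD[OF u] HomD[OF v]
  by (simp add: hom_product_def comp_assoc_arr)

lemma hom_product_closed:
  assumes u: "u \<in> Hom C \<I> V" and v: "v \<in> Hom C \<I> V"
  shows "hom_product C prd n u v \<in> Hom C \<I> V"
  using HomD[OF u] HomD[OF v] by (simp add: hom_product_def Hom_def)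

lemma hom_product_truncation:
  assumes unit: "compact_object TYPE('i) C \<I>" and u: "u \<in> Hom C \<I> V" and v: "v \<in> Hom C \<I> V"
  shows "\<exists>K. \<forall>n\<ge>K. hom_product C prd n u v = Zero C \<I> V"
proof -
  obtain K where "\<forall>n\<ge>K. prd n \<bullet> (u \<star> v) = Zero C (\<I> \<boxtimes> \<I>) V"
    using truncation[OF unit unit u v] by blast
  then show ?thesis
    by (auto simp: hom_product_def intro!: exI[of _ K] comp_zero_left HomI)
qed

lemma hom_product_translation:
  assumes u: "u \<in> Hom C \<I> V" and v: "v \<in> Hom C \<I> V"
  shows "T \<bullet> field_of (hom_product C prd) p u v
      \<ominus>\<^bsub>hom_module C V\<^esub> field_of (hom_product C prd) p u (T \<bullet> v)
    = fd_deriv (hom_module C V) (\<lambda>r. field_of (hom_product C prd) r u v) p"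
proof -
  note [simp] = HomD[OF u] HomD[OF v]
  define s where "s = (u \<star> v) \<bullet> inv_arrow C (Lunit C \<I>)"
  have s: "s \<in> Hom C \<I> (V \<boxtimes> V)"
    unfolding s_def by (auto simp: Hom_def)
  note [simp] = HomD[OF s]
  have "u \<star> (T \<bullet> v) = (Idn C V \<star> T) \<bullet> (u \<star> v)"
    by (simp add: interchange)
  then have "field_of (hom_product C prd) p u (T \<bullet> v) = (field_of prd p \<bullet> (Idn C V \<star> T)) \<bullet> s"
    using comp_closed[OF v T_closed] by (simp add: field_of_hom_product u comp_assoc_arr s_def)
  moreover have "T \<bullet> field_of (hom_product C prd) p u v = (T \<bullet> field_of prd p) \<bullet> s"
    by (simp add: field_of_hom_product u v comp_assoc_arr flip: s_def)
  ultimately have "T \<bullet> field_of (hom_product C prd) p u v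
      \<ominus>\<^bsub>hom_module C V\<^esub> field_of (hom_product C prd) p u (T \<bullet> v)
    = (T \<bullet> field_of prd p \<ominus>\<^bsub>hom_group C (V \<boxtimes> V) V\<^esub> field_of prd p \<bullet> (Idn C V \<star> T)) \<bullet> s"
    by (subst comp_minus_left[OF s]) (auto simp: hom_module_minus intro!: HomI)
  also have "\<dots> = fd_deriv (hom_group C (V \<boxtimes> V) V) (field_of prd) p \<bullet> s"
    by (simp add: translation)
  also have "\<dots> = fd_deriv (hom_module C V) (\<lambda>r. field_of (hom_product C prd) r u v) p"
    unfolding fd_deriv_def
    by (subst comp_int_pow_left[OF s])
      (auto simp: hom_module_int_pow field_of_hom_product u v s_def intro!: HomI)
  finally show ?thesis .
qed

text \<open>The arrow \<open>\<one> \<rightarrow> (\<one> \<otimes> \<one>) \<otimes> V\<close> below turns each composite of the locality axiom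
  into an iterated product; the one with the braiding is dealt with by \<open>\<sigma>\<^bsub>\<one>,\<one>\<^esub> = id\<close>.\<close>

lemma hom_product_locality:
  assumes unit: "compact_object TYPE('i) C \<I>" and u: "u \<in> Hom C \<I> V" and v: "v \<in> Hom C \<I> V"
  defines "Y \<equiv> field_of (hom_product C prd)"
  shows "\<exists>K. \<forall>x\<in>Hom C \<I> V. (times_z_minus_w (hom_module C V) ^^ K)
      (\<lambda>p q. Y p u (Y q v x) \<ominus>\<^bsub>hom_module C V\<^esub> Y q v (Y p u x)) = (\<lambda>p q. Zero C \<I> V)"
proof -
  note [simp] = HomD[OF u] HomD[OF v]
  let ?G = "hom_group C ((\<I> \<boxtimes> \<I>) \<boxtimes> V) V" and ?M = "hom_group C \<I> V"
  let ?y = "field_of prd" and ?li = "inv_arrow C (Lunit C \<I>)"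
  \<comment> \<open>In the axiom the first argument carries \<open>w\<close> and the second
    \<open>z\<close>, whereas here \<open>u\<close> goes with \<open>z\<close> and \<open>v\<close>
    with \<open>w\<close>. The pair is therefore fed in as \<open>(v, u)\<close>: \<open>A\<close>
    becomes the composite in which \<open>v\<close> acts last, and \<open>A - B\<close> becomes the
    negative of the required commutator.\<close>
  define A where "A p q = ?y q \<bullet> (Idn C V \<star> ?y p) \<bullet> Assoc C V V V \<bullet> ((v \<star> u) \<star> Idn C V)" for p q
  define B where "B p q = ?y p \<bullet> (Idn C V \<star> ?y q) \<bullet> Assoc C V V V
      \<bullet> (Braid C V V \<star> Idn C V) \<bullet> ((v \<star> u) \<star> Idn C V)" for p q
  define F where "F p q = A p q \<ominus>\<^bsub>?G\<^esub> B p q" for p q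
  obtain K where K: "(times_z_minus_w ?G ^^ K) F = (\<lambda>p q. Zero C ((\<I> \<boxtimes> \<I>) \<boxtimes> V) V)"
    using locality[OF unit unit v u] unfolding F_def[abs_def] A_def B_def by blast
  have AB: "A p q \<in> Hom C ((\<I> \<boxtimes> \<I>) \<boxtimes> V) V" "B p q \<in> Hom C ((\<I> \<boxtimes> \<I>) \<boxtimes> V) V" for p q
    by (auto simp: A_def B_def Hom_def)
  interpret G: abelian_group ?G
    by (rule abelian_group_hom) auto
  interpret M: abelian_group ?M
    by (rule abelian_group_hom) auto
  show ?thesis
  \<comment> \<open>\<open>K\<close> is fixed before \<open>x\<close>: the axiom keeps the identity
    of \<open>V\<close> in the third factor, so one exponent serves all \<open>x\<close>.\<close>
  proof (intro exI[of _ K] ballI)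
    fix x assume x: "x \<in> Hom C \<I> V"
    note [simp] = HomD[OF x]
    define s where "s = ((Idn C \<I> \<star> Idn C \<I>) \<star> x) \<bullet> (?li \<star> Idn C \<I>) \<bullet> ?li"
    have s: "s \<in> Hom C \<I> ((\<I> \<boxtimes> \<I>) \<boxtimes> V)"
      unfolding s_def by (auto simp: Hom_def)
    note [simp] = HomD[OF s]
    have iterated: "?y p \<bullet> ((Idn C V \<star> ?y q) \<bullet> (Assoc C V V V \<bullet> (((a \<star> b) \<star> Idn C V) \<bullet> s))) = Y p a (Y q b x)"
      if a: "a \<in> Hom C \<I> V" and b: "b \<in> Hom C \<I> V" for a b p q
    proof -
      note [simp] = HomD[OF a] HomD[OF b]
      have "((a \<star> b) \<star> Idn C V) \<bullet> s = (((a \<star> b) \<star> x) \<bullet> (?li \<star> Idn C \<I>)) \<bullet> ?li"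
        unfolding s_def by (simp add: comp_assoc_arr[symmetric] interchange)
      then have "Assoc C V V V \<bullet> (((a \<star> b) \<star> Idn C V) \<bullet> s) = (a \<star> ((b \<star> x) \<bullet> ?li)) \<bullet> ?li"
        by (simp add: comp_assoc_arr[symmetric] flip: points_tensor_nested[OF a b x])
      then have "(Idn C V \<star> ?y q) \<bullet> (Assoc C V V V \<bullet> (((a \<star> b) \<star> Idn C V) \<bullet> s))
          = (a \<star> Y q b x) \<bullet> ?li"
        by (simp add: comp_assoc_arr[symmetric] interchange Y_def field_of_hom_product b x)
      then show ?thesis
        using field_of_hom_product[OF a, of "Y q b x" p] hom_product_closed[OF b x, of "- q - 1"]
        by (simp add: Y_def field_of_def)
    qed
    have A: "A p q \<bullet> s = Y q v (Y p u x)" for p q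
      unfolding A_def by (simp add: comp_assoc_arr iterated[OF v u])
    have "(Braid C V V \<star> Idn C V) \<bullet> ((v \<star> u) \<star> Idn C V) = (u \<star> v) \<star> Idn C V"
      using braid_natural[OF v u] by (simp add: whisker_right braid_unit_unit)
    then have "((Braid C V V \<star> Idn C V) \<bullet> ((v \<star> u) \<star> Idn C V)) \<bullet> s = ((u \<star> v) \<star> Idn C V) \<bullet> s"
      by simp
    then have B: "B p q \<bullet> s = Y p u (Y q v x)" for p q
      unfolding B_def by (simp add: comp_assoc_arr iterated[OF u v])
    have Y: "Y p a b \<in> Hom C \<I> V" if "a \<in> Hom C \<I> V" "b \<in> Hom C \<I> V" for p a b
      using hom_product_closed[OF that] by (simp add: Y_def field_of_def)
    \<comment> \<open>Precomposition with \<open>s\<close>, followed by the sign that compensates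
      for the order of \<open>v\<close> and \<open>u\<close>. It is compatible with differences, so
      it passes through the powers of \<open>z - w\<close>.\<close>
    define h where "h f = \<ominus>\<^bsub>?M\<^esub> (f \<bullet> s)" for f
    have "(\<lambda>p q. Y p u (Y q v x) \<ominus>\<^bsub>?M\<^esub> Y q v (Y p u x)) = (\<lambda>p q. h (F p q))"
    proof (intro ext)
      fix p q
      have "h (F p q) = \<ominus>\<^bsub>?M\<^esub> (Y q v (Y p u x) \<ominus>\<^bsub>?M\<^esub> Y p u (Y q v x))"
        unfolding h_def F_def by (simp add: comp_minus_left[OF s AB] A B)
      also have "\<dots> = Y p u (Y q v x) \<ominus>\<^bsub>?M\<^esub> Y q v (Y p u x)"
        using Y u v x M.minus_add M.minus_minus M.a_comm M.a_inv_closed by (simp add: a_minus_def)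
      finally show "Y p u (Y q v x) \<ominus>\<^bsub>?M\<^esub> Y q v (Y p u x) = h (F p q)" ..
    qed
    moreover have "(times_z_minus_w ?M ^^ K) (\<lambda>p q. h (F p q))
        = (\<lambda>p q. h ((times_z_minus_w ?G ^^ K) F p q))"
    proof (rule times_z_minus_w_pow_map)
      show "F p q \<in> carrier ?G" for p q
        using AB G.minus_closed by (simp add: F_def)
      fix f g assume "f \<in> carrier ?G" "g \<in> carrier ?G"
      then have fg: "f \<in> Hom C ((\<I> \<boxtimes> \<I>) \<boxtimes> V) V" "g \<in> Hom C ((\<I> \<boxtimes> \<I>) \<boxtimes> V) V"
        by auto
      have "f \<bullet> s \<in> carrier ?M" "g \<bullet> s \<in> carrier ?M"
        using comp_closed[OF s fg(1)] comp_closed[OF s fg(2)] by auto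
      then show "h (f \<ominus>\<^bsub>?G\<^esub> g) = h f \<ominus>\<^bsub>?M\<^esub> h g"
        unfolding h_def comp_minus_left[OF s fg]
        by (simp only: a_minus_def M.minus_add M.a_inv_closed)
    qed (fact G.abelian_group_axioms)
    moreover have "h (Zero C ((\<I> \<boxtimes> \<I>) \<boxtimes> V) V) = Zero C \<I> V"
      unfolding h_def using M.add.inv_one by (simp add: comp_zero_left[OF s] a_inv_def)
    moreover have "times_z_minus_w (hom_module C V) = times_z_minus_w ?M"
      by (simp add: fun_eq_iff times_z_minus_w_def hom_module_minus)
    ultimately show "(times_z_minus_w (hom_module C V) ^^ K)
        (\<lambda>p q. Y p u (Y q v x) \<ominus>\<^bsub>hom_module C V\<^esub> Y q v (Y p u x)) = (\<lambda>p q. Zero C \<I> V)"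
      by (simp add: K hom_module_minus)
  qed
qed

lemma hom_module_vertex_algebra:
  assumes unit: "compact_object TYPE('i) C \<I>" and rat: "contains_rationals (end_ring C)"
  shows "vertex_algebra_over (end_ring C) (hom_module C V) vac (\<lambda>\<alpha>. T \<bullet> \<alpha>) (hom_product C prd)"
proof (intro vertex_algebra_over.intro vertex_algebra_over_axioms.intro)
  show "module (end_ring C) (hom_module C V)"
    by (rule hom_module_module) simp
  \<comment> \<open>The endomorphisms of \<open>V\<close> left when the first, respectively the
    second, argument of the product is frozen at \<open>u\<close>. Additivity and linearity in the
    free argument are then laws of composition.\<close>
  have L: "prd n \<bullet> ((u \<star> Idn C V) \<bullet> inv_arrow C (Lunit C V)) \<in> Hom C V V"
    and R: "prd n \<bullet> ((Idn C V \<star> u) \<bullet> inv_arrow C (Runit C V)) \<in> Hom C V V"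
    if "u \<in> Hom C \<I> V" for u n
    using HomD[OF that] by (auto simp: Hom_def)
  fix u v u' v' n p a
  {
    assume "u \<in> carrier (hom_module C V)" "v \<in> carrier (hom_module C V)"
    then have uv: "u \<in> Hom C \<I> V" "v \<in> Hom C \<I> V" by auto
    show "hom_product C prd n u v \<in> carrier (hom_module C V)"
      using hom_product_closed[OF uv] by simp
    show "\<exists>K. \<forall>n\<ge>K. hom_product C prd n u v = \<zero>\<^bsub>hom_module C V\<^esub>"
      using hom_product_truncation[OF unit uv] by simp
    show "T \<bullet> field_of (hom_product C prd) p u v
        \<ominus>\<^bsub>hom_module C V\<^esub> field_of (hom_product C prd) p u (T \<bullet> v)
      = fd_deriv (hom_module C V) (\<lambda>r. field_of (hom_product C prd) r u v) p"
      by (rule hom_product_translation[OF uv])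
    show "\<exists>K. \<forall>x\<in>carrier (hom_module C V). (times_z_minus_w (hom_module C V) ^^ K)
        (\<lambda>p q. field_of (hom_product C prd) p u (field_of (hom_product C prd) q v x)
          \<ominus>\<^bsub>hom_module C V\<^esub> field_of (hom_product C prd) q v (field_of (hom_product C prd) p u x))
      = (\<lambda>p q. \<zero>\<^bsub>hom_module C V\<^esub>)"
      using hom_product_locality[OF unit uv] by simp
    show "T \<bullet> (u \<oplus>\<^bsub>hom_module C V\<^esub> v) = T \<bullet> u \<oplus>\<^bsub>hom_module C V\<^esub> T \<bullet> v"
      using comp_plus_right[OF uv T_closed] by simp
  next
    assume "u \<in> carrier (hom_module C V)" "u' \<in> carrier (hom_module C V)" "v \<in> carrier (hom_module C V)"
    then have h: "u \<in> Hom C \<I> V" "u' \<in> Hom C \<I> V" "v \<in> Hom C \<I> V" by auto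
    moreover have "Plus C u u' \<in> Hom C \<I> V"
      using abelian_group_hom[of \<I> V] abelian_monoid.a_closed[of "hom_group C \<I> V" u u'] h
      by (simp add: abelian_group_def)
    ultimately show "hom_product C prd n (u \<oplus>\<^bsub>hom_module C V\<^esub> u') v
        = hom_product C prd n u v \<oplus>\<^bsub>hom_module C V\<^esub> hom_product C prd n u' v"
      by (simp add: hom_product_left comp_plus_right[OF _ _ R])
  next
    assume "u \<in> carrier (hom_module C V)" "v \<in> carrier (hom_module C V)" "v' \<in> carrier (hom_module C V)"
    then have h: "u \<in> Hom C \<I> V" "v \<in> Hom C \<I> V" "v' \<in> Hom C \<I> V" by auto
    moreover have "Plus C v v' \<in> Hom C \<I> V"
      using abelian_group_hom[of \<I> V] abelian_monoid.a_closed[of "hom_group C \<I> V" v v'] h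
      by (simp add: abelian_group_def)
    ultimately show "hom_product C prd n u (v \<oplus>\<^bsub>hom_module C V\<^esub> v')
        = hom_product C prd n u v \<oplus>\<^bsub>hom_module C V\<^esub> hom_product C prd n u v'"
      by (simp add: hom_product_right comp_plus_right[OF _ _ L])
  next
    assume "a \<in> carrier (end_ring C)" "u \<in> carrier (hom_module C V)" "v \<in> carrier (hom_module C V)"
    then have h: "a \<in> Hom C \<I> \<I>" "u \<in> Hom C \<I> V" "v \<in> Hom C \<I> V" by auto
    note c = comp_closed[OF h(1,2)] comp_closed[OF h(1,3)]
    show "hom_product C prd n (a \<odot>\<^bsub>hom_module C V\<^esub> u) v = a \<odot>\<^bsub>hom_module C V\<^esub> hom_product C prd n u v"
      by (simp add: hom_product_left h c comp_assoc[OF h(1,2) R])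
    show "hom_product C prd n u (a \<odot>\<^bsub>hom_module C V\<^esub> v) = a \<odot>\<^bsub>hom_module C V\<^esub> hom_product C prd n u v"
      by (simp add: hom_product_right h c comp_assoc[OF h(1,3) L])
  next
    assume "a \<in> carrier (end_ring C)" "u \<in> carrier (hom_module C V)"
    then show "T \<bullet> (a \<odot>\<^bsub>hom_module C V\<^esub> u) = a \<odot>\<^bsub>hom_module C V\<^esub> (T \<bullet> u)"
      using comp_assoc[OF _ _ T_closed] by simp
  next
    assume "u \<in> carrier (hom_module C V)"
    then have u: "u \<in> Hom C \<I> V" by auto
    note [simp] = HomD[OF u]
    show "T \<bullet> u \<in> carrier (hom_module C V)"
      using comp_closed[OF u T_closed] by simp
    have "field_of (hom_product C prd) p vac u
        = (field_of prd p \<bullet> (vac \<star> Idn C V)) \<bullet> (inv_arrow C (Lunit C V) \<bullet> u)"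
      using hom_product_right[OF vac_closed u, of "- p - 1"] by (simp add: field_of_def comp_assoc_arr)
    also have "\<dots> = (if p = 0 then u else Zero C \<I> V)"
      using comp_zero_left[of "inv_arrow C (Lunit C V) \<bullet> u" \<I> "\<I> \<boxtimes> V" V]
      by (auto simp: vacuum_left Hom_def comp_assoc_arr[symmetric])
    finally show "field_of (hom_product C prd) p vac u = (if p = 0 then u else \<zero>\<^bsub>hom_module C V\<^esub>)"
      by simp
    have r: "field_of (hom_product C prd) p u vac
        = (field_of prd p \<bullet> (Idn C V \<star> vac)) \<bullet> (inv_arrow C (Runit C V) \<bullet> u)" for p
      using hom_product_left[OF u vac_closed, of "- p - 1"] by (simp add: field_of_def comp_assoc_arr)
    show "field_of (hom_product C prd) 0 u vac = u"
      unfolding r by (simp add: vacuum_right_value comp_assoc_arr[symmetric])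
    assume "p < 0"
    then show "field_of (hom_product C prd) p u vac = \<zero>\<^bsub>hom_module C V\<^esub>"
      unfolding r using comp_zero_left[of "inv_arrow C (Runit C V) \<bullet> u" \<I> "V \<boxtimes> \<I>" V]
      by (simp add: vacuum_right_regular Hom_def)
  }
qed (use rat T_vac vac_closed in auto)

end

section \<open>Filtered diagrams and compactness\<close>

context cat_functor
begin

lemma fun_simps [simp]:
  "X \<in> Obj D \<Longrightarrow> fobj F X \<in> Obj E"
  "f \<in> Arr D \<Longrightarrow> farr F f \<in> Arr E"
  "f \<in> Arr D \<Longrightarrow> Src E (farr F f) = fobj F (Src D f)"
  "f \<in> Arr D \<Longrightarrow> Tgt E (farr F f) = fobj F (Tgt D f)"
  using fobj_closed farr_closed[of f "Src D f" "Tgt D f"] by (auto simp: Hom_def)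

lemma farr_comp_arr:
  "\<lbrakk>f \<in> Arr D; g \<in> Arr D; Src D g = Tgt D f\<rbrakk> \<Longrightarrow> farr F (g \<bullet>\<^bsub>D\<^esub> f) = farr F g \<bullet>\<^bsub>E\<^esub> farr F f"
  by (rule farr_comp[of f "Src D f" "Tgt D f" g "Tgt D g"]) (auto simp: Hom_def)

end

lemma comp_funct_simps [simp]:
  "fobj (comp_funct G F) X = fobj G (fobj F X)" "farr (comp_funct G F) f = farr G (farr F f)"
  by (simp_all add: comp_funct_def)

text \<open>\<open>small_filtered\<close> forces objects and arrows to have type \<open>'i\<close>.
  The glued category lives on product types, so filteredness is separated here from smallness and
  from the choice of types.\<close>

locale filtered_category = category J for J :: "('i, 'j, 'm) cat_scheme" (structure) +
  assumes nonempty: "Obj J \<noteq> {}"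
    and upper_bound: "\<lbrakk>j \<in> Obj J; k \<in> Obj J\<rbrakk> \<Longrightarrow> \<exists>l\<in>Obj J. Hom J j l \<noteq> {} \<and> Hom J k l \<noteq> {}"
    and coequalized: "\<lbrakk>u \<in> Hom J j k; v \<in> Hom J j k\<rbrakk>
        \<Longrightarrow> \<exists>l\<in>Obj J. \<exists>w\<in>Hom J k l. w \<bullet> u = w \<bullet> v"

lemma small_filtered_iff:
  fixes J :: "('i, 'i) cat"
  shows "small_filtered J \<longleftrightarrow> filtered_category J \<and> small TYPE('i) (Obj J) \<and> small TYPE('i) (Arr J)"
  unfolding small_filtered_def small_filtered_axioms_def filtered_category_def
    filtered_category_axioms_def by blast

lemma is_coconeD:
  assumes "is_cocone J C D L c"
  shows "L \<in> Obj C" "j \<in> Obj J \<Longrightarrow> c j \<in> Hom C (fobj D j) L"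
    "u \<in> Hom J j k \<Longrightarrow> c k \<bullet>\<^bsub>C\<^esub> farr D u = c j"
  using assms by (auto simp: is_cocone_def Hom_def)

lemma is_coconeI:
  assumes "L \<in> Obj C" "\<And>j. j \<in> Obj J \<Longrightarrow> c j \<in> Hom C (fobj D j) L"
    "\<And>u. u \<in> Arr J \<Longrightarrow> c (Tgt J u) \<bullet>\<^bsub>C\<^esub> farr D u = c (Src J u)"
  shows "is_cocone J C D L c"
  using assms by (simp add: is_cocone_def)

lemma is_colimitD:
  assumes "is_colimit J C D L c"
  shows "is_cocone J C D L c"
    and "is_cocone J C D M d \<Longrightarrow> \<exists>h\<in>Hom C L M. \<forall>j\<in>Obj J. h \<bullet>\<^bsub>C\<^esub> c j = d j"
  using assms unfolding is_colimit_def by blast+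

text \<open>Both arrows solve the universal problem for the cocone \<open>f \<bullet> c j\<close>;
  in other words, the legs of a colimit are jointly epic.\<close>

lemma (in category) is_colimit_unique:
  assumes L: "is_colimit J C D L c" and f: "f \<in> Hom C L M" and g: "g \<in> Hom C L M"
    and D: "\<And>u. u \<in> Arr J \<Longrightarrow> farr D u \<in> Hom C (fobj D (Src J u)) (fobj D (Tgt J u))"
    and J: "\<And>u. u \<in> Arr J \<Longrightarrow> Src J u \<in> Obj J \<and> Tgt J u \<in> Obj J"
    and eq: "\<And>j. j \<in> Obj J \<Longrightarrow> f \<bullet> c j = g \<bullet> c j"
  shows "f = g"
proof -
  note c = is_coconeD[OF is_colimitD(1)[OF L]]
  have "is_cocone J C D M (\<lambda>j. f \<bullet> c j)"
  proof (rule is_coconeI)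
    fix u assume u: "u \<in> Arr J"
    then have "c (Tgt J u) \<bullet> farr D u = c (Src J u)"
      by (intro c(3)) (simp add: Hom_def)
    then show "f \<bullet> c (Tgt J u) \<bullet> farr D u = f \<bullet> c (Src J u)"
      using comp_assoc[OF D[OF u] c(2) f] J[OF u] by simp
  qed (use HomD[OF f] comp_closed[OF c(2) f] in auto)
  then have "\<exists>!h. h \<in> Hom C L M \<and> (\<forall>j\<in>Obj J. h \<bullet> c j = f \<bullet> c j)"
    using L unfolding is_colimit_def by blast
  then show ?thesis
    using f g eq by metis
qed

section \<open>Classes of arrows in a filtered colimit of hom sets\<close>

lemma hom_colim_relI:
  assumes "j \<in> Obj J" "f \<in> Hom C X (fobj D j)" "k \<in> Obj J" "g \<in> Hom C X (fobj D k)" "l \<in> Obj J"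
    "u \<in> Hom J j l" "v \<in> Hom J k l" "farr D u \<bullet>\<^bsub>C\<^esub> f = farr D v \<bullet>\<^bsub>C\<^esub> g"
  shows "((j, f), (k, g)) \<in> hom_colim_rel C J D X"
  using assms unfolding hom_colim_rel_def by blast

lemma hom_colim_relE:
  assumes "((j, f), (k, g)) \<in> hom_colim_rel C J D X"
  obtains l u v where "j \<in> Obj J" "f \<in> Hom C X (fobj D j)" "k \<in> Obj J" "g \<in> Hom C X (fobj D k)"
    "l \<in> Obj J" "u \<in> Hom J j l" "v \<in> Hom J k l" "farr D u \<bullet>\<^bsub>C\<^esub> f = farr D v \<bullet>\<^bsub>C\<^esub> g"
  using assms unfolding hom_colim_rel_def by blast

locale filtered_diagram = J: filtered_category J + C: category C + D: cat_functor J C D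
  for J :: "('i, 'j) cat" and C :: "('o, 'a, 'm) cat_scheme" and D :: "('i, 'j, 'o, 'a) funct"
begin

lemma comp_closed_diagram:
  "\<lbrakk>u \<in> Hom J j k; f \<in> Hom C X (fobj D j)\<rbrakk> \<Longrightarrow> farr D u \<bullet>\<^bsub>C\<^esub> f \<in> Hom C X (fobj D k)"
  using C.comp_closed D.farr_closed by blast

lemma farr_comp_app:
  "\<lbrakk>u \<in> Hom J j k; v \<in> Hom J k l; f \<in> Hom C X (fobj D j)\<rbrakk>
    \<Longrightarrow> farr D (v \<bullet>\<^bsub>J\<^esub> u) \<bullet>\<^bsub>C\<^esub> f = farr D v \<bullet>\<^bsub>C\<^esub> (farr D u \<bullet>\<^bsub>C\<^esub> f)"
  using D.farr_comp[of u j k v l] C.comp_assoc[OF _ D.farr_closed D.farr_closed] by metis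

lemma rel_shift:
  assumes u: "u \<in> Hom J j k" and f: "f \<in> Hom C X (fobj D j)"
  shows "((j, f), (k, farr D u \<bullet>\<^bsub>C\<^esub> f)) \<in> hom_colim_rel C J D X"
proof (rule hom_colim_relI)
  show "farr D u \<bullet>\<^bsub>C\<^esub> f = farr D (Idn J k) \<bullet>\<^bsub>C\<^esub> (farr D u \<bullet>\<^bsub>C\<^esub> f)"
    using C.idn_left[OF comp_closed_diagram[OF u f]] D.farr_idn J.HomD[OF u] by simp
qed (use J.HomD[OF u] u f comp_closed_diagram J.idn_closed in auto)

lemma rel_sym:
  "(a, b) \<in> hom_colim_rel C J D X \<Longrightarrow> (b, a) \<in> hom_colim_rel C J D X"
  unfolding hom_colim_rel_def by (auto dest: sym)

lemma rel_trans:
  assumes "(a, b) \<in> hom_colim_rel C J D X" "(b, c) \<in> hom_colim_rel C J D X"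
  shows "(a, c) \<in> hom_colim_rel C J D X"
proof -
  obtain j f k g m h where abc: "a = (j, f)" "b = (k, g)" "c = (m, h)"
    by (cases a, cases b, cases c)
  obtain l u v where 1: "f \<in> Hom C X (fobj D j)" "g \<in> Hom C X (fobj D k)" "l \<in> Obj J"
    "u \<in> Hom J j l" "v \<in> Hom J k l" "farr D u \<bullet>\<^bsub>C\<^esub> f = farr D v \<bullet>\<^bsub>C\<^esub> g"
    using assms(1) unfolding abc by (auto elim: hom_colim_relE)
  obtain l' u' v' where 2: "h \<in> Hom C X (fobj D m)" "l' \<in> Obj J"
    "u' \<in> Hom J k l'" "v' \<in> Hom J m l'" "farr D u' \<bullet>\<^bsub>C\<^esub> g = farr D v' \<bullet>\<^bsub>C\<^esub> h"
    using assms(2) unfolding abc by (auto elim: hom_colim_relE)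
  obtain n s s' where s: "s \<in> Hom J l n" "s' \<in> Hom J l' n"
    using J.upper_bound[OF 1(3) 2(2)] by auto
  \<comment> \<open>The two paths from \<open>k\<close> to the common bound \<open>n\<close> may
    differ; \<open>w\<close> makes them equal.\<close>
  obtain n' w where w: "w \<in> Hom J n n'" "w \<bullet>\<^bsub>J\<^esub> (s \<bullet>\<^bsub>J\<^esub> v) = w \<bullet>\<^bsub>J\<^esub> (s' \<bullet>\<^bsub>J\<^esub> u')"
    using J.coequalized[OF J.comp_closed[OF 1(5) s(1)] J.comp_closed[OF 2(3) s(2)]] by blast
  have c: "s \<bullet>\<^bsub>J\<^esub> u \<in> Hom J j n" "s \<bullet>\<^bsub>J\<^esub> v \<in> Hom J k n" "s' \<bullet>\<^bsub>J\<^esub> u' \<in> Hom J k n" "s' \<bullet>\<^bsub>J\<^esub> v' \<in> Hom J m n"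
    using s 1 2 by (auto intro: J.comp_closed)
  have "farr D (w \<bullet>\<^bsub>J\<^esub> (s \<bullet>\<^bsub>J\<^esub> u)) \<bullet>\<^bsub>C\<^esub> f = farr D (w \<bullet>\<^bsub>J\<^esub> (s \<bullet>\<^bsub>J\<^esub> v)) \<bullet>\<^bsub>C\<^esub> g"
    by (simp add: farr_comp_app[OF c(1) w(1) 1(1)] farr_comp_app[OF c(2) w(1) 1(2)]
        farr_comp_app[OF 1(4) s(1) 1(1)] farr_comp_app[OF 1(5) s(1) 1(2)] 1(6))
  also have "\<dots> = farr D (w \<bullet>\<^bsub>J\<^esub> (s' \<bullet>\<^bsub>J\<^esub> v')) \<bullet>\<^bsub>C\<^esub> h"
    by (simp add: farr_comp_app[OF c(3) w(1) 1(2)] farr_comp_app[OF c(4) w(1) 2(1)]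
        farr_comp_app[OF 2(3) s(2) 1(2)] farr_comp_app[OF 2(4) s(2) 2(1)] 2(5) w(2))
  finally show ?thesis
    unfolding abc using J.HomD(4)[OF c(1)] J.HomD(4)[OF c(4)] J.HomD(5)[OF w(1)] 1(1) 2(1)
      J.comp_closed[OF c(1) w(1)] J.comp_closed[OF c(4) w(1)]
    by (intro hom_colim_relI)
qed

lemma rel_refl:
  assumes "j \<in> Obj J" "f \<in> Hom C X (fobj D j)"
  shows "((j, f), (j, f)) \<in> hom_colim_rel C J D X"
  using assms J.idn_closed by (blast intro: hom_colim_relI)

lemma equiv_rel: "equiv (SIGMA j:Obj J. Hom C X (fobj D j)) (hom_colim_rel C J D X)"
proof (rule equivI)
  show "hom_colim_rel C J D X \<subseteq> (SIGMA j:Obj J. Hom C X (fobj D j)) \<times> (SIGMA j:Obj J. Hom C X (fobj D j))"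
    by (auto simp: hom_colim_rel_def)
  show "refl_on (SIGMA j:Obj J. Hom C X (fobj D j)) (hom_colim_rel C J D X)"
    using rel_refl by (auto simp: refl_on_def)
  show "sym (hom_colim_rel C J D X)" "trans (hom_colim_rel C J D X)"
    using rel_sym rel_trans by (blast intro: symI transI)+
qed

lemma rel_precomp:
  assumes r: "((j, f), (k, g)) \<in> hom_colim_rel C J D X" and e: "e \<in> Hom C W X"
  shows "((j, f \<bullet>\<^bsub>C\<^esub> e), (k, g \<bullet>\<^bsub>C\<^esub> e)) \<in> hom_colim_rel C J D W"
proof -
  obtain l u v where *: "j \<in> Obj J" "f \<in> Hom C X (fobj D j)" "k \<in> Obj J" "g \<in> Hom C X (fobj D k)"
    "l \<in> Obj J" "u \<in> Hom J j l" "v \<in> Hom J k l" "farr D u \<bullet>\<^bsub>C\<^esub> f = farr D v \<bullet>\<^bsub>C\<^esub> g"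
    using r by (rule hom_colim_relE)
  then have "farr D u \<bullet>\<^bsub>C\<^esub> (f \<bullet>\<^bsub>C\<^esub> e) = farr D v \<bullet>\<^bsub>C\<^esub> (g \<bullet>\<^bsub>C\<^esub> e)"
    using C.comp_assoc[OF e *(2) D.farr_closed[OF *(6)]] C.comp_assoc[OF e *(4) D.farr_closed[OF *(7)]]
    by simp
  with * e C.comp_closed show ?thesis
    by (blast intro: hom_colim_relI)
qed

text \<open>The two witnessing arrows of \<open>J\<close> are parallel here, so a coequalizing arrow
  replaces them by a single one.\<close>

lemma rel_same_index:
  assumes "((j, f), (j, g)) \<in> hom_colim_rel C J D X"
  obtains l u where "l \<in> Obj J" "u \<in> Hom J j l" "farr D u \<bullet>\<^bsub>C\<^esub> f = farr D u \<bullet>\<^bsub>C\<^esub> g"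
proof -
  obtain l u v where *: "f \<in> Hom C X (fobj D j)" "g \<in> Hom C X (fobj D j)"
    "l \<in> Obj J" "u \<in> Hom J j l" "v \<in> Hom J j l" "farr D u \<bullet>\<^bsub>C\<^esub> f = farr D v \<bullet>\<^bsub>C\<^esub> g"
    using assms by (rule hom_colim_relE)
  obtain m w where w: "m \<in> Obj J" "w \<in> Hom J l m" "w \<bullet>\<^bsub>J\<^esub> u = w \<bullet>\<^bsub>J\<^esub> v"
    using J.coequalized[OF *(4,5)] by blast
  have "farr D (w \<bullet>\<^bsub>J\<^esub> u) \<bullet>\<^bsub>C\<^esub> f = farr D (w \<bullet>\<^bsub>J\<^esub> v) \<bullet>\<^bsub>C\<^esub> g"
    by (simp add: farr_comp_app[OF *(4) w(2) *(1)] farr_comp_app[OF *(5) w(2) *(2)] *(6))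
  then show ?thesis
    using that[OF w(1) J.comp_closed[OF *(4) w(2)]] w(3) by simp
qed

text \<open>This makes the canonical map from the colimit of hom sets to the arrows into
  \<open>L\<close> well defined.\<close>

lemma rel_cocone:
  assumes c: "is_cocone J C D L c" and r: "((j, f), (k, g)) \<in> hom_colim_rel C J D X"
  shows "c j \<bullet>\<^bsub>C\<^esub> f = c k \<bullet>\<^bsub>C\<^esub> g"
proof -
  obtain l u v where *: "f \<in> Hom C X (fobj D j)" "g \<in> Hom C X (fobj D k)"
    "l \<in> Obj J" "u \<in> Hom J j l" "v \<in> Hom J k l" "farr D u \<bullet>\<^bsub>C\<^esub> f = farr D v \<bullet>\<^bsub>C\<^esub> g"
    using r by (rule hom_colim_relE)
  have cl: "c l \<in> Hom C (fobj D l) L" "c l \<bullet>\<^bsub>C\<^esub> farr D u = c j" "c l \<bullet>\<^bsub>C\<^esub> farr D v = c k"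
    using c *(3) J.HomD[OF *(4)] J.HomD[OF *(5)] by (auto simp: is_cocone_def)
  show ?thesis
    using C.comp_assoc[OF *(1) D.farr_closed[OF *(4)] cl(1)]
      C.comp_assoc[OF *(2) D.farr_closed[OF *(5)] cl(1)] cl *(6) by simp
qed

end

text \<open>Bijectivity on the quotient is split into surjectivity and injectivity on
  representatives. Both are tested at an isomorphic object \<open>Y\<close>, because the unit of
  \<open>C\<close> is only isomorphic to the image of the unit of \<open>C0\<close>.\<close>

lemma compact_objectI_iso:
  fixes C :: "('o, 'a, 'm) cat_scheme"
  assumes cat: "category C" and i: "i \<in> Hom C X Y" "iso_arrow C i"
    and surj: "\<And>(J :: ('i, 'i) cat) D L c f. \<lbrakk>small_filtered J; cat_functor J C D; is_colimit J C D L c;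
        f \<in> Hom C Y L\<rbrakk> \<Longrightarrow> \<exists>j\<in>Obj J. \<exists>g\<in>Hom C Y (fobj D j). c j \<bullet>\<^bsub>C\<^esub> g = f"
    and inj: "\<And>(J :: ('i, 'i) cat) D L c j f k g. \<lbrakk>small_filtered J; cat_functor J C D; is_colimit J C D L c;
        j \<in> Obj J; f \<in> Hom C Y (fobj D j); k \<in> Obj J; g \<in> Hom C Y (fobj D k);
        c j \<bullet>\<^bsub>C\<^esub> f = c k \<bullet>\<^bsub>C\<^esub> g\<rbrakk> \<Longrightarrow> ((j, f), (k, g)) \<in> hom_colim_rel C J D Y"
  shows "compact_object TYPE('i) C X"
  unfolding compact_object_def
proof (intro conjI allI impI)
  interpret C: category C by (fact cat)
  define i' where "i' = inv_arrow C i"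
  note i' = C.inv_arrow[OF i(2,1), folded i'_def]
  show "X \<in> Obj C"
    using C.HomD[OF i(1)] by simp
  fix J :: "('i, 'i) cat" and D L c
  assume J: "small_filtered J" and D: "cat_functor J C D" and L: "is_colimit J C D L c"
  have c: "is_cocone J C D L c" and cj: "\<And>j. j \<in> Obj J \<Longrightarrow> c j \<in> Hom C (fobj D j) L"
    using is_colimitD(1)[OF L] is_coconeD(2)[OF is_colimitD(1)[OF L]] by simp_all
  interpret filtered_diagram J C D
    using J D cat unfolding filtered_diagram_def small_filtered_iff by blast
  let ?R = "hom_colim_rel C J D X"
  let ?h = "\<lambda>\<xi>. the_elem ((\<lambda>(j, f). c j \<bullet>\<^bsub>C\<^esub> f) ` \<xi>)"
  \<comment> \<open>The image of a class is a singleton by \<open>rel_cocone\<close>, so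
    \<open>the_elem\<close> evaluates to the value on any representative.\<close>
  have h: "?h (?R `` {(j, f)}) = c j \<bullet>\<^bsub>C\<^esub> f" if "j \<in> Obj J" "f \<in> Hom C X (fobj D j)" for j f
  proof -
    have "(\<lambda>(j, f). c j \<bullet>\<^bsub>C\<^esub> f) ` (?R `` {(j, f)}) = {c j \<bullet>\<^bsub>C\<^esub> f}"
    proof (intro equalityI subsetI)
      fix x assume "x \<in> (\<lambda>(j, f). c j \<bullet>\<^bsub>C\<^esub> f) ` (?R `` {(j, f)})"
      then obtain k g where "((j, f), (k, g)) \<in> ?R" "x = c k \<bullet>\<^bsub>C\<^esub> g"
        by (elim imageE ImageE) (simp split: prod.splits)
      then show "x \<in> {c j \<bullet>\<^bsub>C\<^esub> f}"
        using rel_cocone[OF c] by simp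
    next
      fix x assume "x \<in> {c j \<bullet>\<^bsub>C\<^esub> f}"
      then show "x \<in> (\<lambda>(j, f). c j \<bullet>\<^bsub>C\<^esub> f) ` (?R `` {(j, f)})"
        using rel_refl[OF that] by (intro image_eqI[of _ _ "(j, f)"]) auto
    qed
    then show ?thesis by simp
  qed
  have inj': "((j, f), (k, g)) \<in> ?R" if "j \<in> Obj J" "f \<in> Hom C X (fobj D j)" "k \<in> Obj J"
    "g \<in> Hom C X (fobj D k)" "c j \<bullet>\<^bsub>C\<^esub> f = c k \<bullet>\<^bsub>C\<^esub> g" for j f k g
  proof -
    have "c j \<bullet>\<^bsub>C\<^esub> (f \<bullet>\<^bsub>C\<^esub> i') = c k \<bullet>\<^bsub>C\<^esub> (g \<bullet>\<^bsub>C\<^esub> i')"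
      using C.comp_assoc[OF i'(1) that(2) cj[OF that(1)]] C.comp_assoc[OF i'(1) that(4) cj[OF that(3)]]
        that(5) by simp
    then have "((j, f \<bullet>\<^bsub>C\<^esub> i'), (k, g \<bullet>\<^bsub>C\<^esub> i')) \<in> hom_colim_rel C J D Y"
      using that by (intro inj[OF J D L]) (auto intro: C.comp_closed i'(1))
    from rel_precomp[OF this i(1)] show ?thesis
      using C.comp_assoc[OF i(1) i'(1) that(2)] C.comp_assoc[OF i(1) i'(1) that(4)] i'(2)
        C.idn_right[OF that(2)] C.idn_right[OF that(4)] by simp
  qed
  show "bij_betw ?h (hom_colim C J D X) (Hom C X L)"
    unfolding bij_betw_def
  proof
    show "inj_on ?h (hom_colim C J D X)"
    proof (rule inj_onI)
      fix \<xi> \<eta> assume "\<xi> \<in> hom_colim C J D X" "\<eta> \<in> hom_colim C J D X" and eq: "?h \<xi> = ?h \<eta>"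
      then obtain j f k g where *: "\<xi> = ?R `` {(j, f)}" "j \<in> Obj J" "f \<in> Hom C X (fobj D j)"
        "\<eta> = ?R `` {(k, g)}" "k \<in> Obj J" "g \<in> Hom C X (fobj D k)"
        by (auto simp: hom_colim_def elim!: quotientE)
      then have "((j, f), (k, g)) \<in> ?R"
        using eq h[OF *(2,3)] h[OF *(5,6)] by (intro inj') simp_all
      then show "\<xi> = \<eta>"
        using equiv_class_eq[OF equiv_rel] * by blast
    qed
    show "?h ` hom_colim C J D X = Hom C X L"
    proof safe
      fix \<xi> assume "\<xi> \<in> hom_colim C J D X"
      then obtain j f where *: "\<xi> = ?R `` {(j, f)}" "j \<in> Obj J" "f \<in> Hom C X (fobj D j)"
        by (auto simp: hom_colim_def elim!: quotientE)
      then show "?h \<xi> \<in> Hom C X L"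
        using h[OF *(2,3)] C.comp_closed[OF *(3) cj[OF *(2)]] by simp
    next
      fix f assume f: "f \<in> Hom C X L"
      obtain j g where g: "j \<in> Obj J" "g \<in> Hom C Y (fobj D j)" "c j \<bullet>\<^bsub>C\<^esub> g = f \<bullet>\<^bsub>C\<^esub> i'"
        using surj[OF J D L C.comp_closed[OF i'(1) f]] by blast
      have gi: "g \<bullet>\<^bsub>C\<^esub> i \<in> Hom C X (fobj D j)"
        using C.comp_closed[OF i(1) g(2)] .
      have "c j \<bullet>\<^bsub>C\<^esub> (g \<bullet>\<^bsub>C\<^esub> i) = f"
        using C.comp_assoc[OF i(1) g(2) cj[OF g(1)]] g(3) C.comp_assoc[OF i(1) i'(1) f] i'(2)
          C.idn_right[OF f] by simp
      then have "f = ?h (?R `` {(j, g \<bullet>\<^bsub>C\<^esub> i)})"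
        using h[OF g(1) gi] by simp
      moreover have "?R `` {(j, g \<bullet>\<^bsub>C\<^esub> i)} \<in> hom_colim C J D X"
        unfolding hom_colim_def using g(1) gi by (intro quotientI) auto
      ultimately show "f \<in> ?h ` hom_colim C J D X"
        by blast
    qed
  qed
qed

section \<open>Small sets\<close>

lemma small_inj_on:
  assumes "small TYPE('i) (A :: 'x set)"
  obtains \<phi> :: "'x \<Rightarrow> 'i" where "inj_on \<phi> A"
proof -
  have "|A| \<le>o |UNIV :: 'i set|"
    using assms ordLess_imp_ordLeq unfolding small_def by blast
  then show ?thesis
    using that card_of_ordLeq[of A "UNIV :: 'i set"] by auto
qed

lemma small_image:
  assumes "small TYPE('i) A"
  shows "small TYPE('i) (f ` A)"
  using assms card_of_image ordLeq_ordLess_trans unfolding small_def by blast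

lemma small_subset:
  assumes "small TYPE('i) B" "A \<subseteq> B"
  shows "small TYPE('i) A"
  using assms card_of_mono1 ordLeq_ordLess_trans unfolding small_def by blast

text \<open>Regularity of the cardinal of \<open>'i\<close> enters here, as stability under small
  sums of small sets. It bounds the glued category, whose objects and arrows form or embed into such
  sums.\<close>

lemma small_Sigma:
  assumes U: "universe TYPE('i)" and A: "small TYPE('i) A" and B: "\<And>a. a \<in> A \<Longrightarrow> small TYPE('i) (B a)"
  shows "small TYPE('i) (SIGMA a:A. B a)"
proof -
  have "stable |UNIV :: 'i set|"
    using U regularCard_stable[OF card_of_Card_order, of "UNIV :: 'i set"] by (simp add: universe_def Field_card_of)
  then show ?thesis
    using A B unfolding small_def by (intro stable_elim) auto
qed

lemma small_singleton:
  assumes U: "universe TYPE('i)"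
  shows "small TYPE('i) {x}"
  using U finite_ordLess_infinite[OF card_of_Well_order card_of_Well_order, of "{x}" "UNIV :: 'i set"]
  by (simp add: universe_def small_def Field_card_of)

section \<open>Gluing presentations\<close>

text \<open>Besides the colimit property, the clauses say that arrows from objects
  \<open>F X\<close> into \<open>L\<close> are computed by the diagram, as in
  \<open>Ind(C\<^sub>0)\<close>: the map from \<open>colim\<^sub>k Hom(X, G k)\<close> to
  \<open>Hom(F X, L)\<close> is surjective and, compared at a common stage, injective. For fully
  faithful \<open>F\<close> this is compactness of \<open>F X\<close> with respect to one diagram of
  objects of \<open>C0\<close>; compactness for all diagrams is deduced from it.\<close>

definition presentation :: "('p, 'b, 'n) cat_scheme \<Rightarrow> ('o, 'a, 'm) cat_scheme \<Rightarrow> ('p, 'b, 'o, 'a) funct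
    \<Rightarrow> ('i, 'j) cat \<Rightarrow> ('i, 'j, 'p, 'b) funct \<Rightarrow> 'o \<Rightarrow> ('i \<Rightarrow> 'a) \<Rightarrow> bool" where
  "presentation C0 C F K G L \<gamma> \<longleftrightarrow> is_colimit K C (comp_funct F G) L \<gamma> \<and>
     (\<forall>X\<in>Obj C0. \<forall>f\<in>Hom C (fobj F X) L.
        \<exists>k\<in>Obj K. \<exists>g\<in>Hom C0 X (fobj G k). \<gamma> k \<bullet>\<^bsub>C\<^esub> farr F g = f) \<and>
     (\<forall>X\<in>Obj C0. \<forall>k\<in>Obj K. \<forall>g\<in>Hom C0 X (fobj G k). \<forall>g'\<in>Hom C0 X (fobj G k).
        \<gamma> k \<bullet>\<^bsub>C\<^esub> farr F g = \<gamma> k \<bullet>\<^bsub>C\<^esub> farr F g' \<longrightarrow>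
        (\<exists>l\<in>Obj K. \<exists>t\<in>Hom K k l. farr G t \<bullet>\<^bsub>C0\<^esub> g = farr G t \<bullet>\<^bsub>C0\<^esub> g'))"

lemma presentationD:
  assumes "presentation C0 C F K G L \<gamma>"
  shows "is_colimit K C (comp_funct F G) L \<gamma>"
    and "\<lbrakk>X \<in> Obj C0; f \<in> Hom C (fobj F X) L\<rbrakk>
      \<Longrightarrow> \<exists>k\<in>Obj K. \<exists>g\<in>Hom C0 X (fobj G k). \<gamma> k \<bullet>\<^bsub>C\<^esub> farr F g = f"
    and "\<lbrakk>X \<in> Obj C0; k \<in> Obj K; g \<in> Hom C0 X (fobj G k); g' \<in> Hom C0 X (fobj G k);
        \<gamma> k \<bullet>\<^bsub>C\<^esub> farr F g = \<gamma> k \<bullet>\<^bsub>C\<^esub> farr F g'\<rbrakk>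
      \<Longrightarrow> \<exists>l\<in>Obj K. \<exists>t\<in>Hom K k l. farr G t \<bullet>\<^bsub>C0\<^esub> g = farr G t \<bullet>\<^bsub>C0\<^esub> g'"
  using assms unfolding presentation_def by simp_all

section \<open>Transport of index categories along injections\<close>

definition relabel :: "('x \<Rightarrow> 'i) \<Rightarrow> ('y \<Rightarrow> 'j) \<Rightarrow> ('x, 'y) cat \<Rightarrow> ('i, 'j) cat" where
  "relabel \<phi> \<psi> I = (let \<phi>' = inv_into (Obj I) \<phi>; \<psi>' = inv_into (Arr I) \<psi> in
     \<lparr>Obj = \<phi> ` Obj I, Arr = \<psi> ` Arr I, Src = \<phi> \<circ> Src I \<circ> \<psi>', Tgt = \<phi> \<circ> Tgt I \<circ> \<psi>',
      Idn = \<psi> \<circ> Idn I \<circ> \<phi>', Comp = (\<lambda>g f. \<psi> (\<psi>' g \<bullet>\<^bsub>I\<^esub> \<psi>' f))\<rparr>)"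

definition relabel_funct :: "('x \<Rightarrow> 'i) \<Rightarrow> ('y \<Rightarrow> 'j) \<Rightarrow> ('x, 'y) cat \<Rightarrow> ('x, 'y, 'o, 'a) funct
    \<Rightarrow> ('i, 'j, 'o, 'a) funct" where
  "relabel_funct \<phi> \<psi> I D =
     \<lparr>fobj = fobj D \<circ> inv_into (Obj I) \<phi>, farr = farr D \<circ> inv_into (Arr I) \<psi>\<rparr>"

lemma comp_funct_relabel:
  "comp_funct F (relabel_funct \<phi> \<psi> I D) = relabel_funct \<phi> \<psi> I (comp_funct F D)"
  by (simp add: comp_funct_def relabel_funct_def comp_assoc)

text \<open>Ind-objects have index categories on \<open>'i\<close>. A small category on other types
  is moved there by injections of its objects and of its arrows, and its diagrams are carried
  along.\<close>

locale relabelling = I: category I for I :: "('x, 'y) cat" +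
  fixes \<phi> :: "'x \<Rightarrow> 'i" and \<psi> :: "'y \<Rightarrow> 'j"
  assumes inj_\<phi>: "inj_on \<phi> (Obj I)" and inj_\<psi>: "inj_on \<psi> (Arr I)"
begin

abbreviation "I' \<equiv> relabel \<phi> \<psi> I"

lemma relabel_simps [simp]:
  "Obj I' = \<phi> ` Obj I" "Arr I' = \<psi> ` Arr I"
  "f \<in> Arr I \<Longrightarrow> Src I' (\<psi> f) = \<phi> (Src I f)" "f \<in> Arr I \<Longrightarrow> Tgt I' (\<psi> f) = \<phi> (Tgt I f)"
  "x \<in> Obj I \<Longrightarrow> Idn I' (\<phi> x) = \<psi> (Idn I x)"
  "f \<in> Arr I \<Longrightarrow> g \<in> Arr I \<Longrightarrow> \<psi> g \<bullet>\<^bsub>I'\<^esub> \<psi> f = \<psi> (g \<bullet>\<^bsub>I\<^esub> f)"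
  "x \<in> Obj I \<Longrightarrow> fobj (relabel_funct \<phi> \<psi> I D) (\<phi> x) = fobj D x"
  "f \<in> Arr I \<Longrightarrow> farr (relabel_funct \<phi> \<psi> I D) (\<psi> f) = farr D f"
  using inj_\<phi> inj_\<psi> by (simp_all add: relabel_def relabel_funct_def Let_def)

lemma \<phi>_eq_iff [simp]: "x \<in> Obj I \<Longrightarrow> y \<in> Obj I \<Longrightarrow> \<phi> x = \<phi> y \<longleftrightarrow> x = y"
  using inj_\<phi> by (auto dest: inj_onD)

lemma Hom_relabel:
  assumes "x \<in> Obj I" "y \<in> Obj I"
  shows "Hom I' (\<phi> x) (\<phi> y) = \<psi> ` Hom I x y"
  using assms I.src_closed I.tgt_closed by (auto simp: Hom_def)

lemma Hom_relabelE:
  assumes "h \<in> Hom I' x' y'"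
  obtains x y f where "x' = \<phi> x" "y' = \<phi> y" "h = \<psi> f" "x \<in> Obj I" "y \<in> Obj I" "f \<in> Hom I x y"
  using assms I.src_closed I.tgt_closed by (auto simp: Hom_def)

lemma category_relabel: "category I'"
proof
  fix f assume "f \<in> Arr I'"
  then show "Src I' f \<in> Obj I'" "Tgt I' f \<in> Obj I'"
    using I.src_closed I.tgt_closed by auto
next
  fix x assume "x \<in> Obj I'"
  then show "Idn I' x \<in> Hom I' x x"
    using I.idn_closed by (auto simp: Hom_relabel)
next
  fix f g x y z assume f: "f \<in> Hom I' x y" and g: "g \<in> Hom I' y z"
  obtain x1 y1 f1 where 1: "x = \<phi> x1" "y = \<phi> y1" "f = \<psi> f1" "x1 \<in> Obj I" "y1 \<in> Obj I" "f1 \<in> Hom I x1 y1"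
    using f by (rule Hom_relabelE)
  obtain z1 g1 where 2: "z = \<phi> z1" "g = \<psi> g1" "z1 \<in> Obj I" "g1 \<in> Hom I y1 z1"
    using g 1(2,5) by (auto elim!: Hom_relabelE)
  show "g \<bullet>\<^bsub>I'\<^esub> f \<in> Hom I' x z"
    using I.comp_closed[OF 1(6) 2(4)] I.HomD(1)[OF 1(6)] I.HomD(1)[OF 2(4)]
    by (simp add: 1 2 Hom_relabel)
  fix h w assume h: "h \<in> Hom I' z w"
  obtain w1 h1 where 3: "w = \<phi> w1" "h = \<psi> h1" "w1 \<in> Obj I" "h1 \<in> Hom I z1 w1"
    using h 2(1,3) by (auto elim!: Hom_relabelE)
  show "(h \<bullet>\<^bsub>I'\<^esub> g) \<bullet>\<^bsub>I'\<^esub> f = h \<bullet>\<^bsub>I'\<^esub> (g \<bullet>\<^bsub>I'\<^esub> f)"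
    using I.comp_assoc[OF 1(6) 2(4) 3(4)] I.HomD(1-3)[OF 1(6)] I.HomD(1-3)[OF 2(4)] I.HomD(1-3)[OF 3(4)]
    by (simp add: 1(3) 2(2) 3(2))
next
  fix f x y assume f: "f \<in> Hom I' x y"
  obtain x1 y1 f1 where 1: "x = \<phi> x1" "y = \<phi> y1" "f = \<psi> f1" "x1 \<in> Obj I" "y1 \<in> Obj I" "f1 \<in> Hom I x1 y1"
    using f by (rule Hom_relabelE)
  show "Idn I' y \<bullet>\<^bsub>I'\<^esub> f = f" "f \<bullet>\<^bsub>I'\<^esub> Idn I' x = f"
    using I.HomD[OF 1(6)] by (simp_all add: 1(1-5))
qed

lemma cat_functor_relabel:
  assumes "cat_functor I E D"
  shows "cat_functor I' E (relabel_funct \<phi> \<psi> I D)"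
proof -
  interpret D: cat_functor I E D by (fact assms)
  show ?thesis
  proof (rule cat_functor.intro[OF category_relabel D.E.category_axioms], unfold_locales)
    fix x assume "x \<in> Obj I'"
    then show "fobj (relabel_funct \<phi> \<psi> I D) x \<in> Obj E"
      "farr (relabel_funct \<phi> \<psi> I D) (Idn I' x) = Idn E (fobj (relabel_funct \<phi> \<psi> I D) x)"
      using D.farr_idn by auto
  next
    fix f g x y z assume f: "f \<in> Hom I' x y"
    obtain x1 y1 f1 where 1: "x = \<phi> x1" "y = \<phi> y1" "f = \<psi> f1" "x1 \<in> Obj I" "y1 \<in> Obj I" "f1 \<in> Hom I x1 y1"
      using f by (rule Hom_relabelE)
    show "farr (relabel_funct \<phi> \<psi> I D) f
      \<in> Hom E (fobj (relabel_funct \<phi> \<psi> I D) x) (fobj (relabel_funct \<phi> \<psi> I D) y)"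
      using D.farr_closed[OF 1(6)] I.HomD(1)[OF 1(6)] by (simp add: 1(1-5))
    assume g: "g \<in> Hom I' y z"
    obtain z1 g1 where 2: "z = \<phi> z1" "g = \<psi> g1" "z1 \<in> Obj I" "g1 \<in> Hom I y1 z1"
      using g 1(2,5) by (auto elim!: Hom_relabelE)
    show "farr (relabel_funct \<phi> \<psi> I D) (g \<bullet>\<^bsub>I'\<^esub> f)
      = farr (relabel_funct \<phi> \<psi> I D) g \<bullet>\<^bsub>E\<^esub> farr (relabel_funct \<phi> \<psi> I D) f"
      using D.farr_comp[OF 1(6) 2(4)] I.HomD(1-3)[OF 1(6)] I.HomD(1-3)[OF 2(4)] by (simp add: 1(3) 2(2))
  qed
qed

lemma filtered_relabel:
  assumes "filtered_category I"
  shows "filtered_category I'"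
proof -
  interpret I: filtered_category I by (fact assms)
  show ?thesis
  proof (rule filtered_category.intro[OF category_relabel], unfold_locales)
    show "Obj I' \<noteq> {}"
      using I.nonempty by simp
  next
    fix j k assume "j \<in> Obj I'" "k \<in> Obj I'"
    then obtain x y where xy: "j = \<phi> x" "k = \<phi> y" "x \<in> Obj I" "y \<in> Obj I"
      by auto
    obtain l where "l \<in> Obj I" "Hom I x l \<noteq> {}" "Hom I y l \<noteq> {}"
      using I.upper_bound[OF xy(3,4)] by auto
    then show "\<exists>l\<in>Obj I'. Hom I' j l \<noteq> {} \<and> Hom I' k l \<noteq> {}"
      using xy by (auto simp: Hom_relabel)
  next
    fix u v j k assume u: "u \<in> Hom I' j k" and v: "v \<in> Hom I' j k"
    obtain x y f where 1: "j = \<phi> x" "k = \<phi> y" "u = \<psi> f" "x \<in> Obj I" "y \<in> Obj I" "f \<in> Hom I x y"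
      using u by (rule Hom_relabelE)
    obtain g where g: "v = \<psi> g" "g \<in> Hom I x y"
      using v 1(1,2,4,5) by (auto elim!: Hom_relabelE)
    obtain l w where w: "l \<in> Obj I" "w \<in> Hom I y l" "w \<bullet>\<^bsub>I\<^esub> f = w \<bullet>\<^bsub>I\<^esub> g"
      using I.coequalized[OF 1(6) g(2)] by blast
    have "\<psi> w \<in> Hom I' k (\<phi> l)" "\<psi> w \<bullet>\<^bsub>I'\<^esub> u = \<psi> w \<bullet>\<^bsub>I'\<^esub> v"
      using w I.HomD(1)[OF 1(6)] I.HomD(1)[OF g(2)] I.HomD(1)[OF w(2)] by (simp_all add: 1 g(1) Hom_relabel)
    then show "\<exists>l\<in>Obj I'. \<exists>w\<in>Hom I' k l. w \<bullet>\<^bsub>I'\<^esub> u = w \<bullet>\<^bsub>I'\<^esub> v"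
      using w(1) by auto
  qed
qed

lemma is_cocone_relabel:
  "is_cocone I' C (relabel_funct \<phi> \<psi> I D) M d \<longleftrightarrow> is_cocone I C D M (\<lambda>x. d (\<phi> x))"
  by (simp add: is_cocone_def ball_simps(9))

lemma is_colimit_relabel:
  assumes L: "is_colimit I' C (relabel_funct \<phi> \<psi> I D) P p"
  shows "is_colimit I C D P (\<lambda>x. p (\<phi> x))"
  unfolding is_colimit_def
proof (intro conjI allI impI)
  show "is_cocone I C D P (\<lambda>x. p (\<phi> x))"
    using is_colimitD(1)[OF L] by (simp add: is_cocone_relabel)
  fix M d assume d: "is_cocone I C D M d"
  \<comment> \<open>\<open>inv_into\<close> is meaningful on the image of the objects only, and this
    is all that a cocone over \<open>I'\<close> looks at.\<close>
  define e where "e = d \<circ> inv_into (Obj I) \<phi>"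
  have e: "e (\<phi> x) = d x" if "x \<in> Obj I" for x
    using that inj_\<phi> by (simp add: e_def)
  have "is_cocone I C D M (\<lambda>x. e (\<phi> x))"
    using d e I.src_closed I.tgt_closed by (simp add: is_cocone_def)
  moreover have "\<forall>M d. is_cocone I C D M (\<lambda>x. d (\<phi> x)) \<longrightarrow>
      (\<exists>!h. h \<in> Hom C P M \<and> (\<forall>y\<in>Obj I'. h \<bullet>\<^bsub>C\<^esub> p y = d y))"
    using L unfolding is_colimit_def is_cocone_relabel by (rule conjunct2)
  ultimately have "\<exists>!h. h \<in> Hom C P M \<and> (\<forall>y\<in>Obj I'. h \<bullet>\<^bsub>C\<^esub> p y = e y)"
    by blast
  moreover have "(\<forall>y\<in>Obj I'. h \<bullet>\<^bsub>C\<^esub> p y = e y) \<longleftrightarrow> (\<forall>x\<in>Obj I. h \<bullet>\<^bsub>C\<^esub> p (\<phi> x) = d x)" for h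
    by (simp add: e)
  ultimately show "\<exists>!h. h \<in> Hom C P M \<and> (\<forall>x\<in>Obj I. h \<bullet>\<^bsub>C\<^esub> p (\<phi> x) = d x)"
    by simp
qed

lemma presentation_relabel:
  assumes p: "presentation C0 C F I' (relabel_funct \<phi> \<psi> I H) P p"
  shows "presentation C0 C F I H P (\<lambda>x. p (\<phi> x))"
  unfolding presentation_def
proof (intro conjI ballI impI)
  show "is_colimit I C (comp_funct F H) P (\<lambda>x. p (\<phi> x))"
    by (rule is_colimit_relabel) (use p in \<open>simp add: presentation_def comp_funct_relabel\<close>)
next
  fix X f assume "X \<in> Obj C0" "f \<in> Hom C (fobj F X) P"
  then obtain k g where "k \<in> Obj I'" "g \<in> Hom C0 X (fobj (relabel_funct \<phi> \<psi> I H) k)"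
      "p k \<bullet>\<^bsub>C\<^esub> farr F g = f"
    using p unfolding presentation_def by blast
  moreover from this obtain x where "x \<in> Obj I" "k = \<phi> x"
    by auto
  ultimately show "\<exists>k\<in>Obj I. \<exists>g\<in>Hom C0 X (fobj H k). p (\<phi> k) \<bullet>\<^bsub>C\<^esub> farr F g = f"
    by (intro bexI[of _ x] bexI[of _ g]) simp_all
next
  fix X k g g' assume *: "X \<in> Obj C0" "k \<in> Obj I" "g \<in> Hom C0 X (fobj H k)" "g' \<in> Hom C0 X (fobj H k)"
    and eq: "p (\<phi> k) \<bullet>\<^bsub>C\<^esub> farr F g = p (\<phi> k) \<bullet>\<^bsub>C\<^esub> farr F g'"
  have k: "\<phi> k \<in> Obj I'" and g: "g \<in> Hom C0 X (fobj (relabel_funct \<phi> \<psi> I H) (\<phi> k))"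
    "g' \<in> Hom C0 X (fobj (relabel_funct \<phi> \<psi> I H) (\<phi> k))"
    using * by auto
  obtain l t where lt: "t \<in> Hom I' (\<phi> k) l"
    "farr (relabel_funct \<phi> \<psi> I H) t \<bullet>\<^bsub>C0\<^esub> g = farr (relabel_funct \<phi> \<psi> I H) t \<bullet>\<^bsub>C0\<^esub> g'"
    using p *(1) k g eq unfolding presentation_def by blast
  obtain l1 t1 where 1: "t = \<psi> t1" "t1 \<in> Hom I k l1" "l1 \<in> Obj I"
    using lt(1) *(2) by (auto elim!: Hom_relabelE)
  then show "\<exists>l\<in>Obj I. \<exists>t\<in>Hom I k l. farr H t \<bullet>\<^bsub>C0\<^esub> g = farr H t \<bullet>\<^bsub>C0\<^esub> g'"
    using lt(2) I.HomD(1)[OF 1(2)] by (auto intro!: bexI[of _ l1] bexI[of _ t1])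
qed

end

text \<open>The properties of \<open>F\<close> from which compactness of the objects
  \<open>F X\<close> is derived, detached from the concrete construction of \<open>ind_cat\<close>.
  \<open>presentable\<close> supplies presentations of the objects \<open>D j\<close>;
  \<open>realizable\<close> supplies the object \<open>P\<close> for the glued diagram.\<close>

locale ind_generated = C0: category C0 + C: category C + F: cat_functor C0 C F
  for C0 :: "('p, 'b, 'n) cat_scheme" and C :: "('o, 'a, 'm) cat_scheme"
    and F :: "('p, 'b, 'o, 'a) funct" +
  fixes universe_type :: "'i itself"
  assumes fully_faithful: "\<lbrakk>X \<in> Obj C0; Y \<in> Obj C0\<rbrakk>
        \<Longrightarrow> bij_betw (farr F) (Hom C0 X Y) (Hom C (fobj F X) (fobj F Y))"
    and universe: "universe TYPE('i)"
    and locally_small: "\<lbrakk>X \<in> Obj C0; Y \<in> Obj C0\<rbrakk> \<Longrightarrow> small TYPE('i) (Hom C0 X Y)"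
    and presentable: "L \<in> Obj C \<Longrightarrow> \<exists>(K :: ('i, 'i) cat) G \<gamma>.
        small_filtered K \<and> cat_functor K C0 G \<and> presentation C0 C F K G L \<gamma>"
    and realizable: "\<And>(K :: ('i, 'i) cat) G. \<lbrakk>small_filtered K; cat_functor K C0 G\<rbrakk>
        \<Longrightarrow> \<exists>L \<gamma>. presentation C0 C F K G L \<gamma>"
begin

lemma faithful:
  assumes "g \<in> Hom C0 X Y" "g' \<in> Hom C0 X Y" "farr F g = farr F g'"
  shows "g = g'"
  using fully_faithful[of X Y] C0.HomD[OF assms(1)] assms by (auto simp: bij_betw_def dest: inj_onD)

lemma realizable_any:
  fixes I :: "('x, 'y) cat"
  assumes I: "filtered_category I" and small: "small TYPE('i) (Obj I)" "small TYPE('i) (Arr I)"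
    and H: "cat_functor I C0 H"
  obtains P p where "presentation C0 C F I H P p"
proof -
  obtain \<phi> :: "'x \<Rightarrow> 'i" where \<phi>: "inj_on \<phi> (Obj I)"
    using small_inj_on[OF small(1)] by blast
  obtain \<psi> :: "'y \<Rightarrow> 'i" where \<psi>: "inj_on \<psi> (Arr I)"
    using small_inj_on[OF small(2)] by blast
  interpret filtered_category I by (fact I)
  interpret relabelling I \<phi> \<psi>
    using \<phi> \<psi> by unfold_locales
  have "small_filtered I'"
    using filtered_relabel[OF I] small_image[OF small(1), of \<phi>] small_image[OF small(2), of \<psi>]
    by (simp add: small_filtered_iff)
  then obtain P p where "presentation C0 C F I' (relabel_funct \<phi> \<psi> I H) P p"
    using realizable cat_functor_relabel[OF H] by blast
  from that[OF presentation_relabel[OF this]] show ?thesis .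
qed

end

text \<open>\<open>K\<close>, \<open>G\<close> and \<open>\<gamma>\<close> choose a presentation of
  each \<open>D j\<close> separately; nothing relates the choices along arrows of
  \<open>J\<close>.\<close>

locale gluing = ind_generated C0 C F universe_type + filtered_diagram J C D
  for C0 :: "('p, 'b, 'n) cat_scheme" and C :: "('o, 'a, 'm) cat_scheme"
    and F :: "('p, 'b, 'o, 'a) funct" and universe_type :: "'i itself"
    and J :: "('i, 'i) cat" and D :: "('i, 'i, 'o, 'a) funct" +
  fixes K :: "'i \<Rightarrow> ('i, 'i) cat" and G :: "'i \<Rightarrow> ('i, 'i, 'p, 'b) funct" and \<gamma> :: "'i \<Rightarrow> 'i \<Rightarrow> 'a"
  assumes small_index: "small TYPE('i) (Obj J)"
    and K: "j \<in> Obj J \<Longrightarrow> small_filtered (K j)"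
    and G: "j \<in> Obj J \<Longrightarrow> cat_functor (K j) C0 (G j)"
    and \<gamma>: "j \<in> Obj J \<Longrightarrow> presentation C0 C F (K j) (G j) (fobj D j) (\<gamma> j)"
begin

section \<open>The glued category and its filteredness\<close>

definition stages :: "('i \<times> 'i) set" where
  "stages = (SIGMA j:Obj J. Obj (K j))"

definition ob :: "'i \<times> 'i \<Rightarrow> 'p" where
  "ob a = fobj (G (fst a)) (snd a)"

definition leg :: "'i \<times> 'i \<Rightarrow> 'a" where
  "leg a = \<gamma> (fst a) (snd a)"

text \<open>The condition on arrows says that the legs of \<open>a\<close> and \<open>b\<close> agree along \<open>g\<close> in
  \<open>colim\<^sub>j Hom(-, D j)\<close>, without recording an arrow of \<open>J\<close>.\<close>

definition glue :: "('i \<times> 'i, ('i \<times> 'i) \<times> ('i \<times> 'i) \<times> 'b) cat" where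
  "glue = \<lparr>Obj = stages,
     Arr = {(a, b, g). a \<in> stages \<and> b \<in> stages \<and> g \<in> Hom C0 (ob a) (ob b) \<and>
       ((fst b, leg b \<bullet>\<^bsub>C\<^esub> farr F g), (fst a, leg a)) \<in> hom_colim_rel C J D (fobj F (ob a))},
     Src = fst, Tgt = fst \<circ> snd, Idn = (\<lambda>a. (a, a, Idn C0 (ob a))),
     Comp = (\<lambda>(b, c, g) (a, b', f). (a, c, g \<bullet>\<^bsub>C0\<^esub> f))\<rparr>"

definition glue_funct :: "('i \<times> 'i, ('i \<times> 'i) \<times> ('i \<times> 'i) \<times> 'b, 'p, 'b) funct" where
  "glue_funct = \<lparr>fobj = ob, farr = snd \<circ> snd\<rparr>"

lemma glue_simps [simp]:
  "Obj glue = stages" "Src glue (a, b, g) = a" "Tgt glue (a, b, g) = b" "Idn glue a = (a, a, Idn C0 (ob a))"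
  "(b, c, g') \<bullet>\<^bsub>glue\<^esub> (a, b', g) = (a, c, g' \<bullet>\<^bsub>C0\<^esub> g)"
  "fobj glue_funct a = ob a" "farr glue_funct (a, b, g) = g"
  by (simp_all add: glue_def glue_funct_def)

lemma glue_arr:
  "(a, b, g) \<in> Arr glue \<longleftrightarrow> a \<in> stages \<and> b \<in> stages \<and> g \<in> Hom C0 (ob a) (ob b) \<and>
    ((fst b, leg b \<bullet>\<^bsub>C\<^esub> farr F g), (fst a, leg a)) \<in> hom_colim_rel C J D (fobj F (ob a))"
  by (simp add: glue_def)

lemma glue_Hom: "x \<in> Hom glue a b \<longleftrightarrow> (\<exists>g. x = (a, b, g) \<and> (a, b, g) \<in> Arr glue)"
  by (cases x) (auto simp: Hom_def)

lemma stagesD: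
  assumes "a \<in> stages"
  shows "fst a \<in> Obj J" "snd a \<in> Obj (K (fst a))"
  using assms by (auto simp: stages_def)

lemma cocone_\<gamma>:
  "j \<in> Obj J \<Longrightarrow> is_cocone (K j) C (comp_funct F (G j)) (fobj D j) (\<gamma> j)"
  by (rule is_colimitD(1)[OF presentationD(1)[OF \<gamma>]])

lemma ob_closed: "a \<in> stages \<Longrightarrow> ob a \<in> Obj C0"
  unfolding ob_def by (intro cat_functor.fobj_closed[OF G]) (auto dest: stagesD)

lemma leg_closed: "a \<in> stages \<Longrightarrow> leg a \<in> Hom C (fobj F (ob a)) (fobj D (fst a))"
  using is_coconeD(2)[OF cocone_\<gamma>, of "fst a" "snd a"] by (simp add: stagesD leg_def ob_def)

lemma leg_comp_closed:
  assumes "a \<in> stages" "g \<in> Hom C0 X (ob a)"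
  shows "leg a \<bullet>\<^bsub>C\<^esub> farr F g \<in> Hom C (fobj F X) (fobj D (fst a))"
  using C.comp_closed[OF F.farr_closed[OF assms(2)] leg_closed[OF assms(1)]] .

lemma leg_factor:
  assumes j: "j \<in> Obj J" and X: "X \<in> Obj C0" and f: "f \<in> Hom C (fobj F X) (fobj D j)"
  obtains k g where "(j, k) \<in> stages" "g \<in> Hom C0 X (ob (j, k))" "leg (j, k) \<bullet>\<^bsub>C\<^esub> farr F g = f"
proof -
  have "\<exists>k\<in>Obj (K j). \<exists>g\<in>Hom C0 X (fobj (G j) k). \<gamma> j k \<bullet>\<^bsub>C\<^esub> farr F g = f"
    by (rule presentationD(2)[OF \<gamma>[OF j] X f])
  then show ?thesis
    using that j by (auto simp: stages_def ob_def leg_def)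
qed

lemma leg_separate:
  assumes a: "(j, k) \<in> stages" and g: "g \<in> Hom C0 X (ob (j, k))" "g' \<in> Hom C0 X (ob (j, k))"
    and eq: "leg (j, k) \<bullet>\<^bsub>C\<^esub> farr F g = leg (j, k) \<bullet>\<^bsub>C\<^esub> farr F g'"
  obtains l t where "l \<in> Obj (K j)" "t \<in> Hom (K j) k l" "farr (G j) t \<bullet>\<^bsub>C0\<^esub> g = farr (G j) t \<bullet>\<^bsub>C0\<^esub> g'"
proof -
  have "j \<in> Obj J" "k \<in> Obj (K j)" "X \<in> Obj C0"
    using a C0.HomD[OF g(1)] by (auto simp: stages_def)
  then have "\<exists>l\<in>Obj (K j). \<exists>t\<in>Hom (K j) k l. farr (G j) t \<bullet>\<^bsub>C0\<^esub> g = farr (G j) t \<bullet>\<^bsub>C0\<^esub> g'"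
    using g eq unfolding ob_def leg_def fst_conv snd_conv by (intro presentationD(3)[OF \<gamma>])
  then show ?thesis
    using that by blast
qed

lemma step_closed:
  assumes "j \<in> Obj J" "t \<in> Hom (K j) k l"
  shows "(j, k) \<in> stages" "(j, l) \<in> stages" "farr (G j) t \<in> Hom C0 (ob (j, k)) (ob (j, l))"
    "leg (j, l) \<bullet>\<^bsub>C\<^esub> farr F (farr (G j) t) = leg (j, k)"
proof -
  interpret K: small_filtered "K j" by (rule K[OF assms(1)])
  show "(j, k) \<in> stages" "(j, l) \<in> stages"
    using K.HomD[OF assms(2)] assms(1) by (auto simp: stages_def)
  show "farr (G j) t \<in> Hom C0 (ob (j, k)) (ob (j, l))"
    using cat_functor.farr_closed[OF G[OF assms(1)] assms(2)] by (simp add: ob_def)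
  show "leg (j, l) \<bullet>\<^bsub>C\<^esub> farr F (farr (G j) t) = leg (j, k)"
    using is_coconeD(3)[OF cocone_\<gamma>[OF assms(1)] assms(2)] by (simp add: leg_def)
qed

lemma glue_arrI:
  assumes "a \<in> stages" "b \<in> stages" "g \<in> Hom C0 (ob a) (ob b)" "u \<in> Hom J (fst a) (fst b)"
    "leg b \<bullet>\<^bsub>C\<^esub> farr F g = farr D u \<bullet>\<^bsub>C\<^esub> leg a"
  shows "(a, b, g) \<in> Arr glue"
  using rel_sym[OF rel_shift[OF assms(4) leg_closed[OF assms(1)]]] assms by (simp add: glue_arr)

text \<open>Transition arrows within one presentation lie over the identity of
  \<open>j\<close>.\<close>

lemma glue_step:
  assumes "j \<in> Obj J" "t \<in> Hom (K j) k l"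
  shows "((j, k), (j, l), farr (G j) t) \<in> Arr glue"
proof (rule glue_arrI)
  note s = step_closed[OF assms]
  show "leg (j, l) \<bullet>\<^bsub>C\<^esub> farr F (farr (G j) t) = farr D (Idn J j) \<bullet>\<^bsub>C\<^esub> leg (j, k)"
    using s(4) D.farr_idn[OF assms(1)] C.idn_left[OF leg_closed[OF s(1)]] by simp
qed (use step_closed[OF assms] J.idn_closed[OF assms(1)] in auto)

text \<open>The relation defining the arrow \<open>g\<close>, restricted along \<open>f\<close>, is
  chained with the relation defining \<open>f\<close>.\<close>

lemma glue_comp:
  assumes f: "(a, b, f) \<in> Arr glue" and g: "(b, c, g) \<in> Arr glue"
  shows "(a, c, g \<bullet>\<^bsub>C0\<^esub> f) \<in> Arr glue"
proof -
  have *: "a \<in> stages" "c \<in> stages" "f \<in> Hom C0 (ob a) (ob b)" "g \<in> Hom C0 (ob b) (ob c)"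
    using f g by (auto simp: glue_arr)
  have "((fst c, (leg c \<bullet>\<^bsub>C\<^esub> farr F g) \<bullet>\<^bsub>C\<^esub> farr F f), (fst b, leg b \<bullet>\<^bsub>C\<^esub> farr F f))
      \<in> hom_colim_rel C J D (fobj F (ob a))"
    using g by (intro rel_precomp[OF _ F.farr_closed[OF *(3)]]) (simp add: glue_arr)
  moreover have "(leg c \<bullet>\<^bsub>C\<^esub> farr F g) \<bullet>\<^bsub>C\<^esub> farr F f = leg c \<bullet>\<^bsub>C\<^esub> farr F (g \<bullet>\<^bsub>C0\<^esub> f)"
    using C.comp_assoc[OF F.farr_closed[OF *(3)] F.farr_closed[OF *(4)] leg_closed[OF *(2)]]
      F.farr_comp[OF *(3,4)] by simp
  ultimately have "((fst c, leg c \<bullet>\<^bsub>C\<^esub> farr F (g \<bullet>\<^bsub>C0\<^esub> f)), (fst a, leg a)) \<in> hom_colim_rel C J D (fobj F (ob a))"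
    using f rel_trans by (simp add: glue_arr)
  then show ?thesis
    using * C0.comp_closed by (auto simp: glue_arr)
qed

lemma category_glue: "category glue"
proof
  fix x assume "x \<in> Arr glue"
  then show "Src glue x \<in> Obj glue" "Tgt glue x \<in> Obj glue"
    by (cases x; simp add: glue_arr)+
next
  fix a assume a: "a \<in> Obj glue"
  then have "leg a \<bullet>\<^bsub>C\<^esub> farr F (Idn C0 (ob a)) = leg a"
    using F.farr_idn ob_closed C.idn_right[OF leg_closed] by simp
  then show "Idn glue a \<in> Hom glue a a"
    using a C0.idn_closed[OF ob_closed] rel_refl[OF stagesD(1) leg_closed]
    by (simp add: glue_Hom glue_arr)
next
  fix x y a b c assume "x \<in> Hom glue a b" "y \<in> Hom glue b c"
  then show "y \<bullet>\<^bsub>glue\<^esub> x \<in> Hom glue a c"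
    by (auto simp: glue_Hom intro: glue_comp)
next
  fix x y z a b c d assume "x \<in> Hom glue a b" "y \<in> Hom glue b c" "z \<in> Hom glue c d"
  then show "(z \<bullet>\<^bsub>glue\<^esub> y) \<bullet>\<^bsub>glue\<^esub> x = z \<bullet>\<^bsub>glue\<^esub> (y \<bullet>\<^bsub>glue\<^esub> x)"
    using C0.comp_assoc by (auto simp: glue_Hom glue_arr)
next
  fix x a b assume "x \<in> Hom glue a b"
  then show "Idn glue b \<bullet>\<^bsub>glue\<^esub> x = x" "x \<bullet>\<^bsub>glue\<^esub> Idn glue a = x"
    using C0.idn_left C0.idn_right by (auto simp: glue_Hom glue_arr)
qed

lemma cat_functor_glue: "cat_functor glue C0 glue_funct"
proof (rule cat_functor.intro[OF category_glue C0.category_axioms], unfold_locales)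
  fix a assume "a \<in> Obj glue"
  then show "fobj glue_funct a \<in> Obj C0" "farr glue_funct (Idn glue a) = Idn C0 (fobj glue_funct a)"
    using ob_closed by auto
next
  fix x y a b c assume x: "x \<in> Hom glue a b"
  then show "farr glue_funct x \<in> Hom C0 (fobj glue_funct a) (fobj glue_funct b)"
    by (auto simp: glue_Hom glue_arr)
  assume "y \<in> Hom glue b c"
  with x show "farr glue_funct (y \<bullet>\<^bsub>glue\<^esub> x) = farr glue_funct y \<bullet>\<^bsub>C0\<^esub> farr glue_funct x"
    by (auto simp: glue_Hom)
qed

text \<open>The composite of \<open>leg a\<close> with the image of \<open>u\<close> starts at the
  image of an object of \<open>C0\<close>, so it factors through some stage of the presentation of
  \<open>D l\<close>. This stands in for an action of the arrows of \<open>J\<close> on the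
  presentations.\<close>

lemma glue_shift:
  assumes a: "a \<in> stages" and u: "u \<in> Hom J (fst a) l"
  obtains m g where "(l, m) \<in> stages" "g \<in> Hom C0 (ob a) (ob (l, m))"
    "leg (l, m) \<bullet>\<^bsub>C\<^esub> farr F g = farr D u \<bullet>\<^bsub>C\<^esub> leg a" "(a, (l, m), g) \<in> Arr glue"
proof -
  obtain m g where mg: "(l, m) \<in> stages" "g \<in> Hom C0 (ob a) (ob (l, m))"
    "leg (l, m) \<bullet>\<^bsub>C\<^esub> farr F g = farr D u \<bullet>\<^bsub>C\<^esub> leg a"
    using leg_factor[OF J.HomD(5)[OF u] ob_closed[OF a] comp_closed_diagram[OF u leg_closed[OF a]]] .
  moreover have "(a, (l, m), g) \<in> Arr glue"
    using glue_arrI[OF a mg(1,2) _ mg(3)] u by simp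
  ultimately show ?thesis
    by (rule that)
qed

lemma filtered_glue: "filtered_category glue"
proof (rule filtered_category.intro[OF category_glue], unfold_locales)
  obtain j where j: "j \<in> Obj J"
    using J.nonempty by blast
  interpret K: small_filtered "K j" by (rule K[OF j])
  show "Obj glue \<noteq> {}"
    using j K.nonempty by (auto simp: stages_def)
next
  fix a b assume "a \<in> Obj glue" "b \<in> Obj glue"
  then have a: "a \<in> stages" and b: "b \<in> stages"
    by auto
  \<comment> \<open>Upper bounds are found in two rounds: both objects are moved over a common
    \<open>l\<close> in \<open>J\<close>, then to a common stage of the presentation of
    \<open>D l\<close>.\<close>
  obtain l u v where l: "l \<in> Obj J" and u: "u \<in> Hom J (fst a) l" and v: "v \<in> Hom J (fst b) l"
    using J.upper_bound[OF stagesD(1)[OF a] stagesD(1)[OF b]] by blast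
  obtain m g where m: "(l, m) \<in> stages" "(a, (l, m), g) \<in> Arr glue"
    using glue_shift[OF a u] .
  obtain n h where n: "(l, n) \<in> stages" "(b, (l, n), h) \<in> Arr glue"
    using glue_shift[OF b v] .
  interpret K: small_filtered "K l" by (rule K[OF l])
  obtain q s t where q: "s \<in> Hom (K l) m q" "t \<in> Hom (K l) n q"
    using K.upper_bound[of m n] m(1) n(1) by (auto simp: stages_def)
  have "(a, (l, q), farr (G l) s \<bullet>\<^bsub>C0\<^esub> g) \<in> Arr glue" "(b, (l, q), farr (G l) t \<bullet>\<^bsub>C0\<^esub> h) \<in> Arr glue"
    using glue_comp[OF m(2) glue_step[OF l q(1)]] glue_comp[OF n(2) glue_step[OF l q(2)]] .
  then show "\<exists>c\<in>Obj glue. Hom glue a c \<noteq> {} \<and> Hom glue b c \<noteq> {}"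
    using step_closed(2)[OF l q(1)] by (intro bexI[of _ "(l, q)"]) (auto simp: glue_Hom ex_in_conv[symmetric])
next
  fix x y a b assume "x \<in> Hom glue a b" "y \<in> Hom glue a b"
  then obtain g g' where xy: "x = (a, b, g)" "y = (a, b, g')" "(a, b, g) \<in> Arr glue" "(a, b, g') \<in> Arr glue"
    by (auto simp: glue_Hom)
  then have g: "b \<in> stages" "g \<in> Hom C0 (ob a) (ob b)" "g' \<in> Hom C0 (ob a) (ob b)"
    by (auto simp: glue_arr)
  \<comment> \<open>Both arrows represent \<open>leg a\<close> in the colimit of hom sets, so they
    agree after some \<open>u\<close> of \<open>J\<close>. Moving \<open>b\<close> over
    \<open>l\<close> turns this into an equation at a single stage of the presentation of
    \<open>D l\<close>, which a transition arrow \<open>t\<close> makes true in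
    \<open>C0\<close>.\<close>
  have "((fst b, leg b \<bullet>\<^bsub>C\<^esub> farr F g), (fst b, leg b \<bullet>\<^bsub>C\<^esub> farr F g')) \<in> hom_colim_rel C J D (fobj F (ob a))"
    using xy(3,4) rel_trans rel_sym unfolding glue_arr by blast
  then obtain l u where u: "u \<in> Hom J (fst b) l"
    "farr D u \<bullet>\<^bsub>C\<^esub> (leg b \<bullet>\<^bsub>C\<^esub> farr F g) = farr D u \<bullet>\<^bsub>C\<^esub> (leg b \<bullet>\<^bsub>C\<^esub> farr F g')"
    by (rule rel_same_index)
  obtain m h where m: "(l, m) \<in> stages" "h \<in> Hom C0 (ob b) (ob (l, m))"
    "leg (l, m) \<bullet>\<^bsub>C\<^esub> farr F h = farr D u \<bullet>\<^bsub>C\<^esub> leg b" "(b, (l, m), h) \<in> Arr glue"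
    using glue_shift[OF g(1) u(1)] .
  have shift: "leg (l, m) \<bullet>\<^bsub>C\<^esub> farr F (h \<bullet>\<^bsub>C0\<^esub> e) = farr D u \<bullet>\<^bsub>C\<^esub> (leg b \<bullet>\<^bsub>C\<^esub> farr F e)"
    if e: "e \<in> Hom C0 (ob a) (ob b)" for e
    using C.comp_assoc[OF F.farr_closed[OF e] F.farr_closed[OF m(2)] leg_closed[OF m(1)]]
      C.comp_assoc[OF F.farr_closed[OF e] leg_closed[OF g(1)] D.farr_closed[OF u(1)]]
      F.farr_comp[OF e m(2)] m(3) by simp
  obtain q t where t: "t \<in> Hom (K l) m q"
    "farr (G l) t \<bullet>\<^bsub>C0\<^esub> (h \<bullet>\<^bsub>C0\<^esub> g) = farr (G l) t \<bullet>\<^bsub>C0\<^esub> (h \<bullet>\<^bsub>C0\<^esub> g')"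
    using leg_separate[OF m(1) C0.comp_closed[OF g(2) m(2)] C0.comp_closed[OF g(3) m(2)]]
      shift[OF g(2)] shift[OF g(3)] u(2) by metis
  have l: "l \<in> Obj J"
    using stagesD(1)[OF m(1)] by simp
  note s = step_closed[OF l t(1)]
  have "(b, (l, q), farr (G l) t \<bullet>\<^bsub>C0\<^esub> h) \<in> Arr glue"
    using glue_comp[OF m(4) glue_step[OF l t(1)]] .
  moreover have "(farr (G l) t \<bullet>\<^bsub>C0\<^esub> h) \<bullet>\<^bsub>C0\<^esub> g = (farr (G l) t \<bullet>\<^bsub>C0\<^esub> h) \<bullet>\<^bsub>C0\<^esub> g'"
    using C0.comp_assoc[OF g(2) m(2) s(3)] C0.comp_assoc[OF g(3) m(2) s(3)] t(2) by simp
  ultimately show "\<exists>c\<in>Obj glue. \<exists>w\<in>Hom glue b c. w \<bullet>\<^bsub>glue\<^esub> x = w \<bullet>\<^bsub>glue\<^esub> y"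
    using s(2) by (intro bexI[of _ "(l, q)"] bexI[of _ "(b, (l, q), farr (G l) t \<bullet>\<^bsub>C0\<^esub> h)"])
      (auto simp: xy(1,2) glue_Hom)
qed

lemma small_stages: "small TYPE('i) stages"
  unfolding stages_def using K by (intro small_Sigma[OF universe small_index]) (simp add: small_filtered_iff)

lemma small_glue: "small TYPE('i) (Arr glue)"
proof (rule small_subset)
  show "Arr glue \<subseteq> (SIGMA a:stages. SIGMA b:stages. Hom C0 (ob a) (ob b))"
    by (auto simp: glue_arr)
  show "small TYPE('i) (SIGMA a:stages. SIGMA b:stages. Hom C0 (ob a) (ob b))"
    by (intro small_Sigma[OF universe] small_stages locally_small ob_closed)
qed

section \<open>The object presented by the glued diagram\<close>

context
  fixes P :: 'o and p :: "'i \<times> 'i \<Rightarrow> 'a"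
  assumes P: "presentation C0 C F glue glue_funct P p"
begin

lemma colimit_P: "is_colimit glue C (comp_funct F glue_funct) P p"
  by (rule presentationD(1)[OF P])

lemma p_closed: "a \<in> stages \<Longrightarrow> p a \<in> Hom C (fobj F (ob a)) P"
  using is_coconeD(2)[OF is_colimitD(1)[OF colimit_P], of a] by simp

lemma p_glue:
  assumes "(a, b, g) \<in> Arr glue"
  shows "p b \<bullet>\<^bsub>C\<^esub> farr F g = p a"
  using is_coconeD(3)[OF is_colimitD(1)[OF colimit_P], of "(a, b, g)" a b] assms by (simp add: glue_Hom)

lemma eq_if_legs_eq:
  assumes j: "j \<in> Obj J" and f: "f \<in> Hom C (fobj D j) M" and g: "g \<in> Hom C (fobj D j) M"
    and eq: "\<And>k. (j, k) \<in> stages \<Longrightarrow> f \<bullet>\<^bsub>C\<^esub> leg (j, k) = g \<bullet>\<^bsub>C\<^esub> leg (j, k)"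
  shows "f = g"
proof -
  interpret G: cat_functor "K j" C0 "G j" by (rule G[OF j])
  have col: "is_colimit (K j) C (comp_funct F (G j)) (fobj D j) (\<gamma> j)"
    by (rule presentationD(1)[OF \<gamma>[OF j]])
  show ?thesis
  proof (rule C.is_colimit_unique[OF col f g])
    show "farr (comp_funct F (G j)) u
        \<in> Hom C (fobj (comp_funct F (G j)) (Src (K j) u)) (fobj (comp_funct F (G j)) (Tgt (K j) u))"
      if "u \<in> Arr (K j)" for u
      using that by (auto intro!: C.HomI)
    show "f \<bullet>\<^bsub>C\<^esub> \<gamma> j k = g \<bullet>\<^bsub>C\<^esub> \<gamma> j k" if "k \<in> Obj (K j)" for k
      using eq[of k] that j by (simp add: stages_def leg_def)
  qed (use G.D.src_closed G.D.tgt_closed in auto)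
qed

text \<open>For fixed \<open>j\<close> the arrows \<open>p (j, k)\<close> form a cocone by
  \<open>glue_step\<close>, and this defines \<open>d j\<close>. Compatibility along an arrow of
  \<open>J\<close> is tested on the legs of \<open>D j\<close> and read off from a lift given by
  \<open>glue_shift\<close>.\<close>

lemma cocone_into_glued:
  obtains d where "is_cocone J C D P d" "\<And>a. a \<in> stages \<Longrightarrow> d (fst a) \<bullet>\<^bsub>C\<^esub> leg a = p a"
proof -
  have "\<exists>h\<in>Hom C (fobj D j) P. \<forall>k\<in>Obj (K j). h \<bullet>\<^bsub>C\<^esub> \<gamma> j k = p (j, k)" if j: "j \<in> Obj J" for j
  proof (rule is_colimitD(2))
    interpret K: small_filtered "K j" by (rule K[OF j])
    show "is_colimit (K j) C (comp_funct F (G j)) (fobj D j) (\<gamma> j)"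
      by (rule presentationD(1)[OF \<gamma>[OF j]])
    show "is_cocone (K j) C (comp_funct F (G j)) P (\<lambda>k. p (j, k))"
    proof (rule is_coconeI)
      show "P \<in> Obj C"
        using is_coconeD(1)[OF is_colimitD(1)[OF colimit_P]] .
      show "p (j, k) \<in> Hom C (fobj (comp_funct F (G j)) k) P" if "k \<in> Obj (K j)" for k
        using p_closed[of "(j, k)"] that j by (simp add: stages_def ob_def)
      show "p (j, Tgt (K j) t) \<bullet>\<^bsub>C\<^esub> farr (comp_funct F (G j)) t = p (j, Src (K j) t)" if "t \<in> Arr (K j)" for t
        using p_glue[OF glue_step[OF j]] that K.arr_iff_Hom by simp
    qed
  qed
  then obtain d where d: "\<And>j. j \<in> Obj J \<Longrightarrow> d j \<in> Hom C (fobj D j) P"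
      "\<And>j k. j \<in> Obj J \<Longrightarrow> k \<in> Obj (K j) \<Longrightarrow> d j \<bullet>\<^bsub>C\<^esub> \<gamma> j k = p (j, k)"
    by metis
  have leg: "d (fst a) \<bullet>\<^bsub>C\<^esub> leg a = p a" if "a \<in> stages" for a
    using d(2)[OF stagesD[OF that]] by (simp add: leg_def)
  have "is_cocone J C D P d"
  proof (rule is_coconeI)
    show "P \<in> Obj C"
      using is_coconeD(1)[OF is_colimitD(1)[OF colimit_P]] .
    show "d j \<in> Hom C (fobj D j) P" if "j \<in> Obj J" for j
      using d(1)[OF that] .
    fix u assume "u \<in> Arr J"
    then obtain j j' where u: "u \<in> Hom J j j'" "j = Src J u" "j' = Tgt J u"
      using J.arr_iff_Hom by blast
    note j = J.HomD(4,5)[OF u(1)]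
    have "d j' \<bullet>\<^bsub>C\<^esub> farr D u = d j"
    proof (rule eq_if_legs_eq[OF j(1) C.comp_closed[OF D.farr_closed[OF u(1)] d(1)[OF j(2)]] d(1)[OF j(1)]])
      fix k assume a: "(j, k) \<in> stages"
      have u': "u \<in> Hom J (fst (j, k)) j'"
        using u(1) by simp
      obtain m g where m: "(j', m) \<in> stages" "g \<in> Hom C0 (ob (j, k)) (ob (j', m))"
        "leg (j', m) \<bullet>\<^bsub>C\<^esub> farr F g = farr D u \<bullet>\<^bsub>C\<^esub> leg (j, k)" "((j, k), (j', m), g) \<in> Arr glue"
        using glue_shift[OF a u'] .
      have lm: "leg (j', m) \<in> Hom C (fobj F (ob (j', m))) (fobj D j')" and la: "leg (j, k) \<in> Hom C (fobj F (ob (j, k))) (fobj D j)"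
        using leg_closed[OF m(1)] leg_closed[OF a] by simp_all
      have "(d j' \<bullet>\<^bsub>C\<^esub> farr D u) \<bullet>\<^bsub>C\<^esub> leg (j, k) = d j' \<bullet>\<^bsub>C\<^esub> (leg (j', m) \<bullet>\<^bsub>C\<^esub> farr F g)"
        using C.comp_assoc[OF la D.farr_closed[OF u(1)] d(1)[OF j(2)]] m(3) by simp
      also have "\<dots> = p (j', m) \<bullet>\<^bsub>C\<^esub> farr F g"
        using C.comp_assoc[OF F.farr_closed[OF m(2)] lm d(1)[OF j(2)]] leg[OF m(1)] by simp
      also have "\<dots> = d j \<bullet>\<^bsub>C\<^esub> leg (j, k)"
        using p_glue[OF m(4)] leg[OF a] by simp
      finally show "(d j' \<bullet>\<^bsub>C\<^esub> farr D u) \<bullet>\<^bsub>C\<^esub> leg (j, k) = d j \<bullet>\<^bsub>C\<^esub> leg (j, k)" .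
    qed
    then show "d (Tgt J u) \<bullet>\<^bsub>C\<^esub> farr D u = d (Src J u)"
      using u by simp
  qed
  then show ?thesis
    using that leg by blast
qed

lemma glued_factor:
  assumes "X \<in> Obj C0" "f \<in> Hom C (fobj F X) P"
  obtains a g where "a \<in> stages" "g \<in> Hom C0 X (ob a)" "p a \<bullet>\<^bsub>C\<^esub> farr F g = f"
  using presentationD(2)[OF P assms] that unfolding glue_simps by blast

lemma glued_separate:
  assumes a: "a \<in> stages" and g: "g \<in> Hom C0 X (ob a)" "g' \<in> Hom C0 X (ob a)"
    and eq: "p a \<bullet>\<^bsub>C\<^esub> farr F g = p a \<bullet>\<^bsub>C\<^esub> farr F g'"
  obtains b t where "(a, b, t) \<in> Arr glue" "t \<bullet>\<^bsub>C0\<^esub> g = t \<bullet>\<^bsub>C0\<^esub> g'"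
proof -
  have "\<exists>b\<in>stages. \<exists>x\<in>Hom glue a b. farr glue_funct x \<bullet>\<^bsub>C0\<^esub> g = farr glue_funct x \<bullet>\<^bsub>C0\<^esub> g'"
    using presentationD(3)[OF P C0.HomD(4)[OF g(1)], of a g g'] a g eq by simp
  then show ?thesis
    using that by (auto simp: glue_Hom)
qed

text \<open>Arrows that agree in \<open>P\<close> agree already after arrows of \<open>glue\<close>,
  by filteredness and the separation clause of the presentation. Along arrows of \<open>glue\<close>
  the class in the colimit of hom sets does not change, by their definition.\<close>

lemma rel_if_eq_in_glued:
  assumes a: "a \<in> stages" and g: "g \<in> Hom C0 X (ob a)" and b: "b \<in> stages" and h: "h \<in> Hom C0 X (ob b)"
    and eq: "p a \<bullet>\<^bsub>C\<^esub> farr F g = p b \<bullet>\<^bsub>C\<^esub> farr F h"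
  shows "((fst a, leg a \<bullet>\<^bsub>C\<^esub> farr F g), (fst b, leg b \<bullet>\<^bsub>C\<^esub> farr F h)) \<in> hom_colim_rel C J D (fobj F X)"
proof -
  interpret glue: filtered_category glue by (rule filtered_glue)
  have pull: "((fst c, leg c \<bullet>\<^bsub>C\<^esub> farr F (s \<bullet>\<^bsub>C0\<^esub> e)), (fst a, leg a \<bullet>\<^bsub>C\<^esub> farr F e)) \<in> hom_colim_rel C J D (fobj F X)"
    and pull': "p c \<bullet>\<^bsub>C\<^esub> farr F (s \<bullet>\<^bsub>C0\<^esub> e) = p a \<bullet>\<^bsub>C\<^esub> farr F e"
    if s: "(a, c, s) \<in> Arr glue" and e: "e \<in> Hom C0 X (ob a)" for a c s e
  proof -
    have *: "a \<in> stages" "c \<in> stages" "s \<in> Hom C0 (ob a) (ob c)"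
      "((fst c, leg c \<bullet>\<^bsub>C\<^esub> farr F s), (fst a, leg a)) \<in> hom_colim_rel C J D (fobj F (ob a))"
      using s by (auto simp: glue_arr)
    show "((fst c, leg c \<bullet>\<^bsub>C\<^esub> farr F (s \<bullet>\<^bsub>C0\<^esub> e)), (fst a, leg a \<bullet>\<^bsub>C\<^esub> farr F e)) \<in> hom_colim_rel C J D (fobj F X)"
      using rel_precomp[OF *(4) F.farr_closed[OF e]] F.farr_comp[OF e *(3)]
        C.comp_assoc[OF F.farr_closed[OF e] F.farr_closed[OF *(3)] leg_closed[OF *(2)]] by simp
    show "p c \<bullet>\<^bsub>C\<^esub> farr F (s \<bullet>\<^bsub>C0\<^esub> e) = p a \<bullet>\<^bsub>C\<^esub> farr F e"
      using p_glue[OF s] F.farr_comp[OF e *(3)]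
        C.comp_assoc[OF F.farr_closed[OF e] F.farr_closed[OF *(3)] p_closed[OF *(2)]] by simp
  qed
  obtain c s t where st: "(a, c, s) \<in> Arr glue" "(b, c, t) \<in> Arr glue"
    using glue.upper_bound[of a b] a b by (auto simp: glue_Hom ex_in_conv[symmetric])
  then have c: "c \<in> stages" "s \<in> Hom C0 (ob a) (ob c)" "t \<in> Hom C0 (ob b) (ob c)"
    by (auto simp: glue_arr)
  have "p c \<bullet>\<^bsub>C\<^esub> farr F (s \<bullet>\<^bsub>C0\<^esub> g) = p c \<bullet>\<^bsub>C\<^esub> farr F (t \<bullet>\<^bsub>C0\<^esub> h)"
    using pull'[OF st(1) g] pull'[OF st(2) h] eq by simp
  then obtain e r where r: "(c, e, r) \<in> Arr glue" "r \<bullet>\<^bsub>C0\<^esub> (s \<bullet>\<^bsub>C0\<^esub> g) = r \<bullet>\<^bsub>C0\<^esub> (t \<bullet>\<^bsub>C0\<^esub> h)"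
    using glued_separate[OF c(1) C0.comp_closed[OF g c(2)] C0.comp_closed[OF h c(3)]] by blast
  have "r \<in> Hom C0 (ob c) (ob e)"
    using r(1) by (simp add: glue_arr)
  then have "(r \<bullet>\<^bsub>C0\<^esub> s) \<bullet>\<^bsub>C0\<^esub> g = (r \<bullet>\<^bsub>C0\<^esub> t) \<bullet>\<^bsub>C0\<^esub> h"
    using C0.comp_assoc[OF g c(2), of r] C0.comp_assoc[OF h c(3), of r] r(2) by simp
  then show ?thesis
    using pull[OF glue_comp[OF st(1) r(1)] g] pull[OF glue_comp[OF st(2) r(1)] h] rel_sym rel_trans
    by metis
qed

text \<open>This replaces a proof that \<open>P\<close> is itself a colimit of \<open>D\<close>.\<close>

lemma colimit_retract_of_glued:
  assumes L: "is_colimit J C D L c"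
  obtains d h e where "is_cocone J C D P d" "\<forall>a\<in>stages. d (fst a) \<bullet>\<^bsub>C\<^esub> leg a = p a"
    "h \<in> Hom C L P" "\<forall>j\<in>Obj J. h \<bullet>\<^bsub>C\<^esub> c j = d j"
    "e \<in> Hom C P L" "e \<bullet>\<^bsub>C\<^esub> h = Idn C L" "\<forall>j\<in>Obj J. e \<bullet>\<^bsub>C\<^esub> d j = c j"
proof -
  have c: "is_cocone J C D L c"
    using is_colimitD(1)[OF L] .
  obtain d where d: "is_cocone J C D P d" "\<And>a. a \<in> stages \<Longrightarrow> d (fst a) \<bullet>\<^bsub>C\<^esub> leg a = p a"
    using cocone_into_glued by blast
  obtain h where h: "h \<in> Hom C L P" "\<And>j. j \<in> Obj J \<Longrightarrow> h \<bullet>\<^bsub>C\<^esub> c j = d j"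
    using is_colimitD(2)[OF L d(1)] by blast
  have cl: "c (fst a) \<bullet>\<^bsub>C\<^esub> leg a \<in> Hom C (fobj F (ob a)) L" if "a \<in> stages" for a
    using C.comp_closed[OF leg_closed[OF that] is_coconeD(2)[OF c stagesD(1)[OF that]]] .
  \<comment> \<open>The condition defining arrows of \<open>glue\<close> yields the cocone equations
    through \<open>rel_cocone\<close>.\<close>
  have "is_cocone glue C (comp_funct F glue_funct) L (\<lambda>a. c (fst a) \<bullet>\<^bsub>C\<^esub> leg a)"
  proof (rule is_coconeI)
    show "L \<in> Obj C"
      using is_coconeD(1)[OF c] .
    show "c (fst a) \<bullet>\<^bsub>C\<^esub> leg a \<in> Hom C (fobj (comp_funct F glue_funct) a) L" if "a \<in> Obj glue" for a
      using cl that by simp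
    fix x assume "x \<in> Arr glue"
    then obtain a b g where x: "x = (a, b, g)" and "(a, b, g) \<in> Arr glue"
      by (cases x) auto
    then have g: "a \<in> stages" "b \<in> stages" "g \<in> Hom C0 (ob a) (ob b)"
      "((fst b, leg b \<bullet>\<^bsub>C\<^esub> farr F g), (fst a, leg a)) \<in> hom_colim_rel C J D (fobj F (ob a))"
      by (auto simp: glue_arr)
    have "(c (fst b) \<bullet>\<^bsub>C\<^esub> leg b) \<bullet>\<^bsub>C\<^esub> farr F g = c (fst b) \<bullet>\<^bsub>C\<^esub> (leg b \<bullet>\<^bsub>C\<^esub> farr F g)"
      using C.comp_assoc[OF F.farr_closed[OF g(3)] leg_closed[OF g(2)] is_coconeD(2)[OF c stagesD(1)[OF g(2)]]] .
    also have "\<dots> = c (fst a) \<bullet>\<^bsub>C\<^esub> leg a"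
      using rel_cocone[OF c g(4)] .
    finally show "(c (fst (Tgt glue x)) \<bullet>\<^bsub>C\<^esub> leg (Tgt glue x)) \<bullet>\<^bsub>C\<^esub> farr (comp_funct F glue_funct) x
        = c (fst (Src glue x)) \<bullet>\<^bsub>C\<^esub> leg (Src glue x)"
      by (simp add: x)
  qed
  from is_colimitD(2)[OF colimit_P this]
  obtain e where e: "e \<in> Hom C P L" "\<And>a. a \<in> stages \<Longrightarrow> e \<bullet>\<^bsub>C\<^esub> p a = c (fst a) \<bullet>\<^bsub>C\<^esub> leg a"
    unfolding glue_simps by blast
  have ed: "e \<bullet>\<^bsub>C\<^esub> d j = c j" if j: "j \<in> Obj J" for j
  proof (rule eq_if_legs_eq[OF j C.comp_closed[OF is_coconeD(2)[OF d(1) j] e(1)] is_coconeD(2)[OF c j]])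
    fix k assume a: "(j, k) \<in> stages"
    have la: "leg (j, k) \<in> Hom C (fobj F (ob (j, k))) (fobj D j)"
      using leg_closed[OF a] by simp
    show "(e \<bullet>\<^bsub>C\<^esub> d j) \<bullet>\<^bsub>C\<^esub> leg (j, k) = c j \<bullet>\<^bsub>C\<^esub> leg (j, k)"
      using C.comp_assoc[OF la is_coconeD(2)[OF d(1) j] e(1)] e(2)[OF a] d(2)[OF a] by simp
  qed
  have "e \<bullet>\<^bsub>C\<^esub> h = Idn C L"
  proof (rule C.is_colimit_unique[OF L C.comp_closed[OF h(1) e(1)] C.idn_closed[OF is_coconeD(1)[OF c]]])
    show "farr D u \<in> Hom C (fobj D (Src J u)) (fobj D (Tgt J u))" if "u \<in> Arr J" for u
      using that D.farr_closed J.arr_iff_Hom by blast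
    show "(e \<bullet>\<^bsub>C\<^esub> h) \<bullet>\<^bsub>C\<^esub> c j = Idn C L \<bullet>\<^bsub>C\<^esub> c j" if j: "j \<in> Obj J" for j
      using C.comp_assoc[OF is_coconeD(2)[OF c j] h(1) e(1)] h(2)[OF j] ed[OF j]
        C.idn_left[OF is_coconeD(2)[OF c j]] by simp
  qed (use J.src_closed J.tgt_closed in auto)
  then show ?thesis
    using that[OF d(1) _ h(1) _ e(1)] d(2) h(2) ed by simp
qed

end

text \<open>The composite \<open>h \<bullet> f\<close> factors through a stage \<open>a\<close> of
  \<open>P\<close>, hence through \<open>D (fst a)\<close>. Applying \<open>e\<close> gives a
  factorization of \<open>f\<close> itself, since \<open>e \<bullet> h\<close> is the
  identity.\<close>

lemma compact_surj:
  assumes L: "is_colimit J C D L c" and X: "X \<in> Obj C0" and f: "f \<in> Hom C (fobj F X) L"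
  shows "\<exists>j\<in>Obj J. \<exists>g\<in>Hom C (fobj F X) (fobj D j). c j \<bullet>\<^bsub>C\<^esub> g = f"
proof -
  obtain P p where P: "presentation C0 C F glue glue_funct P p"
    using realizable_any[OF filtered_glue _ small_glue cat_functor_glue] small_stages by auto
  obtain d h e where d: "is_cocone J C D P d" "\<forall>a\<in>stages. d (fst a) \<bullet>\<^bsub>C\<^esub> leg a = p a"
    and h: "h \<in> Hom C L P" "\<forall>j\<in>Obj J. h \<bullet>\<^bsub>C\<^esub> c j = d j" and e: "e \<in> Hom C P L" "e \<bullet>\<^bsub>C\<^esub> h = Idn C L"
      "\<forall>j\<in>Obj J. e \<bullet>\<^bsub>C\<^esub> d j = c j"
    using colimit_retract_of_glued[OF P L] .
  obtain a g where a: "a \<in> stages" "g \<in> Hom C0 X (ob a)" "p a \<bullet>\<^bsub>C\<^esub> farr F g = h \<bullet>\<^bsub>C\<^esub> f"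
    using glued_factor[OF P X C.comp_closed[OF f h(1)]] .
  note j = stagesD(1)[OF a(1)]
  note lg = leg_comp_closed[OF a(1,2)]
  have "c (fst a) \<bullet>\<^bsub>C\<^esub> (leg a \<bullet>\<^bsub>C\<^esub> farr F g) = e \<bullet>\<^bsub>C\<^esub> (d (fst a) \<bullet>\<^bsub>C\<^esub> (leg a \<bullet>\<^bsub>C\<^esub> farr F g))"
    using C.comp_assoc[OF lg is_coconeD(2)[OF d(1) j] e(1)] bspec[OF e(3) j] by simp
  also have "\<dots> = e \<bullet>\<^bsub>C\<^esub> (h \<bullet>\<^bsub>C\<^esub> f)"
    using C.comp_assoc[OF F.farr_closed[OF a(2)] leg_closed[OF a(1)] is_coconeD(2)[OF d(1) j]]
      bspec[OF d(2) a(1)] a(3) by simp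
  also have "\<dots> = f"
    using C.comp_assoc[OF f h(1) e(1)] e(2) C.idn_left[OF f] by simp
  finally show ?thesis
    using j lg by blast
qed

text \<open>Each arrow is first written as a leg after the image of an arrow of \<open>C0\<close>.
  The map \<open>h\<close> carries the equation in \<open>L\<close> to one in \<open>P\<close>,
  where \<open>rel_if_eq_in_glued\<close> applies.\<close>

lemma compact_inj:
  assumes L: "is_colimit J C D L c" and X: "X \<in> Obj C0"
    and f: "j \<in> Obj J" "f \<in> Hom C (fobj F X) (fobj D j)"
    and g: "k \<in> Obj J" "g \<in> Hom C (fobj F X) (fobj D k)"
    and eq: "c j \<bullet>\<^bsub>C\<^esub> f = c k \<bullet>\<^bsub>C\<^esub> g"
  shows "((j, f), (k, g)) \<in> hom_colim_rel C J D (fobj F X)"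
proof -
  obtain P p where P: "presentation C0 C F glue glue_funct P p"
    using realizable_any[OF filtered_glue _ small_glue cat_functor_glue] small_stages by auto
  obtain d h e where d: "is_cocone J C D P d" "\<forall>a\<in>stages. d (fst a) \<bullet>\<^bsub>C\<^esub> leg a = p a"
    and h: "h \<in> Hom C L P" "\<forall>j\<in>Obj J. h \<bullet>\<^bsub>C\<^esub> c j = d j"
    and "e \<in> Hom C P L" "e \<bullet>\<^bsub>C\<^esub> h = Idn C L" "\<forall>j\<in>Obj J. e \<bullet>\<^bsub>C\<^esub> d j = c j"
    using colimit_retract_of_glued[OF P L] .
  have c: "is_cocone J C D L c"
    using is_colimitD(1)[OF L] .
  have transfer: "p a \<bullet>\<^bsub>C\<^esub> farr F r = h \<bullet>\<^bsub>C\<^esub> (c (fst a) \<bullet>\<^bsub>C\<^esub> (leg a \<bullet>\<^bsub>C\<^esub> farr F r))"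
    if a: "a \<in> stages" and r: "r \<in> Hom C0 X (ob a)" for a r
  proof -
    note j = stagesD(1)[OF a]
    have "p a \<bullet>\<^bsub>C\<^esub> farr F r = d (fst a) \<bullet>\<^bsub>C\<^esub> (leg a \<bullet>\<^bsub>C\<^esub> farr F r)"
      using C.comp_assoc[OF F.farr_closed[OF r] leg_closed[OF a] is_coconeD(2)[OF d(1) j]] bspec[OF d(2) a] by simp
    then show ?thesis
      using C.comp_assoc[OF leg_comp_closed[OF a r] is_coconeD(2)[OF c j] h(1)] bspec[OF h(2) j] by simp
  qed
  obtain m r where m: "(j, m) \<in> stages" "r \<in> Hom C0 X (ob (j, m))" "leg (j, m) \<bullet>\<^bsub>C\<^esub> farr F r = f"
    using leg_factor[OF f(1) X f(2)] .
  obtain n s where n: "(k, n) \<in> stages" "s \<in> Hom C0 X (ob (k, n))" "leg (k, n) \<bullet>\<^bsub>C\<^esub> farr F s = g"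
    using leg_factor[OF g(1) X g(2)] .
  have "p (j, m) \<bullet>\<^bsub>C\<^esub> farr F r = p (k, n) \<bullet>\<^bsub>C\<^esub> farr F s"
    using transfer[OF m(1,2)] transfer[OF n(1,2)] m(3) n(3) eq by simp
  then show ?thesis
    using rel_if_eq_in_glued[OF P m(1,2) n(1,2)] m(3) n(3) by simp
qed

end

context ind_generated
begin

lemma gluing_exists:
  assumes J: "small_filtered (J :: ('i, 'i) cat)" and D: "cat_functor J C D"
  obtains K G \<gamma> where "gluing C0 C F J D K G \<gamma>"
proof -
  interpret D: cat_functor J C D by (fact D)
  have "\<forall>j\<in>Obj J. \<exists>(K :: ('i, 'i) cat) G \<gamma>.
      small_filtered K \<and> cat_functor K C0 G \<and> presentation C0 C F K G (fobj D j) \<gamma>"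
    using presentable D.fobj_closed by blast
  then obtain K :: "'i \<Rightarrow> ('i, 'i) cat" and G \<gamma> where "\<forall>j\<in>Obj J. small_filtered (K j) \<and> cat_functor (K j) C0 (G j) \<and>
      presentation C0 C F (K j) (G j) (fobj D j) (\<gamma> j)"
    by metis
  then have "gluing C0 C F J D K G \<gamma>"
    using J D C.category_axioms ind_generated_axioms
    unfolding gluing_def gluing_axioms_def filtered_diagram_def small_filtered_iff by blast
  then show ?thesis
    by (rule that)
qed

lemma compact_object_iso_image:
  assumes X: "X \<in> Obj C0" and i: "i \<in> Hom C Z (fobj F X)" "iso_arrow C i"
  shows "compact_object TYPE('i) C Z"
proof (rule compact_objectI_iso[OF C.category_axioms i])
  fix J :: "('i, 'i) cat" and D L c
  assume J: "small_filtered J" "cat_functor J C D" and L: "is_colimit J C D L c"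
  obtain K G \<gamma> where "gluing C0 C F J D K G \<gamma>"
    using gluing_exists[OF J] .
  then interpret gluing C0 C F universe_type J D K G \<gamma> .
  show "\<exists>j\<in>Obj J. \<exists>g\<in>Hom C (fobj F X) (fobj D j). c j \<bullet>\<^bsub>C\<^esub> g = f" if "f \<in> Hom C (fobj F X) L" for f
    using compact_surj[OF L X that] .
  show "((j, f), (k, g)) \<in> hom_colim_rel C J D (fobj F X)"
    if "j \<in> Obj J" "f \<in> Hom C (fobj F X) (fobj D j)" "k \<in> Obj J" "g \<in> Hom C (fobj F X) (fobj D k)"
      "c j \<bullet>\<^bsub>C\<^esub> f = c k \<bullet>\<^bsub>C\<^esub> g" for j f k g
    using compact_inj[OF L X that] .
qed

end

section \<open>Arrows of ind-objects\<close>

text \<open>Arrows of ind-objects are restricted and composed by saturating a whole set of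
  composites of representatives; this identifies the result with the class containing them.\<close>

lemma equiv_Image_class:
  assumes R: "equiv A R" and \<xi>: "\<xi> \<in> A // R" and S: "S \<subseteq> \<xi>" "S \<noteq> {}"
  shows "R `` S = \<xi>"
proof -
  have "R `` {x} = \<xi>" if "x \<in> \<xi>" for x
    using that \<xi> equiv_class_eq[OF R] by (auto elim!: quotientE)
  then show ?thesis
    using S by blast
qed

text \<open>That \<open>ind_cat C0\<close> is a category is a hypothesis of the locale because it
  comes with the equivalence \<open>\<Phi>\<close>, whose definition includes it.\<close>

locale ind_objects = C0: category C0 + ind: category "ind_cat C0 :: (('i, 'o, 'a) ind_object, ('i, 'o, 'a) ind_arrow) cat"
  for C0 :: "('o, 'a, 'm) cat_scheme" and universe_type :: "'i itself" +
  assumes universe: "universe TYPE('i)"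
begin

abbreviation IndC :: "(('i, 'o, 'a) ind_object, ('i, 'o, 'a) ind_arrow) cat" where
  "IndC \<equiv> ind_cat C0"

abbreviation const :: "'o \<Rightarrow> ('i, 'o, 'a) ind_object" where
  "const \<equiv> const_ind C0"

abbreviation embed :: "'a \<Rightarrow> ('i, 'o, 'a) ind_arrow" where
  "embed \<equiv> farr (ind_embedding C0)"

lemma IndC_simps [simp]:
  "X \<in> Obj IndC \<longleftrightarrow> small_filtered (index X) \<and> cat_functor (index X) C0 (diagram X)"
  "Src IndC (X, Y, \<phi>) = X" "Tgt IndC (X, Y, \<phi>) = Y"
  by (simp_all add: ind_cat_def)

lemma IndC_Hom: "x \<in> Hom IndC X Y \<longleftrightarrow> X \<in> Obj IndC \<and> Y \<in> Obj IndC \<and> (\<exists>\<phi>\<in>ind_hom C0 X Y. x = (X, Y, \<phi>))"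
  by (cases x) (auto simp: Hom_def ind_cat_def)

lemma ind_homD:
  assumes \<phi>: "\<phi> \<in> ind_hom C0 X Y"
  shows "\<phi> \<in> extensional (Obj (index X))"
    and "a \<in> Obj (index X) \<Longrightarrow> \<phi> a \<in> hom_colim C0 (index Y) (diagram Y) (ind_at X a)"
    and "u \<in> Hom (index X) a m \<Longrightarrow> ind_colim_rel C0 Y (ind_at X a) ``
      ((\<lambda>(b, f). (b, f \<bullet>\<^bsub>C0\<^esub> farr (diagram X) u)) ` \<phi> m) = \<phi> a"
proof -
  show "\<phi> \<in> extensional (Obj (index X))"
    "a \<in> Obj (index X) \<Longrightarrow> \<phi> a \<in> hom_colim C0 (index Y) (diagram Y) (ind_at X a)"
    using \<phi> by (auto simp: ind_hom_def PiE_def Pi_def)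
  assume u: "u \<in> Hom (index X) a m"
  have "\<forall>u\<in>Arr (index X). ind_colim_rel C0 Y (ind_at X (Src (index X) u)) ``
      ((\<lambda>(b, f). (b, f \<bullet>\<^bsub>C0\<^esub> farr (diagram X) u)) ` \<phi> (Tgt (index X) u)) = \<phi> (Src (index X) u)"
    using \<phi> unfolding ind_hom_def mem_Collect_eq by (rule conjunct2)
  from bspec[OF this, of u] show "ind_colim_rel C0 Y (ind_at X a) ``
      ((\<lambda>(b, f). (b, f \<bullet>\<^bsub>C0\<^esub> farr (diagram X) u)) ` \<phi> m) = \<phi> a"
    using u by (simp add: Hom_def)
qed

lemma IndC_comp:
  "(Y, Z, \<psi>) \<bullet>\<^bsub>IndC\<^esub> (X, Y', \<phi>) = (X, Z, \<lambda>a\<in>Obj (index X). ind_colim_rel C0 Z (ind_at X a) ``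
     {(c, g \<bullet>\<^bsub>C0\<^esub> f) | b c f g. (b, f) \<in> \<phi> a \<and> (c, g) \<in> \<psi> b})"
  by (simp add: ind_cat_def)

lemma filtered_diagram_ind: "X \<in> Obj IndC \<Longrightarrow> filtered_diagram (index X) C0 (diagram X)"
  using C0.category_axioms by (simp add: filtered_diagram_def small_filtered_iff)

lemma point_simps [simp]:
  "Obj point_cat = {undefined}" "Arr point_cat = {undefined}"
  "index (const X) = point_cat" "ind_at (const X) a = X" "farr (diagram (const X)) u = Idn C0 X"
  "Src point_cat u = undefined" "Tgt point_cat u = undefined" "Comp point_cat u v = undefined"
  "u \<in> Hom point_cat j k \<longleftrightarrow> u = undefined \<and> j = undefined \<and> k = undefined"
  by (auto simp: point_cat_def const_ind_def Hom_def)

lemma const_obj: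
  assumes X: "X \<in> Obj C0"
  shows "const X \<in> Obj IndC"
proof -
  have cat: "category (point_cat :: ('i, 'i) cat)"
    by unfold_locales (auto simp: point_cat_def Hom_def)
  have "small_filtered (point_cat :: ('i, 'i) cat)"
    using small_singleton[OF universe]
    by (intro small_filtered.intro[OF cat] small_filtered_axioms.intro) auto
  moreover have "cat_functor point_cat C0 (diagram (const X))"
    using C0.idn_closed[OF X] C0.idn_left[OF C0.idn_closed[OF X]] X
    by (intro cat_functor.intro[OF cat C0.category_axioms] cat_functor_axioms.intro) auto
  ultimately show ?thesis
    by simp
qed

text \<open>The class of \<open>f\<close> in \<open>colim\<^sub>a Hom(Z, X\<^sub>a)\<close>, viewed
  as an arrow from the constant ind-object on \<open>Z\<close>. \<open>germ_surj\<close> and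
  \<open>germ_eq_iff\<close> translate statements about such arrows into statements about
  representatives.\<close>

definition germ :: "('i, 'o, 'a) ind_object \<Rightarrow> 'o \<Rightarrow> 'i \<Rightarrow> 'a \<Rightarrow> ('i, 'o, 'a) ind_arrow" where
  "germ X Z a f = (const Z, X, \<lambda>_\<in>Obj point_cat. ind_colim_rel C0 X Z `` {(a, f)})"

lemma germ_closed:
  assumes X: "X \<in> Obj IndC" and a: "a \<in> Obj (index X)" and f: "f \<in> Hom C0 Z (ind_at X a)"
  shows "germ X Z a f \<in> Hom IndC (const Z) X"
proof -
  interpret X: filtered_diagram "index X" C0 "diagram X"
    by (rule filtered_diagram_ind[OF X])
  let ?R = "ind_colim_rel C0 X Z"
  have cl: "?R `` {(a, f)} \<in> hom_colim C0 (index X) (diagram X) Z"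
    unfolding hom_colim_def using a f by (intro quotientI) simp
  have "(\<lambda>(b, g). (b, g \<bullet>\<^bsub>C0\<^esub> Idn C0 Z)) ` (?R `` {(a, f)}) = (\<lambda>x. x) ` (?R `` {(a, f)})"
    by (intro image_cong refl) (auto elim!: hom_colim_relE simp: C0.idn_right)
  moreover have "?R `` (?R `` {(a, f)}) = ?R `` {(a, f)}"
    using cl X.rel_refl[OF a f] unfolding hom_colim_def by (intro equiv_Image_class[OF X.equiv_rel]) auto
  ultimately have "(\<lambda>_\<in>Obj point_cat. ?R `` {(a, f)}) \<in> ind_hom C0 (const Z) X"
    using cl by (simp add: ind_hom_def)
  then show ?thesis
    using const_obj[OF C0.HomD(4)[OF f]] X by (simp add: IndC_Hom germ_def)
qed

lemma germ_surj:
  assumes h: "h \<in> Hom IndC (const Z) X"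
  obtains a f where "a \<in> Obj (index X)" "f \<in> Hom C0 Z (ind_at X a)" "h = germ X Z a f"
proof -
  obtain \<phi> where \<phi>: "h = (const Z, X, \<phi>)" "\<phi> \<in> ind_hom C0 (const Z) X"
    using h by (auto simp: IndC_Hom)
  then have *: "\<phi> \<in> (\<Pi>\<^sub>E _\<in>{undefined}. hom_colim C0 (index X) (diagram X) Z)"
    by (simp add: ind_hom_def)
  then have "\<phi> undefined \<in> hom_colim C0 (index X) (diagram X) Z"
    by (auto simp: PiE_def)
  then obtain a f where af: "a \<in> Obj (index X)" "f \<in> Hom C0 Z (ind_at X a)"
    "\<phi> undefined = ind_colim_rel C0 X Z `` {(a, f)}"
    by (auto simp: hom_colim_def elim!: quotientE)
  have "\<phi> = (\<lambda>_\<in>{undefined}. \<phi> undefined)"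
    using * by (intro extensionalityI[of _ "{undefined}"]) (auto simp: PiE_def)
  with af \<phi>(1) show ?thesis
    by (intro that[of a f]) (simp_all add: germ_def)
qed

lemma germ_eq_iff:
  assumes X: "X \<in> Obj IndC" and a: "a \<in> Obj (index X)" "f \<in> Hom C0 Z (ind_at X a)"
    and b: "b \<in> Obj (index X)" "g \<in> Hom C0 Z (ind_at X b)"
  shows "germ X Z a f = germ X Z b g \<longleftrightarrow> ((a, f), (b, g)) \<in> ind_colim_rel C0 X Z"
proof -
  interpret X: filtered_diagram "index X" C0 "diagram X"
    by (rule filtered_diagram_ind[OF X])
  have "germ X Z a f = germ X Z b g \<longleftrightarrow> ind_colim_rel C0 X Z `` {(a, f)} = ind_colim_rel C0 X Z `` {(b, g)}"
    unfolding germ_def by (simp add: fun_eq_iff)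
  then show ?thesis
    using eq_equiv_class_iff[OF X.equiv_rel, of "(a, f)" Z "(b, g)"] a b by simp
qed

text \<open>Restricting a representative of \<open>\<phi> m\<close> along \<open>u\<close> lands in
  the class \<open>\<phi> a\<close>, and members of one class are related.\<close>

lemma ind_hom_natural:
  assumes Y: "Y \<in> Obj IndC" and X: "X \<in> Obj IndC" and \<phi>: "\<phi> \<in> ind_hom C0 X Y"
    and u: "u \<in> Hom (index X) a m" and k: "(d, k) \<in> \<phi> m" and g: "(c, g) \<in> \<phi> a"
  shows "((c, g), (d, k \<bullet>\<^bsub>C0\<^esub> farr (diagram X) u)) \<in> ind_colim_rel C0 Y (ind_at X a)"
proof -
  interpret X: filtered_diagram "index X" C0 "diagram X"
    by (rule filtered_diagram_ind[OF X])
  interpret Y: filtered_diagram "index Y" C0 "diagram Y"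
    by (rule filtered_diagram_ind[OF Y])
  let ?R = "ind_colim_rel C0 Y (ind_at X a)"
  note u' = X.J.HomD[OF u]
  have "\<phi> m \<in> hom_colim C0 (index Y) (diagram Y) (ind_at X m)"
    by (rule ind_homD(2)[OF \<phi> u'(5)])
  then have "\<phi> m \<subseteq> (SIGMA j:Obj (index Y). Hom C0 (ind_at X m) (ind_at Y j))"
    unfolding hom_colim_def by (rule in_quotient_imp_subset[OF Y.equiv_rel])
  then have "d \<in> Obj (index Y)" "k \<in> Hom C0 (ind_at X m) (ind_at Y d)"
    using k by auto
  then have refl: "((d, k \<bullet>\<^bsub>C0\<^esub> farr (diagram X) u), (d, k \<bullet>\<^bsub>C0\<^esub> farr (diagram X) u)) \<in> ?R"
    using C0.comp_closed[OF X.D.farr_closed[OF u]] by (intro Y.rel_refl)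
  have "(d, k \<bullet>\<^bsub>C0\<^esub> farr (diagram X) u) \<in> (\<lambda>(b, f). (b, f \<bullet>\<^bsub>C0\<^esub> farr (diagram X) u)) ` \<phi> m"
    by (rule image_eqI[OF _ k]) simp
  from ImageI[OF refl this] have "(d, k \<bullet>\<^bsub>C0\<^esub> farr (diagram X) u) \<in> \<phi> a"
    by (simp only: ind_homD(3)[OF \<phi> u])
  moreover have "\<phi> a \<in> (SIGMA j:Obj (index Y). Hom C0 (ind_at X a) (ind_at Y j)) // ?R"
    using ind_homD(2)[OF \<phi> u'(4)] by (simp add: hom_colim_def)
  ultimately show ?thesis
    using g by (intro in_quotient_imp_in_rel[OF Y.equiv_rel]) simp_all
qed

lemma ind_hom_obtain:
  assumes Y: "Y \<in> Obj IndC" and \<phi>: "\<phi> \<in> ind_hom C0 X Y" and a: "a \<in> Obj (index X)"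
  obtains b f where "b \<in> Obj (index Y)" "f \<in> Hom C0 (ind_at X a) (ind_at Y b)" "(b, f) \<in> \<phi> a"
    "\<phi> a = ind_colim_rel C0 Y (ind_at X a) `` {(b, f)}"
proof -
  interpret Y: filtered_diagram "index Y" C0 "diagram Y"
    by (rule filtered_diagram_ind[OF Y])
  have "\<phi> a \<in> hom_colim C0 (index Y) (diagram Y) (ind_at X a)"
    by (rule ind_homD(2)[OF \<phi> a])
  then obtain b f where "b \<in> Obj (index Y)" "f \<in> Hom C0 (ind_at X a) (ind_at Y b)"
    "\<phi> a = ind_colim_rel C0 Y (ind_at X a) `` {(b, f)}"
    by (auto simp: hom_colim_def elim!: quotientE)
  then show ?thesis
    using that Y.rel_refl[of b f] by simp
qed

text \<open>Composition in \<open>ind_cat\<close> collects the composites of all representatives;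
  this evaluates it on one choice. Two choices are compared at a common stage \<open>m\<close>,
  where the restrictions of one representative \<open>k\<close> of \<open>\<phi> m\<close> are
  related to both.\<close>

lemma comp_germ:
  assumes \<phi>: "(X, Y, \<phi>) \<in> Hom IndC X Y" and a: "a \<in> Obj (index X)" and f: "f \<in> Hom C0 Z (ind_at X a)"
    and bh: "(b, h) \<in> \<phi> a"
  shows "(X, Y, \<phi>) \<bullet>\<^bsub>IndC\<^esub> germ X Z a f = germ Y Z b (h \<bullet>\<^bsub>C0\<^esub> f)"
proof -
  have X: "X \<in> Obj IndC" and Y: "Y \<in> Obj IndC" and ih: "\<phi> \<in> ind_hom C0 X Y"
    using \<phi> by (auto simp only: IndC_Hom)
  interpret X: filtered_diagram "index X" C0 "diagram X"
    by (rule filtered_diagram_ind[OF X])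
  interpret Y: filtered_diagram "index Y" C0 "diagram Y"
    by (rule filtered_diagram_ind[OF Y])
  let ?R = "ind_colim_rel C0 Y Z"
  let ?S = "{(c, g \<bullet>\<^bsub>C0\<^esub> f') | a' c f' g. (a', f') \<in> ind_colim_rel C0 X Z `` {(a, f)} \<and> (c, g) \<in> \<phi> a'}"
  have rel: "((b, h \<bullet>\<^bsub>C0\<^esub> f), (c, g \<bullet>\<^bsub>C0\<^esub> f')) \<in> ?R"
    if r: "((a, f), (a', f')) \<in> ind_colim_rel C0 X Z" and cg: "(c, g) \<in> \<phi> a'" for a' f' c g
  proof -
    obtain m u v where m: "a' \<in> Obj (index X)" "f' \<in> Hom C0 Z (ind_at X a')" "m \<in> Obj (index X)"
      "u \<in> Hom (index X) a m" "v \<in> Hom (index X) a' m"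
      "farr (diagram X) u \<bullet>\<^bsub>C0\<^esub> f = farr (diagram X) v \<bullet>\<^bsub>C0\<^esub> f'"
      using r by (rule hom_colim_relE)
    obtain d k where k: "k \<in> Hom C0 (ind_at X m) (ind_at Y d)" "(d, k) \<in> \<phi> m"
      using ind_hom_obtain[OF Y ih m(3)] by metis
    have "((b, h \<bullet>\<^bsub>C0\<^esub> f), (d, (k \<bullet>\<^bsub>C0\<^esub> farr (diagram X) u) \<bullet>\<^bsub>C0\<^esub> f)) \<in> ?R"
      by (rule Y.rel_precomp[OF ind_hom_natural[OF Y X ih m(4) k(2) bh] f])
    moreover have "((c, g \<bullet>\<^bsub>C0\<^esub> f'), (d, (k \<bullet>\<^bsub>C0\<^esub> farr (diagram X) v) \<bullet>\<^bsub>C0\<^esub> f')) \<in> ?R"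
      by (rule Y.rel_precomp[OF ind_hom_natural[OF Y X ih m(5) k(2) cg] m(2)])
    moreover have "(k \<bullet>\<^bsub>C0\<^esub> farr (diagram X) u) \<bullet>\<^bsub>C0\<^esub> f = (k \<bullet>\<^bsub>C0\<^esub> farr (diagram X) v) \<bullet>\<^bsub>C0\<^esub> f'"
      using C0.comp_assoc[OF f X.D.farr_closed[OF m(4)] k(1)]
        C0.comp_assoc[OF m(2) X.D.farr_closed[OF m(5)] k(1)] m(6) by simp
    ultimately show ?thesis
      using Y.rel_sym Y.rel_trans by metis
  qed
  have "h \<in> Hom C0 (ind_at X a) (ind_at Y b)" "b \<in> Obj (index Y)"
    using ind_hom_natural[OF Y X ih X.J.idn_closed[OF a] bh bh] by (auto elim: hom_colim_relE)
  then have "b \<in> Obj (index Y)" "h \<bullet>\<^bsub>C0\<^esub> f \<in> Hom C0 Z (ind_at Y b)"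
    using C0.comp_closed[OF f] by auto
  then have cl: "?R `` {(b, h \<bullet>\<^bsub>C0\<^esub> f)} \<in> (SIGMA j:Obj (index Y). Hom C0 Z (ind_at Y j)) // ?R"
    by (intro quotientI) simp
  have "?R `` ?S = ?R `` {(b, h \<bullet>\<^bsub>C0\<^esub> f)}"
  proof (rule equiv_Image_class[OF Y.equiv_rel cl])
    show "?S \<subseteq> ?R `` {(b, h \<bullet>\<^bsub>C0\<^esub> f)}"
      using rel by auto
    show "?S \<noteq> {}"
      using X.rel_refl[OF a f] bh by blast
  qed
  then show ?thesis
    unfolding germ_def IndC_comp by (auto simp: fun_eq_iff restrict_def)
qed

text \<open>\<open>undefined\<close> is the only stage of a constant ind-object.\<close>

lemma embed_eq_germ: "f \<in> Hom C0 Z Z' \<Longrightarrow> embed f = germ (const Z') Z undefined f"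
  using C0.HomD[of f Z Z'] by (simp add: ind_embedding_def germ_def fun_eq_iff restrict_def)

lemma fobj_embedding [simp]: "fobj (ind_embedding C0) = const"
  by (simp add: ind_embedding_def)

lemma embed_closed: "f \<in> Hom C0 Z Z' \<Longrightarrow> embed f \<in> Hom IndC (const Z) (const Z')"
  using germ_closed[OF const_obj] C0.HomD(5) by (simp add: embed_eq_germ)

lemma embed_bij:
  assumes Z: "Z \<in> Obj C0" "Z' \<in> Obj C0"
  shows "bij_betw embed (Hom C0 Z Z') (Hom IndC (const Z) (const Z'))"
  unfolding bij_betw_def
proof
  have eq: "f = g" if "f \<in> Hom C0 Z Z'" "g \<in> Hom C0 Z Z'" "embed f = embed g" for f g
  proof -
    have "((undefined, f), (undefined, g)) \<in> ind_colim_rel C0 (const Z') Z"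
      using that germ_eq_iff[OF const_obj[OF Z(2)], of undefined f Z undefined g] by (simp add: embed_eq_germ)
    then have "Idn C0 Z' \<bullet>\<^bsub>C0\<^esub> f = Idn C0 Z' \<bullet>\<^bsub>C0\<^esub> g"
      by (auto elim: hom_colim_relE)
    then show ?thesis
      using C0.idn_left[OF that(1)] C0.idn_left[OF that(2)] by simp
  qed
  then show "inj_on embed (Hom C0 Z Z')"
    by (blast intro: inj_onI)
  show "embed ` Hom C0 Z Z' = Hom IndC (const Z) (const Z')"
  proof (intro equalityI subsetI)
    fix h assume "h \<in> Hom IndC (const Z) (const Z')"
    then obtain a f where "a \<in> Obj (index (const Z'))" "f \<in> Hom C0 Z (ind_at (const Z') a)" "h = germ (const Z') Z a f"
      by (rule germ_surj)
    then show "h \<in> embed ` Hom C0 Z Z'"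
      using embed_eq_germ[of f Z Z'] by (intro image_eqI[of _ _ f]) auto
  qed (auto intro: embed_closed)
qed

section \<open>An ind-object as the colimit of its own diagram\<close>

definition coproj :: "('i, 'o, 'a) ind_object \<Rightarrow> 'i \<Rightarrow> ('i, 'o, 'a) ind_arrow" where
  "coproj X a = germ X (ind_at X a) a (Idn C0 (ind_at X a))"

context
  fixes X assumes X: "X \<in> Obj IndC"
begin

interpretation X: filtered_diagram "index X" C0 "diagram X"
  by (rule filtered_diagram_ind[OF X])

lemma coproj_closed: "a \<in> Obj (index X) \<Longrightarrow> coproj X a \<in> Hom IndC (const (ind_at X a)) X"
  unfolding coproj_def using germ_closed[OF X] C0.idn_closed X.D.fobj_closed by blast

lemma comp_coproj:
  assumes \<phi>: "(X, Y, \<phi>) \<in> Hom IndC X Y" and a: "a \<in> Obj (index X)"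
    and b: "(b, h) \<in> \<phi> a" "h \<in> Hom C0 (ind_at X a) (ind_at Y b)"
  shows "(X, Y, \<phi>) \<bullet>\<^bsub>IndC\<^esub> coproj X a = germ Y (ind_at X a) b h"
  unfolding coproj_def using comp_germ[OF \<phi> a C0.idn_closed[OF X.D.fobj_closed[OF a]] b(1)] C0.idn_right[OF b(2)]
  by simp

lemma germ_eq_coproj:
  assumes a: "a \<in> Obj (index X)" and f: "f \<in> Hom C0 Z (ind_at X a)"
  shows "coproj X a \<bullet>\<^bsub>IndC\<^esub> embed f = germ X Z a f"
proof -
  let ?i = "Idn C0 (ind_at X a)"
  have i: "?i \<in> Hom C0 (ind_at X a) (ind_at X a)"
    using C0.idn_closed[OF X.D.fobj_closed[OF a]] .
  let ?\<phi> = "\<lambda>_\<in>Obj point_cat. ind_colim_rel C0 X (ind_at X a) `` {(a, ?i)}"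
  have eq: "coproj X a = (const (ind_at X a), X, ?\<phi>)"
    by (simp add: coproj_def germ_def)
  have "(const (ind_at X a), X, ?\<phi>) \<bullet>\<^bsub>IndC\<^esub> germ (const (ind_at X a)) Z undefined f = germ X Z a (?i \<bullet>\<^bsub>C0\<^esub> f)"
    using coproj_closed[OF a] f X.rel_refl[OF a i] unfolding eq by (intro comp_germ) auto
  then show ?thesis
    using C0.idn_left[OF f] embed_eq_germ[OF f] eq by simp
qed

lemma coproj_cocone: "is_cocone (index X) IndC (comp_funct (ind_embedding C0) (diagram X)) X (coproj X)"
proof (rule is_coconeI)
  show "X \<in> Obj IndC" by (rule X)
  show "coproj X a \<in> Hom IndC (fobj (comp_funct (ind_embedding C0) (diagram X)) a) X" if "a \<in> Obj (index X)" for a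
    using coproj_closed[OF that] by simp
  fix u assume "u \<in> Arr (index X)"
  then obtain a b where u: "u \<in> Hom (index X) a b" "a = Src (index X) u" "b = Tgt (index X) u"
    using X.J.arr_iff_Hom by blast
  note ab = X.J.HomD(4,5)[OF u(1)]
  have i: "Idn C0 (ind_at X a) \<in> Hom C0 (ind_at X a) (ind_at X a)"
    using C0.idn_closed[OF X.D.fobj_closed[OF ab(1)]] .
  have xu: "farr (diagram X) u \<in> Hom C0 (ind_at X a) (ind_at X b)"
    using X.D.farr_closed[OF u(1)] .
  have "coproj X b \<bullet>\<^bsub>IndC\<^esub> embed (farr (diagram X) u) = germ X (ind_at X a) b (farr (diagram X) u)"
    by (rule germ_eq_coproj[OF ab(2) xu])
  also have "\<dots> = coproj X a"
    unfolding coproj_def germ_eq_iff[OF X ab(2) xu ab(1) i]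
    using X.rel_sym[OF X.rel_shift[OF u(1) i]] C0.idn_right[OF xu] by simp
  finally show "coproj X (Tgt (index X) u) \<bullet>\<^bsub>IndC\<^esub> farr (comp_funct (ind_embedding C0) (diagram X)) u
      = coproj X (Src (index X) u)"
    using u(2,3) by simp
qed

text \<open>The legs of a cocone on constant objects are germs; choosing a representative of each
  gives the family \<open>\<phi>\<close>. Its compatibility is the cocone equation, translated by
  \<open>germ_eq_iff\<close>.\<close>

lemma hom_from_cocone:
  assumes e: "is_cocone (index X) IndC (comp_funct (ind_embedding C0) (diagram X)) Y e"
  obtains h where "h \<in> Hom IndC X Y" "\<And>a. a \<in> Obj (index X) \<Longrightarrow> h \<bullet>\<^bsub>IndC\<^esub> coproj X a = e a"
proof -
  have Y: "Y \<in> Obj IndC"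
    using is_coconeD(1)[OF e] .
  interpret Y: filtered_diagram "index Y" C0 "diagram Y"
    by (rule filtered_diagram_ind[OF Y])
  have e_closed: "e a \<in> Hom IndC (const (ind_at X a)) Y" if "a \<in> Obj (index X)" for a
    using is_coconeD(2)[OF e that] by simp
  have "\<forall>a\<in>Obj (index X). \<exists>b f. b \<in> Obj (index Y) \<and> f \<in> Hom C0 (ind_at X a) (ind_at Y b) \<and> e a = germ Y (ind_at X a) b f"
    using germ_surj[OF e_closed] by metis
  then obtain b f where bf: "\<And>a. a \<in> Obj (index X) \<Longrightarrow> b a \<in> Obj (index Y)"
    "\<And>a. a \<in> Obj (index X) \<Longrightarrow> f a \<in> Hom C0 (ind_at X a) (ind_at Y (b a))"
    "\<And>a. a \<in> Obj (index X) \<Longrightarrow> e a = germ Y (ind_at X a) (b a) (f a)"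
    by metis
  let ?R = "\<lambda>a. ind_colim_rel C0 Y (ind_at X a)"
  define \<phi> where "\<phi> = (\<lambda>a\<in>Obj (index X). ?R a `` {(b a, f a)})"
  have cl: "?R a `` {(b a, f a)} \<in> hom_colim C0 (index Y) (diagram Y) (ind_at X a)" if "a \<in> Obj (index X)" for a
    unfolding hom_colim_def using bf(1,2)[OF that] by (intro quotientI) simp
  have nat: "?R a `` ((\<lambda>(c, g). (c, g \<bullet>\<^bsub>C0\<^esub> farr (diagram X) u)) ` \<phi> m) = \<phi> a"
    if u: "u \<in> Hom (index X) a m" for u a m
  proof -
    note am = X.J.HomD(4,5)[OF u]
    have xu: "farr (diagram X) u \<in> Hom C0 (ind_at X a) (ind_at X m)"
      using X.D.farr_closed[OF u] .
    have "germ Y (ind_at X a) (b m) (f m \<bullet>\<^bsub>C0\<^esub> farr (diagram X) u) = e m \<bullet>\<^bsub>IndC\<^esub> embed (farr (diagram X) u)"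
    proof -
      let ?\<psi> = "\<lambda>_\<in>Obj point_cat. ?R m `` {(b m, f m)}"
      have eq: "e m = (const (ind_at X m), Y, ?\<psi>)"
        using bf(3)[OF am(2)] by (simp add: germ_def)
      have "(const (ind_at X m), Y, ?\<psi>) \<bullet>\<^bsub>IndC\<^esub> germ (const (ind_at X m)) (ind_at X a) undefined (farr (diagram X) u)
          = germ Y (ind_at X a) (b m) (f m \<bullet>\<^bsub>C0\<^esub> farr (diagram X) u)"
        using e_closed[OF am(2)] xu Y.rel_refl[OF bf(1,2)[OF am(2)]] unfolding eq by (intro comp_germ) auto
      then show ?thesis
        using embed_eq_germ[OF xu] eq by simp
    qed
    also have "\<dots> = germ Y (ind_at X a) (b a) (f a)"
      using is_coconeD(3)[OF e u] bf(3)[OF am(1)] by simp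
    finally have r: "((b m, f m \<bullet>\<^bsub>C0\<^esub> farr (diagram X) u), (b a, f a)) \<in> ?R a"
      using germ_eq_iff[OF Y bf(1)[OF am(2)] C0.comp_closed[OF xu bf(2)[OF am(2)]] bf(1,2)[OF am(1)]] by simp
    have "?R a `` ((\<lambda>(c, g). (c, g \<bullet>\<^bsub>C0\<^esub> farr (diagram X) u)) ` (?R m `` {(b m, f m)})) = ?R a `` {(b a, f a)}"
    proof (rule equiv_Image_class[OF Y.equiv_rel cl[OF am(1), unfolded hom_colim_def]])
      show "(\<lambda>(c, g). (c, g \<bullet>\<^bsub>C0\<^esub> farr (diagram X) u)) ` (?R m `` {(b m, f m)}) \<subseteq> ?R a `` {(b a, f a)}"
      proof
        fix x assume "x \<in> (\<lambda>(c, g). (c, g \<bullet>\<^bsub>C0\<^esub> farr (diagram X) u)) ` (?R m `` {(b m, f m)})"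
        then obtain c g where cg: "((b m, f m), (c, g)) \<in> ?R m" "x = (c, g \<bullet>\<^bsub>C0\<^esub> farr (diagram X) u)"
          by (elim imageE ImageE) (simp split: prod.splits)
        then show "x \<in> ?R a `` {(b a, f a)}"
          using Y.rel_trans[OF Y.rel_sym[OF r] Y.rel_precomp[OF cg(1) xu]] by simp
      qed
      show "(\<lambda>(c, g). (c, g \<bullet>\<^bsub>C0\<^esub> farr (diagram X) u)) ` (?R m `` {(b m, f m)}) \<noteq> {}"
        using Y.rel_refl[OF bf(1,2)[OF am(2)]] by blast
    qed
    then show ?thesis
      using am by (simp add: \<phi>_def)
  qed
  have "\<phi> \<in> ind_hom C0 X Y"
    unfolding ind_hom_def
  proof (intro CollectI conjI ballI)
    show "\<phi> \<in> (\<Pi>\<^sub>E a\<in>Obj (index X). hom_colim C0 (index Y) (diagram Y) (ind_at X a))"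
      using cl by (simp add: \<phi>_def)
    show "?R (Src (index X) u) `` ((\<lambda>(c, g). (c, g \<bullet>\<^bsub>C0\<^esub> farr (diagram X) u)) ` \<phi> (Tgt (index X) u))
        = \<phi> (Src (index X) u)" if "u \<in> Arr (index X)" for u
      using nat that X.J.arr_iff_Hom by blast
  qed
  then have h: "(X, Y, \<phi>) \<in> Hom IndC X Y"
    using X Y unfolding IndC_Hom by blast
  have "(X, Y, \<phi>) \<bullet>\<^bsub>IndC\<^esub> coproj X a = e a" if a: "a \<in> Obj (index X)" for a
    using comp_coproj[OF h a, of "b a" "f a"] Y.rel_refl[OF bf(1,2)[OF a]] bf(2,3)[OF a] a by (simp add: \<phi>_def)
  with h show ?thesis
    by (rule that)
qed

text \<open>Composing with \<open>coproj X a\<close> recovers the component at \<open>a\<close>, and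
  extensionality of the families settles the values outside the index set.\<close>

lemma hom_eqI:
  assumes h: "h \<in> Hom IndC X Y" and k: "k \<in> Hom IndC X Y"
    and eq: "\<And>a. a \<in> Obj (index X) \<Longrightarrow> h \<bullet>\<^bsub>IndC\<^esub> coproj X a = k \<bullet>\<^bsub>IndC\<^esub> coproj X a"
  shows "h = k"
proof -
  have Y: "Y \<in> Obj IndC"
    using h by (simp only: IndC_Hom)
  interpret Y: filtered_diagram "index Y" C0 "diagram Y"
    by (rule filtered_diagram_ind[OF Y])
  obtain \<phi> \<psi> where hk: "h = (X, Y, \<phi>)" "k = (X, Y, \<psi>)" and hom: "\<phi> \<in> ind_hom C0 X Y" "\<psi> \<in> ind_hom C0 X Y"
    using h k by (auto simp only: IndC_Hom)
  have "\<phi> = \<psi>"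
  proof (rule extensionalityI)
    show "\<phi> \<in> extensional (Obj (index X))" "\<psi> \<in> extensional (Obj (index X))"
      using ind_homD(1)[OF hom(1)] ind_homD(1)[OF hom(2)] by simp_all
    fix a assume a: "a \<in> Obj (index X)"
    obtain b f where b: "b \<in> Obj (index Y)" "f \<in> Hom C0 (ind_at X a) (ind_at Y b)" "(b, f) \<in> \<phi> a"
      "\<phi> a = ind_colim_rel C0 Y (ind_at X a) `` {(b, f)}"
      using ind_hom_obtain[OF Y hom(1) a] .
    obtain c g where c: "c \<in> Obj (index Y)" "g \<in> Hom C0 (ind_at X a) (ind_at Y c)" "(c, g) \<in> \<psi> a"
      "\<psi> a = ind_colim_rel C0 Y (ind_at X a) `` {(c, g)}"
      using ind_hom_obtain[OF Y hom(2) a] .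
    have "germ Y (ind_at X a) b f = germ Y (ind_at X a) c g"
      using comp_coproj[OF h[unfolded hk] a b(3,2)] comp_coproj[OF k[unfolded hk] a c(3,2)] eq[OF a] hk by simp
    then have "((b, f), (c, g)) \<in> ind_colim_rel C0 Y (ind_at X a)"
      using germ_eq_iff[OF Y b(1,2) c(1,2)] by simp
    then show "\<phi> a = \<psi> a"
      using equiv_class_eq[OF Y.equiv_rel] b(4) c(4) by simp
  qed
  then show ?thesis
    using hk by simp
qed

lemma coproj_colimit: "is_colimit (index X) IndC (comp_funct (ind_embedding C0) (diagram X)) X (coproj X)"
  unfolding is_colimit_def
proof (intro conjI allI impI)
  fix Y e assume "is_cocone (index X) IndC (comp_funct (ind_embedding C0) (diagram X)) Y e"
  then obtain h where h: "h \<in> Hom IndC X Y" "\<And>a. a \<in> Obj (index X) \<Longrightarrow> h \<bullet>\<^bsub>IndC\<^esub> coproj X a = e a"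
    using hom_from_cocone by blast
  show "\<exists>!h. h \<in> Hom IndC X Y \<and> (\<forall>a\<in>Obj (index X). h \<bullet>\<^bsub>IndC\<^esub> coproj X a = e a)"
  proof (rule ex1I)
    show "h \<in> Hom IndC X Y \<and> (\<forall>a\<in>Obj (index X). h \<bullet>\<^bsub>IndC\<^esub> coproj X a = e a)"
      using h by simp
    fix k assume k: "k \<in> Hom IndC X Y \<and> (\<forall>a\<in>Obj (index X). k \<bullet>\<^bsub>IndC\<^esub> coproj X a = e a)"
    show "k = h"
      using k h(2) by (intro hom_eqI[OF _ h(1)]) simp_all
  qed
qed (rule coproj_cocone)

lemma hom_const_factor:
  assumes h: "h \<in> Hom IndC (const Z) X"
  obtains a f where "a \<in> Obj (index X)" "f \<in> Hom C0 Z (ind_at X a)" "coproj X a \<bullet>\<^bsub>IndC\<^esub> embed f = h"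
proof -
  obtain a f where "a \<in> Obj (index X)" "f \<in> Hom C0 Z (ind_at X a)" "h = germ X Z a f"
    using germ_surj[OF h] .
  then show ?thesis
    using that germ_eq_coproj[of a f Z] by simp
qed

lemma hom_const_separate:
  assumes a: "a \<in> Obj (index X)" and f: "f \<in> Hom C0 Z (ind_at X a)" and g: "g \<in> Hom C0 Z (ind_at X a)"
    and eq: "coproj X a \<bullet>\<^bsub>IndC\<^esub> embed f = coproj X a \<bullet>\<^bsub>IndC\<^esub> embed g"
  obtains b u where "b \<in> Obj (index X)" "u \<in> Hom (index X) a b"
    "farr (diagram X) u \<bullet>\<^bsub>C0\<^esub> f = farr (diagram X) u \<bullet>\<^bsub>C0\<^esub> g"
proof -
  have "((a, f), (a, g)) \<in> ind_colim_rel C0 X Z"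
    using eq germ_eq_coproj[OF a f] germ_eq_coproj[OF a g] germ_eq_iff[OF X a f a g] by simp
  then show ?thesis
    by (rule X.rel_same_index) (rule that)
qed

end

end

section \<open>Compactness of the unit object\<close>

context category
begin

lemma inv_comp_cancel:
  assumes i: "iso_arrow C i" "i \<in> Hom C X Y" and f: "f \<in> Hom C Z Y"
  shows "i \<bullet> (inv_arrow C i \<bullet> f) = f"
  using comp_assoc[OF f inv_arrow(1)[OF i] i(2)] inv_arrow(3)[OF i] idn_left[OF f] by simp

lemma comp_inv_cancel:
  assumes i: "iso_arrow C i" "i \<in> Hom C X Y" and f: "f \<in> Hom C Z X"
  shows "inv_arrow C i \<bullet> (i \<bullet> f) = f"
  using comp_assoc[OF f i(2) inv_arrow(1)[OF i]] inv_arrow(2)[OF i] idn_left[OF f] by simp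

lemma is_colimit_iso:
  assumes L: "is_colimit K C D L c" and i: "iso_arrow C i" "i \<in> Hom C L L'"
    and D: "\<And>u. u \<in> Arr K \<Longrightarrow> farr D u \<in> Hom C (fobj D (Src K u)) (fobj D (Tgt K u))"
    and K: "\<And>u. u \<in> Arr K \<Longrightarrow> Src K u \<in> Obj K \<and> Tgt K u \<in> Obj K"
  shows "is_colimit K C D L' (\<lambda>k. i \<bullet> c k)"
proof -
  let ?i = "inv_arrow C i"
  note c = is_coconeD[OF is_colimitD(1)[OF L]]
  note inv = inv_arrow[OF i]
  show ?thesis
    unfolding is_colimit_def
  proof (intro conjI allI impI)
    show "is_cocone K C D L' (\<lambda>k. i \<bullet> c k)"
    proof (rule is_coconeI)
      fix u assume u: "u \<in> Arr K"
      then have "u \<in> Hom K (Src K u) (Tgt K u)"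
        by (simp add: Hom_def)
      then show "i \<bullet> c (Tgt K u) \<bullet> farr D u = i \<bullet> c (Src K u)"
        using comp_assoc[OF D[OF u] c(2) i(2)] K[OF u] c(3) by simp
    qed (use HomD[OF i(2)] comp_closed[OF c(2) i(2)] in auto)
    fix M d assume d: "is_cocone K C D M d"
    obtain h where h: "h \<in> Hom C L M" "\<forall>k\<in>Obj K. h \<bullet> c k = d k"
      using is_colimitD(2)[OF L d] by blast
    show "\<exists>!h. h \<in> Hom C L' M \<and> (\<forall>k\<in>Obj K. h \<bullet> (i \<bullet> c k) = d k)"
    proof (rule ex1I[of _ "h \<bullet> ?i"], intro conjI ballI)
      show "h \<bullet> ?i \<in> Hom C L' M"
        by (rule comp_closed[OF inv(1) h(1)])
      show "h \<bullet> ?i \<bullet> (i \<bullet> c k) = d k" if k: "k \<in> Obj K" for k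
        using comp_assoc[OF comp_closed[OF c(2)[OF k] i(2)] inv(1) h(1)] comp_inv_cancel[OF i c(2)[OF k]]
          bspec[OF h(2) k] by simp
      fix g assume g: "g \<in> Hom C L' M \<and> (\<forall>k\<in>Obj K. g \<bullet> (i \<bullet> c k) = d k)"
      have "g \<bullet> i = h"
      proof (rule is_colimit_unique[OF L comp_closed[OF i(2)] h(1) D K])
        show "g \<bullet> i \<bullet> c k = h \<bullet> c k" if k: "k \<in> Obj K" for k
          using comp_assoc[OF c(2)[OF k] i(2), of g M] g bspec[OF h(2) k] k by simp
      qed (use g in auto)
      then show "g = h \<bullet> ?i"
        using comp_assoc[OF inv(1) i(2), of g M] g inv(3) idn_right by auto
    qed
  qed
qed

lemma presentation_iso:
  assumes p: "presentation C0 C F K G L \<gamma>" and i: "iso_arrow C i" "i \<in> Hom C L L'"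
    and F: "cat_functor C0 C F" and G: "cat_functor K C0 G"
  shows "presentation C0 C F K G L' (\<lambda>k. i \<bullet> \<gamma> k)"
proof -
  interpret F: cat_functor C0 C F by (fact F)
  interpret G: cat_functor K C0 G by (fact G)
  note L = presentationD(1)[OF p]
  note inv = inv_arrow[OF i]
  have \<gamma>: "\<gamma> k \<in> Hom C (fobj F (fobj G k)) L" if "k \<in> Obj K" for k
    using is_coconeD(2)[OF is_colimitD(1)[OF L] that] by simp
  show ?thesis
    unfolding presentation_def
  proof (intro conjI ballI impI)
    show "is_colimit K C (comp_funct F G) L' (\<lambda>k. i \<bullet> \<gamma> k)"
      by (rule is_colimit_iso[OF L i])
        (auto intro!: HomI G.D.src_closed G.D.tgt_closed)
  next
    fix X f assume X: "X \<in> Obj C0" and f: "f \<in> Hom C (fobj F X) L'"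
    obtain k g where kg: "k \<in> Obj K" "g \<in> Hom C0 X (fobj G k)" "\<gamma> k \<bullet> farr F g = inv_arrow C i \<bullet> f"
      using presentationD(2)[OF p X comp_closed[OF f inv(1)]] by blast
    have "i \<bullet> \<gamma> k \<bullet> farr F g = f"
      using comp_assoc[OF F.farr_closed[OF kg(2)] \<gamma>[OF kg(1)] i(2)] kg(3) inv_comp_cancel[OF i f] by simp
    then show "\<exists>k\<in>Obj K. \<exists>g\<in>Hom C0 X (fobj G k). i \<bullet> \<gamma> k \<bullet> farr F g = f"
      using kg(1,2) by blast
  next
    fix X k g g' assume *: "X \<in> Obj C0" "k \<in> Obj K" and g: "g \<in> Hom C0 X (fobj G k)" "g' \<in> Hom C0 X (fobj G k)"
      and eq: "i \<bullet> \<gamma> k \<bullet> farr F g = i \<bullet> \<gamma> k \<bullet> farr F g'"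
    have "\<gamma> k \<bullet> farr F g = \<gamma> k \<bullet> farr F g'"
    proof (rule iso_mono[OF i])
      show "\<gamma> k \<bullet> farr F g \<in> Hom C (fobj F X) L" "\<gamma> k \<bullet> farr F g' \<in> Hom C (fobj F X) L"
        using comp_closed[OF F.farr_closed[OF g(1)] \<gamma>[OF *(2)]] comp_closed[OF F.farr_closed[OF g(2)] \<gamma>[OF *(2)]] .
      show "i \<bullet> (\<gamma> k \<bullet> farr F g) = i \<bullet> (\<gamma> k \<bullet> farr F g')"
        using eq comp_assoc[OF F.farr_closed[OF g(1)] \<gamma>[OF *(2)] i(2)]
          comp_assoc[OF F.farr_closed[OF g(2)] \<gamma>[OF *(2)] i(2)] by simp
    qed
    then show "\<exists>l\<in>Obj K. \<exists>t\<in>Hom K k l. farr G t \<bullet>\<^bsub>C0\<^esub> g = farr G t \<bullet>\<^bsub>C0\<^esub> g'"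
      by (rule presentationD(3)[OF p * g])
  qed
qed

end

section \<open>Colimits under an equivalence of categories\<close>

context equivalence_functor
begin

lemma faithful:
  assumes "f \<in> Hom D X Y" "g \<in> Hom D X Y" "farr F f = farr F g"
  shows "f = g"
  using fully_faithful[of X Y] D.HomD[OF assms(1)] assms by (auto simp: bij_betw_def dest: inj_onD)

lemma full:
  assumes "X \<in> Obj D" "Y \<in> Obj D" "g \<in> Hom E (fobj F X) (fobj F Y)"
  obtains f where "f \<in> Hom D X Y" "farr F f = g"
proof -
  have "g \<in> farr F ` Hom D X Y"
    using assms(3) bij_betw_imp_surj_on[OF fully_faithful[OF assms(1,2)]] by simp
  then show ?thesis
    using that by blast
qed

text \<open>The target \<open>M\<close> of a cocone is only isomorphic to the image of some
  \<open>M'\<close>. The cocone is moved there by the inverse of \<open>i\<close> and lifted by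
  fullness, its equations by faithfulness; the comparison arrow returns through \<open>F\<close> and
  \<open>i\<close>.\<close>

lemma preserves_colimit:
  assumes L: "is_colimit K D H L c"
    and H: "\<And>u. u \<in> Arr K \<Longrightarrow> farr H u \<in> Hom D (fobj H (Src K u)) (fobj H (Tgt K u))"
    and K: "\<And>u. u \<in> Arr K \<Longrightarrow> Src K u \<in> Obj K \<and> Tgt K u \<in> Obj K"
  shows "is_colimit K E (comp_funct F H) (fobj F L) (\<lambda>k. farr F (c k))"
proof -
  note c = is_coconeD[OF is_colimitD(1)[OF L]]
  have Hk: "fobj H k \<in> Obj D" if "k \<in> Obj K" for k
    using D.HomD(4)[OF c(2)[OF that]] .
  show ?thesis
    unfolding is_colimit_def
  proof (intro conjI allI impI)
    show "is_cocone K E (comp_funct F H) (fobj F L) (\<lambda>k. farr F (c k))"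
    proof (rule is_coconeI)
      show "fobj F L \<in> Obj E"
        using c(1) by simp
      show "farr F (c k) \<in> Hom E (fobj (comp_funct F H) k) (fobj F L)" if "k \<in> Obj K" for k
        using farr_closed[OF c(2)[OF that]] by simp
      fix u assume u: "u \<in> Arr K"
      then have "u \<in> Hom K (Src K u) (Tgt K u)"
        by (simp add: Hom_def)
      then show "farr F (c (Tgt K u)) \<bullet>\<^bsub>E\<^esub> farr (comp_funct F H) u = farr F (c (Src K u))"
        using farr_comp[OF H[OF u] c(2)] K[OF u] c(3) by simp
    qed
    fix M d assume "is_cocone K E (comp_funct F H) M d"
    note d = is_coconeD[OF this]
    obtain M' i where M': "M' \<in> Obj D" and i: "iso_arrow E i" "i \<in> Hom E (fobj F M') M"
      using essentially_surjective[OF d(1)] by blast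
    let ?i = "inv_arrow E i"
    note inv = E.inv_arrow[OF i]
    have dk: "d k \<in> Hom E (fobj F (fobj H k)) M" if "k \<in> Obj K" for k
      using d(2)[OF that] by simp
    have "\<forall>k\<in>Obj K. \<exists>e. e \<in> Hom D (fobj H k) M' \<and> farr F e = ?i \<bullet>\<^bsub>E\<^esub> d k"
    proof
      fix k assume k: "k \<in> Obj K"
      show "\<exists>e. e \<in> Hom D (fobj H k) M' \<and> farr F e = ?i \<bullet>\<^bsub>E\<^esub> d k"
        using full[OF Hk[OF k] M' E.comp_closed[OF dk[OF k] inv(1)]] by blast
    qed
    then obtain e where e: "\<forall>k\<in>Obj K. e k \<in> Hom D (fobj H k) M' \<and> farr F (e k) = ?i \<bullet>\<^bsub>E\<^esub> d k"
      by (rule bchoice[THEN exE])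
    have e_closed: "e k \<in> Hom D (fobj H k) M'" and e_eq: "farr F (e k) = ?i \<bullet>\<^bsub>E\<^esub> d k"
      if "k \<in> Obj K" for k
      using bspec[OF e that] by auto
    have "is_cocone K D H M' e"
    proof (rule is_coconeI)
      fix u assume u: "u \<in> Arr K"
      then have u': "u \<in> Hom K (Src K u) (Tgt K u)"
        by (simp add: Hom_def)
      have st: "Src K u \<in> Obj K" "Tgt K u \<in> Obj K"
        using K[OF u] by auto
      show "e (Tgt K u) \<bullet>\<^bsub>D\<^esub> farr H u = e (Src K u)"
      proof (rule faithful[OF D.comp_closed[OF H[OF u] e_closed[OF st(2)]] e_closed[OF st(1)]])
        have "farr F (e (Tgt K u) \<bullet>\<^bsub>D\<^esub> farr H u) = ?i \<bullet>\<^bsub>E\<^esub> d (Tgt K u) \<bullet>\<^bsub>E\<^esub> farr F (farr H u)"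
          using farr_comp[OF H[OF u] e_closed[OF st(2)]] e_eq[OF st(2)] by simp
        also have "\<dots> = ?i \<bullet>\<^bsub>E\<^esub> d (Src K u)"
          using E.comp_assoc[OF farr_closed[OF H[OF u]] dk[OF st(2)] inv(1)] d(3)[OF u'] by simp
        finally show "farr F (e (Tgt K u) \<bullet>\<^bsub>D\<^esub> farr H u) = farr F (e (Src K u))"
          using e_eq[OF st(1)] by simp
      qed
    qed (use M' e_closed in auto)
    from is_colimitD(2)[OF L this]
    obtain h where h: "h \<in> Hom D L M'" "\<forall>k\<in>Obj K. h \<bullet>\<^bsub>D\<^esub> c k = e k"
      by blast
    have Fh: "farr F h \<in> Hom E (fobj F L) (fobj F M')"
      by (rule farr_closed[OF h(1)])
    show "\<exists>!h. h \<in> Hom E (fobj F L) M \<and> (\<forall>k\<in>Obj K. h \<bullet>\<^bsub>E\<^esub> farr F (c k) = d k)"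
    proof (rule ex1I[of _ "i \<bullet>\<^bsub>E\<^esub> farr F h"], intro conjI ballI)
      show "i \<bullet>\<^bsub>E\<^esub> farr F h \<in> Hom E (fobj F L) M"
        by (rule E.comp_closed[OF Fh i(2)])
      show "i \<bullet>\<^bsub>E\<^esub> farr F h \<bullet>\<^bsub>E\<^esub> farr F (c k) = d k" if k: "k \<in> Obj K" for k
        using E.comp_assoc[OF farr_closed[OF c(2)[OF k]] Fh i(2)] farr_comp[OF c(2)[OF k] h(1)]
          bspec[OF h(2) k] e_eq[OF k] E.inv_comp_cancel[OF i dk[OF k]] by simp
      fix g assume "g \<in> Hom E (fobj F L) M \<and> (\<forall>k\<in>Obj K. g \<bullet>\<^bsub>E\<^esub> farr F (c k) = d k)"
      then have g: "g \<in> Hom E (fobj F L) M" "\<forall>k\<in>Obj K. g \<bullet>\<^bsub>E\<^esub> farr F (c k) = d k"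
        by auto
      obtain g' where g': "g' \<in> Hom D L M'" "farr F g' = ?i \<bullet>\<^bsub>E\<^esub> g"
        using full[OF c(1) M' E.comp_closed[OF g(1) inv(1)]] .
      have "g' = h"
      proof (rule D.is_colimit_unique[OF L g'(1) h(1) H K])
        fix k assume k: "k \<in> Obj K"
        show "g' \<bullet>\<^bsub>D\<^esub> c k = h \<bullet>\<^bsub>D\<^esub> c k"
        proof (rule faithful[OF D.comp_closed[OF c(2)[OF k] g'(1)] D.comp_closed[OF c(2)[OF k] h(1)]])
          show "farr F (g' \<bullet>\<^bsub>D\<^esub> c k) = farr F (h \<bullet>\<^bsub>D\<^esub> c k)"
            using farr_comp[OF c(2)[OF k] g'(1)] g'(2) bspec[OF h(2) k] e_eq[OF k] bspec[OF g(2) k]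
              E.comp_assoc[OF farr_closed[OF c(2)[OF k]] g(1) inv(1)] by simp
        qed
      qed
      then show "g = i \<bullet>\<^bsub>E\<^esub> farr F h"
        using g'(2) E.inv_comp_cancel[OF i g(1)] by simp
    qed
  qed
qed

end

section \<open>Presentations obtained from the equivalence with ind-objects\<close>

locale ind_equivalence = ind_objects C0 universe_type + \<Phi>: equivalence_functor IndC C \<Phi>
    + F: cat_functor C0 C "comp_funct \<Phi> (ind_embedding C0)"
  for C0 :: "('p, 'b, 'n) cat_scheme" and universe_type :: "'i itself"
    and C :: "('o, 'a, 'm) cat_scheme"
    and \<Phi> :: "(('i, 'p, 'b) ind_object, ('i, 'p, 'b) ind_arrow, 'o, 'a) funct" +
  assumes locally_small: "\<lbrakk>X \<in> Obj C0; Y \<in> Obj C0\<rbrakk> \<Longrightarrow> small TYPE('i) (Hom C0 X Y)"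
begin

abbreviation "F \<equiv> comp_funct \<Phi> (ind_embedding C0)"

text \<open>Within \<open>ind_cat\<close>, the object \<open>X\<close> is the colimit of its diagram
  and both clauses hold for arrows from constant objects. The equivalence \<open>\<Phi>\<close>
  preserves the colimit and, being fully faithful, carries the clauses over.\<close>

lemma presentation_ind_object:
  assumes X: "X \<in> Obj IndC"
  shows "presentation C0 C F (index X) (diagram X) (fobj \<Phi> X) (\<lambda>a. farr \<Phi> (coproj X a))"
  unfolding presentation_def
proof (intro conjI ballI impI)
  interpret X: filtered_diagram "index X" C0 "diagram X"
    by (rule filtered_diagram_ind[OF X])
  have assoc: "comp_funct F (diagram X) = comp_funct \<Phi> (comp_funct (ind_embedding C0) (diagram X))"
    by (simp add: comp_funct_def comp_assoc)
  show "is_colimit (index X) C (comp_funct F (diagram X)) (fobj \<Phi> X) (\<lambda>a. farr \<Phi> (coproj X a))"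
    unfolding assoc
  proof (rule \<Phi>.preserves_colimit[OF coproj_colimit[OF X]])
    show "farr (comp_funct (ind_embedding C0) (diagram X)) u
        \<in> Hom IndC (fobj (comp_funct (ind_embedding C0) (diagram X)) (Src (index X) u))
          (fobj (comp_funct (ind_embedding C0) (diagram X)) (Tgt (index X) u))" if "u \<in> Arr (index X)" for u
      using embed_closed[OF X.D.farr_closed] that X.J.arr_iff_Hom[of u] by simp
  qed (use X.J.src_closed X.J.tgt_closed in auto)
next
  fix Z f assume Z: "Z \<in> Obj C0" and f: "f \<in> Hom C (fobj F Z) (fobj \<Phi> X)"
  have f': "f \<in> Hom C (fobj \<Phi> (const Z)) (fobj \<Phi> X)"
    using f by simp
  obtain h where h: "h \<in> Hom IndC (const Z) X" "farr \<Phi> h = f"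
    using \<Phi>.full[OF const_obj[OF Z] X f'] .
  obtain a g where g: "a \<in> Obj (index X)" "g \<in> Hom C0 Z (ind_at X a)" "coproj X a \<bullet>\<^bsub>IndC\<^esub> embed g = h"
    using hom_const_factor[OF X h(1)] .
  have "farr \<Phi> (coproj X a) \<bullet>\<^bsub>C\<^esub> farr F g = f"
    using \<Phi>.farr_comp[OF embed_closed[OF g(2)] coproj_closed[OF X g(1)]] g(3) h(2) by simp
  then show "\<exists>k\<in>Obj (index X). \<exists>g\<in>Hom C0 Z (fobj (diagram X) k). farr \<Phi> (coproj X k) \<bullet>\<^bsub>C\<^esub> farr F g = f"
    using g(1,2) by blast
next
  fix Z a g g' assume Z: "Z \<in> Obj C0" and a: "a \<in> Obj (index X)"
    and g: "g \<in> Hom C0 Z (fobj (diagram X) a)" "g' \<in> Hom C0 Z (fobj (diagram X) a)"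
    and eq: "farr \<Phi> (coproj X a) \<bullet>\<^bsub>C\<^esub> farr F g = farr \<Phi> (coproj X a) \<bullet>\<^bsub>C\<^esub> farr F g'"
  note e = embed_closed[OF g(1)] embed_closed[OF g(2)]
  note p = coproj_closed[OF X a]
  have "coproj X a \<bullet>\<^bsub>IndC\<^esub> embed g = coproj X a \<bullet>\<^bsub>IndC\<^esub> embed g'"
    using \<Phi>.farr_comp[OF e(1) p] \<Phi>.farr_comp[OF e(2) p] eq
    by (intro \<Phi>.faithful[OF ind.comp_closed[OF e(1) p] ind.comp_closed[OF e(2) p]]) simp
  then obtain b u where "b \<in> Obj (index X)" "u \<in> Hom (index X) a b"
      "farr (diagram X) u \<bullet>\<^bsub>C0\<^esub> g = farr (diagram X) u \<bullet>\<^bsub>C0\<^esub> g'"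
    by (rule hom_const_separate[OF X a g])
  then show "\<exists>l\<in>Obj (index X). \<exists>t\<in>Hom (index X) a l. farr (diagram X) t \<bullet>\<^bsub>C0\<^esub> g = farr (diagram X) t \<bullet>\<^bsub>C0\<^esub> g'"
    by blast
qed

text \<open>Every object of \<open>C\<close> is isomorphic to the image of an ind-object, whose
  diagram presents it. Conversely, a small filtered diagram in \<open>C0\<close> is itself an
  ind-object, and its image under \<open>\<Phi>\<close> realizes it.\<close>

sublocale ind_generated C0 C F universe_type
proof
  fix X Y assume XY: "X \<in> Obj C0" "Y \<in> Obj C0"
  show "small TYPE('i) (Hom C0 X Y)"
    by (rule locally_small[OF XY])
  show "bij_betw (farr F) (Hom C0 X Y) (Hom C (fobj F X) (fobj F Y))"
    using bij_betw_trans[OF embed_bij[OF XY] \<Phi>.fully_faithful[OF const_obj[OF XY(1)] const_obj[OF XY(2)]]]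
    by (simp add: comp_funct_def)
next
  show "universe TYPE('i)"
    by (rule universe)
next
  fix L assume "L \<in> Obj C"
  then obtain X i where X: "X \<in> Obj IndC" and i: "iso_arrow C i" "i \<in> Hom C (fobj \<Phi> X) L"
    using \<Phi>.essentially_surjective by blast
  have X': "small_filtered (index X)" "cat_functor (index X) C0 (diagram X)"
    using X by auto
  show "\<exists>(K :: ('i, 'i) cat) G \<gamma>. small_filtered K \<and> cat_functor K C0 G \<and> presentation C0 C F K G L \<gamma>"
    using \<Phi>.E.presentation_iso[OF presentation_ind_object[OF X] i F.cat_functor_axioms X'(2)] X' by blast
next
  fix K :: "('i, 'i) cat" and G assume KG: "small_filtered K" "cat_functor K C0 G"
  then show "\<exists>L \<gamma>. presentation C0 C F K G L \<gamma>"
    using presentation_ind_object[of "\<lparr>index = K, diagram = G\<rparr>"] by auto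
qed

end

lemma (in ind_monoidal_category) unit_compact: "compact_object TYPE('i) C \<I>"
proof -
  interpret F: strong_symmetric_monoidal_functor C0 C "comp_funct \<Phi> (ind_embedding C0)" \<mu> \<epsilon>
    by (rule monoidal)
  interpret \<Phi>: equivalence_functor "ind_cat C0" C \<Phi>
    by (rule equivalence)
  interpret ind_equivalence C0 "TYPE('i)" C \<Phi>
    by unfold_locales (rule universe, rule locally_small)
  show ?thesis
    by (rule compact_object_iso_image[OF C0.unit_closed F.epsilon_closed F.epsilon_iso])
qed

theorem corollary3p3:
  fixes C :: "('o, 'a, 'm) sm_cat_scheme"
    and C0 :: "('p, 'b, 'n) sm_cat_scheme"
    and \<Phi> :: "(('i, 'p, 'b) ind_object, ('i, 'p, 'b) ind_arrow, 'o, 'a) funct"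
    and \<mu> :: "'p \<Rightarrow> 'p \<Rightarrow> 'a" and \<epsilon> :: "'a"
    and V :: "'o" and vac T :: "'a" and prd :: "int \<Rightarrow> 'a"
  assumes "ind_monoidal_category C C0 \<Phi> \<mu> \<epsilon>"
    and "vertex_algebra_in TYPE('i) C V vac T prd"
  shows "vertex_algebra_over (end_ring C) (hom_module C V) vac (\<lambda>\<alpha>. T \<bullet>\<^bsub>C\<^esub> \<alpha>) (hom_product C prd)"
  using vertex_algebra_in.hom_module_vertex_algebra[OF assms(2)]
    ind_monoidal_category.unit_compact[OF assms(1)] ind_monoidal_category.rationals[OF assms(1)] .

end
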